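(* For any positive integer $d$, the diameter of the $d$-dimensional cyclohedron is at least $5d/2-4\sqrt{d}-4$.
   Context: The diameter of a polytope is the diameter of its graph (vertices and edges of the polytope). The graph of the $d$-dimensional cyclohedron is described combinatorially (Simion) as follows, and this description may be taken as the definition. Let $\pi$ be a convex polygon with $2d+2$ vertices. An edge on $\pi$ is a set of two distinct vertices of $\pi$. For a vertex $x$, $\bar{x}$ denotes the opposite vertex (separated from $x$ by exactly $d$ vertices along the boundary on either side). A triangulation of $\pi$ is a maximal set of pairwise non-crossing edges on $\pi$; it contains all boundary edges, and its other edges are its interior edges. A triangulation $T$ is centrally symmetric when $\{x,y\}\in T$ implies $\{\bar{x},\bar{y}\}\in T$. The vertices of the graph are the centrally symmetric triangulations of $\pi$, and two of them are adjacent when they are related by a flip: given an interior edge $\{x,x'\}$ of $T$, let $y,y'$ be the other two vertices of the unique quadrilateral whose four boundary edges belong to $T$ and that has $\{x,x'\}$ as one of its diagonals; flipping $\{x,x'\}$ replaces $\{x,x'\}$ and $\{\bar{x},\bar{x}'\}$ by $\{y,y'\}$ and $\{\bar{y},\bar{y}'\}$. *)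

theory Defs
  imports "Graph_Theory.Pair_Digraph" "Graph_Theory.Shortest_Path"
begin

text \<open>
  The diameter is an extended real: it is infinite when some vertex cannot be reached
  from another one.
\<close>

definition graph_diameter :: "('a, 'b) pre_digraph \<Rightarrow> ereal" where
  "graph_diameter G = (SUP u\<in>verts G. SUP v\<in>verts G. wf_digraph.\<mu> G (\<lambda>_. 1) u v)"

text \<open>
  The vertices of a convex polygon with \<open>n\<close> vertices are labelled \<open>0, \<dots>, n - 1\<close> in their
  cyclic order along the boundary.
\<close>

definition polygon_edges :: "nat \<Rightarrow> nat set set" where
  "polygon_edges n = {{x, y} | x y. x < n \<and> y < n \<and> x \<noteq> y}"

definition boundary_edges :: "nat \<Rightarrow> nat set set" where
  "boundary_edges n = {{x, Suc x mod n} | x. x < n}"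

text \<open>
  Two edges cross when they meet in their relative interiors. By convexity, this happens
  exactly when they are the two diagonals of a quadrilateral.
\<close>

definition crossing :: "nat set \<Rightarrow> nat set \<Rightarrow> bool" where
  "crossing e f \<longleftrightarrow>
    (\<exists>a b c d. a < b \<and> b < c \<and> c < d \<and> {e, f} = {{a, c}, {b, d}})"

definition noncrossing :: "nat set set \<Rightarrow> bool" where
  "noncrossing T \<longleftrightarrow> (\<forall>e\<in>T. \<forall>f\<in>T. \<not> crossing e f)"

definition triangulation :: "nat \<Rightarrow> nat set set \<Rightarrow> bool" where
  "triangulation n T \<longleftrightarrow>
    T \<subseteq> polygon_edges n \<and> noncrossing T \<and>
    (\<forall>S. S \<subseteq> polygon_edges n \<and> noncrossing S \<and> T \<subseteq> S \<longrightarrow> S = T)"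

definition opposite :: "nat \<Rightarrow> nat \<Rightarrow> nat" where
  "opposite d x = (x + (d + 1)) mod (2 * d + 2)"

definition centrally_symmetric :: "nat \<Rightarrow> nat set set \<Rightarrow> bool" where
  "centrally_symmetric d T \<longleftrightarrow>
    (\<forall>x y. {x, y} \<in> T \<longrightarrow> {opposite d x, opposite d y} \<in> T)"

definition symmetric_triangulations :: "nat \<Rightarrow> nat set set set" where
  "symmetric_triangulations d =
    {T. triangulation (2 * d + 2) T \<and> centrally_symmetric d T}"

text \<open>
  That \<open>{x, x'}\<close> and \<open>{y, y'}\<close> cross says that they are the diagonals of the quadrilateral
  with vertices \<open>x, y, x', y'\<close>. If \<open>{x, x'}\<close> is a diameter, then the two removed edges
  coincide, and so do the two added ones.
\<close>

definition flip :: "nat \<Rightarrow> nat set set \<Rightarrow> nat set set \<Rightarrow> bool" where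
  "flip d T T' \<longleftrightarrow>
    (\<exists>x x' y y'.
      {x, x'} \<in> T \<and> {x, x'} \<notin> boundary_edges (2 * d + 2) \<and>
      crossing {x, x'} {y, y'} \<and>
      {x, y} \<in> T \<and> {y, x'} \<in> T \<and> {x', y'} \<in> T \<and> {y', x} \<in> T \<and>
      T' = (T - {{x, x'}, {opposite d x, opposite d x'}})
             \<union> {{y, y'}, {opposite d y, opposite d y'}})"

text \<open>The undirected graph is encoded as a symmetric digraph.\<close>

definition cyclohedron_graph :: "nat \<Rightarrow> nat set set pair_pre_digraph" where
  "cyclohedron_graph d =
    \<lparr>pverts = symmetric_triangulations d,
     parcs = {(T, T'). T \<in> symmetric_triangulations d \<and>
                       T' \<in> symmetric_triangulations d \<and> flip d T T'}\<rparr>"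

lemma crossing_commute: "crossing e f \<longleftrightarrow> crossing f e"
  unfolding crossing_def by (simp add: insert_commute)

lemma crossing_distinct:
  assumes "crossing {x, x'} {y, y'}"
  shows "distinct [x, x', y, y']"
proof -
  obtain a b c k where abck: "a < b" "b < c" "c < k"
    and eq: "{{x, x'}, {y, y'}} = {{a, c}, {b, k}}"
    using assms unfolding crossing_def by blast
  have "{x, x'} = {a, c} \<and> {y, y'} = {b, k} \<or> {x, x'} = {b, k} \<and> {y, y'} = {a, c}"
    using eq unfolding doubleton_eq_iff[of "{x, x'}"] .
  then show ?thesis
    unfolding doubleton_eq_iff using abck by (elim disjE conjE) simp_all
qed

lemma finite_polygon_edges: "finite (polygon_edges n)"
proof (rule finite_subset)
  show "polygon_edges n \<subseteq> Pow {..<n}"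
    unfolding polygon_edges_def by auto
qed simp

lemma polygon_edge_iff:
  "{x, y} \<in> polygon_edges n \<longleftrightarrow> x < n \<and> y < n \<and> x \<noteq> y"
  unfolding polygon_edges_def by (auto simp: doubleton_eq_iff)

lemma opposite_eq:
  assumes "x < 2 * d + 2"
  shows "opposite d x = (if x \<le> d then x + (d + 1) else x - (d + 1))"
proof (cases "x \<le> d")
  case True
  then show ?thesis unfolding opposite_def by simp
next
  case False
  then have "(x + (d + 1)) mod (2 * d + 2) = (x + (d + 1) - (2 * d + 2)) mod (2 * d + 2)"
    by (intro le_mod_geq) linarith
  also have "\<dots> = x - (d + 1)" using assms False by simp
  finally show ?thesis using False unfolding opposite_def by simp
qed

lemma opposite_less: "opposite d x < 2 * d + 2"
  unfolding opposite_def by simp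

lemma opposite_opposite:
  assumes "x < 2 * d + 2"
  shows "opposite d (opposite d x) = x"
  using opposite_eq[OF assms] opposite_eq[OF opposite_less[of d x]] assms
  by (cases "x \<le> d") simp_all

lemma opposite_neq:
  assumes "x < 2 * d + 2"
  shows "opposite d x \<noteq> x"
proof (cases "x \<le> d")
  case True
  then show ?thesis using opposite_eq[OF assms] by simp
next
  case False
  then have "x - (d + 1) < x" by linarith
  then show ?thesis using opposite_eq[OF assms] False by simp
qed

lemma boundary_not_crossing:
  assumes "e \<in> boundary_edges n" "f \<in> polygon_edges n"
  shows "\<not> crossing e f"
proof
  assume cr: "crossing e f"
  obtain x where x: "x < n" "e = {x, Suc x mod n}"
    using assms(1) unfolding boundary_edges_def by auto
  obtain u v where uv: "u < n" "v < n" "f = {u, v}"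
    using assms(2) unfolding polygon_edges_def by auto
  obtain a b c k where abck: "a < b" "b < c" "c < k"
    and ef: "{e, f} = {{a, c}, {b, k}}"
    using cr unfolding crossing_def by blast
  have "e = {a, c} \<and> f = {b, k} \<or> e = {b, k} \<and> f = {a, c}"
    using ef by (simp add: doubleton_eq_iff)
  then have e: "{x, Suc x mod n} = {a, c} \<or> {x, Suc x mod n} = {b, k}"
    and f: "a < n" "b < n" "c < n" "k < n"
    using x uv by (auto simp: doubleton_eq_iff)
  show False
  proof (cases "Suc x = n")
    case True
    with e f abck show False by (auto simp: doubleton_eq_iff)
  next
    case False
    with x(1) have "Suc x mod n = Suc x" by simp
    with e abck show False by (auto simp: doubleton_eq_iff)
  qed
qed

lemma flip_sym:
  assumes T: "T \<in> symmetric_triangulations d" and T': "T' \<in> symmetric_triangulations d"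
    and "flip d T T'"
  shows "flip d T' T"
proof -
  let ?o = "opposite d"
  obtain x x' y y' where
    xx: "{x, x'} \<in> T" and
    cr: "crossing {x, x'} {y, y'}" and
    q: "{x, y} \<in> T" "{y, x'} \<in> T" "{x', y'} \<in> T" "{y', x} \<in> T" and
    eq: "T' = (T - {{x, x'}, {?o x, ?o x'}}) \<union> {{y, y'}, {?o y, ?o y'}}"
    using \<open>flip d T T'\<close> unfolding flip_def by blast
  have sub: "T \<subseteq> polygon_edges (2 * d + 2)" "T' \<subseteq> polygon_edges (2 * d + 2)"
    and nc: "noncrossing T" "noncrossing T'"
    and sym: "centrally_symmetric d T" "centrally_symmetric d T'"
    using T T' unfolding symmetric_triangulations_def triangulation_def by auto
  have lt: "x < 2*d+2" "x' < 2*d+2" "y < 2*d+2" "y' < 2*d+2"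
    using q sub(1) polygon_edge_iff by blast+
  note oo = lt[THEN opposite_opposite]
  note on = lt[THEN opposite_neq]
  have ne: "x \<noteq> x'" "y \<noteq> y'" "x \<noteq> y" "x \<noteq> y'" "x' \<noteq> y" "x' \<noteq> y'"
    using crossing_distinct[OF cr] by auto
  have yyT': "{y, y'} \<in> T'" using eq by blast
  have yyT: "{y, y'} \<notin> T" using nc(1) xx cr unfolding noncrossing_def by blast
  have oT: "{?o x, ?o x'} \<in> T" using sym(1) xx unfolding centrally_symmetric_def by blast
  have oyT: "{?o y, ?o y'} \<notin> T"
  proof
    assume "{?o y, ?o y'} \<in> T"
    then have "{?o (?o y), ?o (?o y')} \<in> T" using sym(1) unfolding centrally_symmetric_def by blast
    then show False using yyT oo by simp
  qed
  have keep: "{u, v} \<in> T'" if "{u, v} \<in> T" "u \<in> {x, x'}" "v \<in> {y, y'}" for u v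
  proof -
    have "{u, v} \<noteq> {x, x'}" using that ne by (auto simp: doubleton_eq_iff)
    moreover have "{u, v} \<noteq> {?o x, ?o x'}"
    proof
      assume h: "{u, v} = {?o x, ?o x'}"
      have v: "v \<noteq> x" "v \<noteq> x'" using that(3) ne by auto
      from h have "u = ?o x \<and> v = ?o x' \<or> u = ?o x' \<and> v = ?o x"
        unfolding doubleton_eq_iff .
      with that(2) v oo on show False by auto
    qed
    ultimately show ?thesis using that(1) eq by blast
  qed
  have nb: "{y, y'} \<notin> boundary_edges (2 * d + 2)"
    using boundary_not_crossing xx sub(1) cr crossing_commute by blast
  have teq: "T = (T' - {{y, y'}, {?o y, ?o y'}}) \<union> {{x, x'}, {?o x, ?o x'}}"
    using eq xx oT yyT oyT by blast
  show ?thesis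
    unfolding flip_def
  proof (intro exI conjI)
    show "{y, y'} \<in> T'" "{y, y'} \<notin> boundary_edges (2 * d + 2)" by fact+
    show "crossing {y, y'} {x, x'}" using cr crossing_commute by blast
    show "{y, x} \<in> T'" "{x, y'} \<in> T'" "{y', x'} \<in> T'" "{x', y} \<in> T'"
      using keep[of x y] keep[of x y'] keep[of x' y'] keep[of x' y] q
      by (simp_all add: insert_commute)
  qed (fact teq)
qed

lemma flip_irrefl:
  assumes "T \<in> symmetric_triangulations d"
  shows "\<not> flip d T T"
proof
  assume "flip d T T"
  then obtain x x' y y' where xx: "{x, x'} \<in> T" and cr: "crossing {x, x'} {y, y'}"
    and eq: "T = (T - {{x, x'}, {opposite d x, opposite d x'}})
                   \<union> {{y, y'}, {opposite d y, opposite d y'}}"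
    unfolding flip_def by (elim exE conjE) (rule that)
  have "{y, y'} \<in> T" by (subst eq) simp
  moreover have "noncrossing T"
    using assms unfolding symmetric_triangulations_def triangulation_def by auto
  ultimately show False using xx cr unfolding noncrossing_def by blast
qed

lemma finite_symmetric_triangulations: "finite (symmetric_triangulations d)"
proof (rule finite_subset)
  show "symmetric_triangulations d \<subseteq> Pow (polygon_edges (2 * d + 2))"
    unfolding symmetric_triangulations_def triangulation_def by auto
qed (simp add: finite_polygon_edges)

lemma pair_graph_cyclohedron_graph: "pair_graph (cyclohedron_graph d)"
proof
  have "parcs (cyclohedron_graph d) \<subseteq> symmetric_triangulations d \<times> symmetric_triangulations d"
    unfolding cyclohedron_graph_def by auto
  then show "finite (parcs (cyclohedron_graph d))"
    by (rule finite_subset) (simp add: finite_symmetric_triangulations)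
  show "symmetric (with_proj (cyclohedron_graph d))"
    unfolding symmetric_def
  proof (rule symI)
    fix T T'
    assume "(T, T') \<in> arcs_ends (with_proj (cyclohedron_graph d))"
    then have "T \<in> symmetric_triangulations d" "T' \<in> symmetric_triangulations d" "flip d T T'"
      unfolding cyclohedron_graph_def by simp_all
    then show "(T', T) \<in> arcs_ends (with_proj (cyclohedron_graph d))"
      using flip_sym[of T d T'] unfolding cyclohedron_graph_def by simp
  qed
qed (auto simp: cyclohedron_graph_def finite_symmetric_triangulations flip_irrefl)

end

theory Submission
  imports Defs
begin

text \<open>
  Let \<open>n = d + 1\<close>. To a function \<open>g\<close> on the triangles \<open>a < b < c \<le> a + n\<close> of integers, invariant under the
  shift by \<open>n\<close>, one attaches the sum \<open>F T\<close> of its values over the triangles of \<open>T\<close> modulo central symmetry.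
  A flip exchanges two triangles of a quadrilateral for the two others, so if the signed sum of \<open>g\<close> over the
  four triangles of every quadrilateral is at most \<open>4 * m\<close> in absolute value (and similarly for diameters),
  the distance of two triangulations is at least the difference of their \<open>F\<close> divided by \<open>4 * m\<close>.
  The values of \<open>g\<close> below are a dual solution, found by linear programming, for the two zigzags whose
  edges have vertex sums \<open>n, n + 1\<close> and \<open>m - 1, m\<close> modulo \<open>2 * n\<close>. They depend on the block of length
  about \<open>n / 2\<close> that contains each vertex and, piecewise linearly, on the depths in these blocks. The zigzags
  differ by about \<open>4 * m * (5 * n / 2 - 3 * n / (2 * m) - 5 * m / 2)\<close>, and \<open>m\<close> is close to the square root of \<open>d\<close>.
\<close>


text \<open>The residues modulo \<open>n\<close> are cut at 0 and \<open>h\<close> into the blocks U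
  (\<open>0\<close> to \<open>h - 1\<close>) and V (\<open>h\<close> to \<open>n - 1\<close>); up to
  one step, these cuts are the ends of the diameters of the two zigzags. Depth is counted from the
  multiples of \<open>n\<close> in both kinds of blocks. Hence the first zigzag joins a U block to
  the next V block at depth differences 0 and 1, and the second joins a V block to the next U block
  at depth differences \<open>m - 1\<close> and \<open>m\<close>. The reflection of \<open>t\<close>
  to \<open>m - t\<close> with a change of sign exchanges the two situations, so most triangles get
  the value \<open>-(5 * m - 3)\<close> in one zigzag and \<open>5 * m - 3\<close> in the other. A
  gap of nearly \<open>10 * m\<close> per triangle, divided by \<open>4 * m\<close>, is the source
  of the factor 5/2.

  The two losses have different origins: the defect 3 in \<open>5 * m - 3\<close> costs about
  \<open>3 * n / (2 * m)\<close>, and the roughly \<open>m\<close> triangles that lie inside one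
  block or at a cut cost about \<open>5 * m / 2\<close>. With \<open>m\<close> near the square root
  of \<open>d\<close> they amount to 3/2 and 5/2 square roots, together 4.\<close>

section \<open>Piecewise linear ingredients of the dual solution\<close>

definition fL :: "int \<Rightarrow> int \<Rightarrow> int" where
  "fL m t = (if t \<le> -m then -m else if t < 0 then -2*m-t else if t = 0 then -3*m else if t = 1 then -2*m-3 else if t = m then 0 else -m)"
definition fR :: "int \<Rightarrow> int \<Rightarrow> int" where
  "fR m t = (if t \<le> -m then -m else if t < 0 then t else if t = 0 then -m else if t = 1 then -2*m+3 else if t < m-1 then -m+2*t+2 else if t = m-1 then m else if t = m then 0 else -m)"
text \<open>For triangles that meet two adjacent blocks. The arguments are, in increasing order, the
  depth differences (U minus V) along the two sides that join the blocks, or the reflections of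
  these differences. The term \<open>2 * x\<close> is the only coupling between the two
  sides.\<close>

definition wA :: "int \<Rightarrow> int \<Rightarrow> int \<Rightarrow> int" where
  "wA m x y = fL m x + fR m y - (if 2 \<le> x \<and> y < m then 2*x else 0)"
text \<open>\<open>pU\<close> and \<open>pV\<close> serve triangles with one vertex in each of three
  successive blocks, starting in a U or a V block. The value is a difference of one function taken
  at the two sides between successive blocks. In a quadrilateral with two vertices in the middle
  block, the four values therefore separate into two expressions of the same shape.\<close>

definition pU :: "int \<Rightarrow> int \<Rightarrow> int" where
  "pU m t = (if t \<le> -m then -4*m else if t < 0 then -5*m-t else if t = 0 then -4*m else if t = 1 then -m-3 else 0)"
definition pV :: "int \<Rightarrow> int \<Rightarrow> int" where
  "pV m t = (if t \<le> -m then 0 else if t < 0 then m+t else if t = 0 then 0 else if t = 1 then -3*m+3 else if t < m-1 then -4*m+2*t+2 else if t = m-1 then -2*m else if t = m then -3*m else -4*m)"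
text \<open>\<open>cU\<close> and \<open>cV\<close> serve triangles on a diameter with the apex in
  the middle block. The ends of a diameter have equal depth, so one depth difference determines the
  value.\<close>

definition cU :: "int \<Rightarrow> int \<Rightarrow> int" where
  "cU m t = (if t \<le> -m then -2*m else if t < 0 then -m+t else if t = 0 then -m else if t = 1 then m-3 else if t < m-1 then 2*m-4*t else if t = m-1 then 3-m else if t = m then m else if t < 2*m then t else 2*m)"
definition cV :: "int \<Rightarrow> int \<Rightarrow> int" where
  "cV m t = (if t \<le> -m then 2*m else if t < 0 then 3*m+t else if t = 0 then 3*m else if t = 1 then m else if t < m-1 then 0 else if t = m-1 then -m else if t = m then -3*m else if t < 2*m then t-4*m else -2*m)"
text \<open>For two vertices at depth distance \<open>d\<close> in one V block and the third in a
  neighbouring V block; the analogous value for U blocks is the constant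
  \<open>4 * m\<close>.\<close>

definition eV :: "int \<Rightarrow> int \<Rightarrow> int" where
  "eV m d = (if d < m then 4*m-2*d else 4*m)"

text \<open>Makes \<open>wA\<close> separable: once it is known on which side of \<open>m\<close>
  the right argument lies, the coupling term is absorbed into the function of the left argument
  (\<open>wA_eq\<close>).\<close>

definition gL :: "int \<Rightarrow> int \<Rightarrow> int" where "gL m t = (if 2 \<le> t then fL m t - 2*t else fL m t)"

lemma wA_eq: "wA m x y = fR m y + (if y < m then gL m x else fL m x)"
  unfolding wA_def gL_def by simp


section \<open>Elimination rules for the regions of linearity\<close>

text \<open>The common breakpoints of the functions of \<open>t\<close> above; only
  \<open>cU\<close> and \<open>cV\<close> also change at \<open>2 * m\<close>. With \<open>m\<close>
  at least 3, the point 1 stays strictly below \<open>m - 1\<close>.\<close>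

lemma regions9: assumes "(m::int) \<ge> 3" obtains "t \<le> -m" | "-m < t" "t < 0" | "t = 0" | "t = 1" | "1 < t" "t < m-1"
  | "t = m-1" | "t = m" | "m < t" "t < 2*m" | "2*m \<le> t"
  using assms by linarith

lemma regions8: assumes "(m::int) \<ge> 3" obtains "t \<le> -m" | "-m < t" "t < 0" | "t = 0" | "t = 1" | "1 < t" "t < m-1"
  | "t = m-1" | "t = m" | "m < t"
  using assms by linarith

text \<open>Each rule from here on delivers, with the region of \<open>t\<close>, linear expressions
  for the functions that one variable of a later inequality enters. In the names, \<open>L\<close>
  and \<open>x\<close> stand for a left argument of \<open>wA\<close>, \<open>R\<close> and
  \<open>y\<close> for a right one, \<open>r\<close> for neither; the letters \<open>U\<close>,
  \<open>V\<close>, \<open>C\<close>, \<open>D\<close> at the end add \<open>pU\<close>,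
  \<open>pV\<close>, \<open>cU\<close>, \<open>cV\<close>.\<close>

lemma regL: assumes "(m::int) \<ge> 3" obtains
"t \<le> -m" "fL m t = -m" "gL m t = -m"
 | "-m < t" "t < 0" "fL m t = -2*m-t" "gL m t = -2*m-t"
 | "t = 0" "fL m t = -3*m" "gL m t = -3*m"
 | "t = 1" "fL m t = -2*m-3" "gL m t = -2*m-3"
 | "1 < t" "t < m-1" "fL m t = -m" "gL m t = -m-2*t"
 | "t = m-1" "fL m t = -m" "gL m t = -m-2*t"
 | "t = m" "fL m t = 0" "gL m t = -2*t"
 | "m < t" "fL m t = -m" "gL m t = -m-2*t"
proof (rule regions8[OF assms, of t], goal_cases)
  case 1 show ?case by (rule that(1)) (use 1 assms in \<open>(simp add: wA_eq fR_def; fail) | (simp add: gL_def fL_def; fail) | (simp add: pU_def pV_def cU_def cV_def; fail)\<close>)+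
next
  case 2 show ?case by (rule that(2)) (use 2 assms in \<open>(simp add: wA_eq fR_def; fail) | (simp add: gL_def fL_def; fail) | (simp add: pU_def pV_def cU_def cV_def; fail)\<close>)+
next
  case 3 show ?case by (rule that(3)) (use 3 assms in \<open>(simp add: wA_eq fR_def; fail) | (simp add: gL_def fL_def; fail) | (simp add: pU_def pV_def cU_def cV_def; fail)\<close>)+
next
  case 4 show ?case by (rule that(4)) (use 4 assms in \<open>(simp add: wA_eq fR_def; fail) | (simp add: gL_def fL_def; fail) | (simp add: pU_def pV_def cU_def cV_def; fail)\<close>)+
next
  case 5 show ?case by (rule that(5)) (use 5 assms in \<open>(simp add: wA_eq fR_def; fail) | (simp add: gL_def fL_def; fail) | (simp add: pU_def pV_def cU_def cV_def; fail)\<close>)+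
next
  case 6 show ?case by (rule that(6)) (use 6 assms in \<open>(simp add: wA_eq fR_def; fail) | (simp add: gL_def fL_def; fail) | (simp add: pU_def pV_def cU_def cV_def; fail)\<close>)+
next
  case 7 show ?case by (rule that(7)) (use 7 assms in \<open>(simp add: wA_eq fR_def; fail) | (simp add: gL_def fL_def; fail) | (simp add: pU_def pV_def cU_def cV_def; fail)\<close>)+
next
  case 8 show ?case by (rule that(8)) (use 8 assms in \<open>(simp add: wA_eq fR_def; fail) | (simp add: gL_def fL_def; fail) | (simp add: pU_def pV_def cU_def cV_def; fail)\<close>)+
qed

lemma regR: assumes "(m::int) \<ge> 3" obtains
"t \<le> -m" "wA m x t = -m + gL m x" "wA m y t = -m + gL m y"
 | "-m < t" "t < 0" "wA m x t = t + gL m x" "wA m y t = t + gL m y"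
 | "t = 0" "wA m x t = -m + gL m x" "wA m y t = -m + gL m y"
 | "t = 1" "wA m x t = -2*m+3 + gL m x" "wA m y t = -2*m+3 + gL m y"
 | "1 < t" "t < m-1" "wA m x t = -m+2*t+2 + gL m x" "wA m y t = -m+2*t+2 + gL m y"
 | "t = m-1" "wA m x t = m + gL m x" "wA m y t = m + gL m y"
 | "t = m" "wA m x t = 0 + fL m x" "wA m y t = 0 + fL m y"
 | "m < t" "wA m x t = -m + fL m x" "wA m y t = -m + fL m y"
proof (rule regions8[OF assms, of t], goal_cases)
  case 1 show ?case by (rule that(1)) (use 1 assms in \<open>(simp add: wA_eq fR_def; fail) | (simp add: gL_def fL_def; fail) | (simp add: pU_def pV_def cU_def cV_def; fail)\<close>)+
next
  case 2 show ?case by (rule that(2)) (use 2 assms in \<open>(simp add: wA_eq fR_def; fail) | (simp add: gL_def fL_def; fail) | (simp add: pU_def pV_def cU_def cV_def; fail)\<close>)+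
next
  case 3 show ?case by (rule that(3)) (use 3 assms in \<open>(simp add: wA_eq fR_def; fail) | (simp add: gL_def fL_def; fail) | (simp add: pU_def pV_def cU_def cV_def; fail)\<close>)+
next
  case 4 show ?case by (rule that(4)) (use 4 assms in \<open>(simp add: wA_eq fR_def; fail) | (simp add: gL_def fL_def; fail) | (simp add: pU_def pV_def cU_def cV_def; fail)\<close>)+
next
  case 5 show ?case by (rule that(5)) (use 5 assms in \<open>(simp add: wA_eq fR_def; fail) | (simp add: gL_def fL_def; fail) | (simp add: pU_def pV_def cU_def cV_def; fail)\<close>)+
next
  case 6 show ?case by (rule that(6)) (use 6 assms in \<open>(simp add: wA_eq fR_def; fail) | (simp add: gL_def fL_def; fail) | (simp add: pU_def pV_def cU_def cV_def; fail)\<close>)+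
next
  case 7 show ?case by (rule that(7)) (use 7 assms in \<open>(simp add: wA_eq fR_def; fail) | (simp add: gL_def fL_def; fail) | (simp add: pU_def pV_def cU_def cV_def; fail)\<close>)+
next
  case 8 show ?case by (rule that(8)) (use 8 assms in \<open>(simp add: wA_eq fR_def; fail) | (simp add: gL_def fL_def; fail) | (simp add: pU_def pV_def cU_def cV_def; fail)\<close>)+
qed

lemma regLR: assumes "(m::int) \<ge> 3" obtains
"t \<le> -m" "fL m t = -m" "gL m t = -m" "wA m x t = -m + gL m x"
 | "-m < t" "t < 0" "fL m t = -2*m-t" "gL m t = -2*m-t" "wA m x t = t + gL m x"
 | "t = 0" "fL m t = -3*m" "gL m t = -3*m" "wA m x t = -m + gL m x"
 | "t = 1" "fL m t = -2*m-3" "gL m t = -2*m-3" "wA m x t = -2*m+3 + gL m x"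
 | "1 < t" "t < m-1" "fL m t = -m" "gL m t = -m-2*t" "wA m x t = -m+2*t+2 + gL m x"
 | "t = m-1" "fL m t = -m" "gL m t = -m-2*t" "wA m x t = m + gL m x"
 | "t = m" "fL m t = 0" "gL m t = -2*t" "wA m x t = 0 + fL m x"
 | "m < t" "fL m t = -m" "gL m t = -m-2*t" "wA m x t = -m + fL m x"
proof (rule regions8[OF assms, of t], goal_cases)
  case 1 show ?case by (rule that(1)) (use 1 assms in \<open>(simp add: wA_eq fR_def; fail) | (simp add: gL_def fL_def; fail) | (simp add: pU_def pV_def cU_def cV_def; fail)\<close>)+
next
  case 2 show ?case by (rule that(2)) (use 2 assms in \<open>(simp add: wA_eq fR_def; fail) | (simp add: gL_def fL_def; fail) | (simp add: pU_def pV_def cU_def cV_def; fail)\<close>)+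
next
  case 3 show ?case by (rule that(3)) (use 3 assms in \<open>(simp add: wA_eq fR_def; fail) | (simp add: gL_def fL_def; fail) | (simp add: pU_def pV_def cU_def cV_def; fail)\<close>)+
next
  case 4 show ?case by (rule that(4)) (use 4 assms in \<open>(simp add: wA_eq fR_def; fail) | (simp add: gL_def fL_def; fail) | (simp add: pU_def pV_def cU_def cV_def; fail)\<close>)+
next
  case 5 show ?case by (rule that(5)) (use 5 assms in \<open>(simp add: wA_eq fR_def; fail) | (simp add: gL_def fL_def; fail) | (simp add: pU_def pV_def cU_def cV_def; fail)\<close>)+
next
  case 6 show ?case by (rule that(6)) (use 6 assms in \<open>(simp add: wA_eq fR_def; fail) | (simp add: gL_def fL_def; fail) | (simp add: pU_def pV_def cU_def cV_def; fail)\<close>)+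
next
  case 7 show ?case by (rule that(7)) (use 7 assms in \<open>(simp add: wA_eq fR_def; fail) | (simp add: gL_def fL_def; fail) | (simp add: pU_def pV_def cU_def cV_def; fail)\<close>)+
next
  case 8 show ?case by (rule that(8)) (use 8 assms in \<open>(simp add: wA_eq fR_def; fail) | (simp add: gL_def fL_def; fail) | (simp add: pU_def pV_def cU_def cV_def; fail)\<close>)+
qed

lemma xU: assumes "(m::int) \<ge> 3" obtains
"t \<le> -m" "fL m t = -m" "gL m t = -m" "pU m t = -4*m"
 | "-m < t" "t < 0" "fL m t = -2*m-t" "gL m t = -2*m-t" "pU m t = -5*m-t"
 | "t = 0" "fL m t = -3*m" "gL m t = -3*m" "pU m t = -4*m"
 | "t = 1" "fL m t = -2*m-3" "gL m t = -2*m-3" "pU m t = -m-3"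
 | "1 < t" "t < m-1" "fL m t = -m" "gL m t = -m-2*t" "pU m t = 0"
 | "t = m-1" "fL m t = -m" "gL m t = -m-2*t" "pU m t = 0"
 | "t = m" "fL m t = 0" "gL m t = -2*t" "pU m t = 0"
 | "m < t" "fL m t = -m" "gL m t = -m-2*t" "pU m t = 0"
proof (rule regions8[OF assms, of t], goal_cases)
  case 1 show ?case by (rule that(1)) (use 1 assms in \<open>(simp add: wA_eq fR_def; fail) | (simp add: gL_def fL_def; fail) | (simp add: pU_def pV_def cU_def cV_def; fail)\<close>)+
next
  case 2 show ?case by (rule that(2)) (use 2 assms in \<open>(simp add: wA_eq fR_def; fail) | (simp add: gL_def fL_def; fail) | (simp add: pU_def pV_def cU_def cV_def; fail)\<close>)+
next
  case 3 show ?case by (rule that(3)) (use 3 assms in \<open>(simp add: wA_eq fR_def; fail) | (simp add: gL_def fL_def; fail) | (simp add: pU_def pV_def cU_def cV_def; fail)\<close>)+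
next
  case 4 show ?case by (rule that(4)) (use 4 assms in \<open>(simp add: wA_eq fR_def; fail) | (simp add: gL_def fL_def; fail) | (simp add: pU_def pV_def cU_def cV_def; fail)\<close>)+
next
  case 5 show ?case by (rule that(5)) (use 5 assms in \<open>(simp add: wA_eq fR_def; fail) | (simp add: gL_def fL_def; fail) | (simp add: pU_def pV_def cU_def cV_def; fail)\<close>)+
next
  case 6 show ?case by (rule that(6)) (use 6 assms in \<open>(simp add: wA_eq fR_def; fail) | (simp add: gL_def fL_def; fail) | (simp add: pU_def pV_def cU_def cV_def; fail)\<close>)+
next
  case 7 show ?case by (rule that(7)) (use 7 assms in \<open>(simp add: wA_eq fR_def; fail) | (simp add: gL_def fL_def; fail) | (simp add: pU_def pV_def cU_def cV_def; fail)\<close>)+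
next
  case 8 show ?case by (rule that(8)) (use 8 assms in \<open>(simp add: wA_eq fR_def; fail) | (simp add: gL_def fL_def; fail) | (simp add: pU_def pV_def cU_def cV_def; fail)\<close>)+
qed

lemma yU: assumes "(m::int) \<ge> 3" obtains
"t \<le> -m" "wA m x t = -m + gL m x" "pU m t = -4*m"
 | "-m < t" "t < 0" "wA m x t = t + gL m x" "pU m t = -5*m-t"
 | "t = 0" "wA m x t = -m + gL m x" "pU m t = -4*m"
 | "t = 1" "wA m x t = -2*m+3 + gL m x" "pU m t = -m-3"
 | "1 < t" "t < m-1" "wA m x t = -m+2*t+2 + gL m x" "pU m t = 0"
 | "t = m-1" "wA m x t = m + gL m x" "pU m t = 0"
 | "t = m" "wA m x t = 0 + fL m x" "pU m t = 0"
 | "m < t" "wA m x t = -m + fL m x" "pU m t = 0"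
proof (rule regions8[OF assms, of t], goal_cases)
  case 1 show ?case by (rule that(1)) (use 1 assms in \<open>(simp add: wA_eq fR_def; fail) | (simp add: gL_def fL_def; fail) | (simp add: pU_def pV_def cU_def cV_def; fail)\<close>)+
next
  case 2 show ?case by (rule that(2)) (use 2 assms in \<open>(simp add: wA_eq fR_def; fail) | (simp add: gL_def fL_def; fail) | (simp add: pU_def pV_def cU_def cV_def; fail)\<close>)+
next
  case 3 show ?case by (rule that(3)) (use 3 assms in \<open>(simp add: wA_eq fR_def; fail) | (simp add: gL_def fL_def; fail) | (simp add: pU_def pV_def cU_def cV_def; fail)\<close>)+
next
  case 4 show ?case by (rule that(4)) (use 4 assms in \<open>(simp add: wA_eq fR_def; fail) | (simp add: gL_def fL_def; fail) | (simp add: pU_def pV_def cU_def cV_def; fail)\<close>)+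
next
  case 5 show ?case by (rule that(5)) (use 5 assms in \<open>(simp add: wA_eq fR_def; fail) | (simp add: gL_def fL_def; fail) | (simp add: pU_def pV_def cU_def cV_def; fail)\<close>)+
next
  case 6 show ?case by (rule that(6)) (use 6 assms in \<open>(simp add: wA_eq fR_def; fail) | (simp add: gL_def fL_def; fail) | (simp add: pU_def pV_def cU_def cV_def; fail)\<close>)+
next
  case 7 show ?case by (rule that(7)) (use 7 assms in \<open>(simp add: wA_eq fR_def; fail) | (simp add: gL_def fL_def; fail) | (simp add: pU_def pV_def cU_def cV_def; fail)\<close>)+
next
  case 8 show ?case by (rule that(8)) (use 8 assms in \<open>(simp add: wA_eq fR_def; fail) | (simp add: gL_def fL_def; fail) | (simp add: pU_def pV_def cU_def cV_def; fail)\<close>)+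
qed

lemma xV: assumes "(m::int) \<ge> 3" obtains
"t \<le> -m" "fL m t = -m" "gL m t = -m" "pV m t = 0"
 | "-m < t" "t < 0" "fL m t = -2*m-t" "gL m t = -2*m-t" "pV m t = m+t"
 | "t = 0" "fL m t = -3*m" "gL m t = -3*m" "pV m t = 0"
 | "t = 1" "fL m t = -2*m-3" "gL m t = -2*m-3" "pV m t = -3*m+3"
 | "1 < t" "t < m-1" "fL m t = -m" "gL m t = -m-2*t" "pV m t = -4*m+2*t+2"
 | "t = m-1" "fL m t = -m" "gL m t = -m-2*t" "pV m t = -2*m"
 | "t = m" "fL m t = 0" "gL m t = -2*t" "pV m t = -3*m"
 | "m < t" "fL m t = -m" "gL m t = -m-2*t" "pV m t = -4*m"
proof (rule regions8[OF assms, of t], goal_cases)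
  case 1 show ?case by (rule that(1)) (use 1 assms in \<open>(simp add: wA_eq fR_def; fail) | (simp add: gL_def fL_def; fail) | (simp add: pU_def pV_def cU_def cV_def; fail)\<close>)+
next
  case 2 show ?case by (rule that(2)) (use 2 assms in \<open>(simp add: wA_eq fR_def; fail) | (simp add: gL_def fL_def; fail) | (simp add: pU_def pV_def cU_def cV_def; fail)\<close>)+
next
  case 3 show ?case by (rule that(3)) (use 3 assms in \<open>(simp add: wA_eq fR_def; fail) | (simp add: gL_def fL_def; fail) | (simp add: pU_def pV_def cU_def cV_def; fail)\<close>)+
next
  case 4 show ?case by (rule that(4)) (use 4 assms in \<open>(simp add: wA_eq fR_def; fail) | (simp add: gL_def fL_def; fail) | (simp add: pU_def pV_def cU_def cV_def; fail)\<close>)+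
next
  case 5 show ?case by (rule that(5)) (use 5 assms in \<open>(simp add: wA_eq fR_def; fail) | (simp add: gL_def fL_def; fail) | (simp add: pU_def pV_def cU_def cV_def; fail)\<close>)+
next
  case 6 show ?case by (rule that(6)) (use 6 assms in \<open>(simp add: wA_eq fR_def; fail) | (simp add: gL_def fL_def; fail) | (simp add: pU_def pV_def cU_def cV_def; fail)\<close>)+
next
  case 7 show ?case by (rule that(7)) (use 7 assms in \<open>(simp add: wA_eq fR_def; fail) | (simp add: gL_def fL_def; fail) | (simp add: pU_def pV_def cU_def cV_def; fail)\<close>)+
next
  case 8 show ?case by (rule that(8)) (use 8 assms in \<open>(simp add: wA_eq fR_def; fail) | (simp add: gL_def fL_def; fail) | (simp add: pU_def pV_def cU_def cV_def; fail)\<close>)+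
qed

lemma yV: assumes "(m::int) \<ge> 3" obtains
"t \<le> -m" "wA m x t = -m + gL m x" "pV m t = 0"
 | "-m < t" "t < 0" "wA m x t = t + gL m x" "pV m t = m+t"
 | "t = 0" "wA m x t = -m + gL m x" "pV m t = 0"
 | "t = 1" "wA m x t = -2*m+3 + gL m x" "pV m t = -3*m+3"
 | "1 < t" "t < m-1" "wA m x t = -m+2*t+2 + gL m x" "pV m t = -4*m+2*t+2"
 | "t = m-1" "wA m x t = m + gL m x" "pV m t = -2*m"
 | "t = m" "wA m x t = 0 + fL m x" "pV m t = -3*m"
 | "m < t" "wA m x t = -m + fL m x" "pV m t = -4*m"
proof (rule regions8[OF assms, of t], goal_cases)
  case 1 show ?case by (rule that(1)) (use 1 assms in \<open>(simp add: wA_eq fR_def; fail) | (simp add: gL_def fL_def; fail) | (simp add: pU_def pV_def cU_def cV_def; fail)\<close>)+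
next
  case 2 show ?case by (rule that(2)) (use 2 assms in \<open>(simp add: wA_eq fR_def; fail) | (simp add: gL_def fL_def; fail) | (simp add: pU_def pV_def cU_def cV_def; fail)\<close>)+
next
  case 3 show ?case by (rule that(3)) (use 3 assms in \<open>(simp add: wA_eq fR_def; fail) | (simp add: gL_def fL_def; fail) | (simp add: pU_def pV_def cU_def cV_def; fail)\<close>)+
next
  case 4 show ?case by (rule that(4)) (use 4 assms in \<open>(simp add: wA_eq fR_def; fail) | (simp add: gL_def fL_def; fail) | (simp add: pU_def pV_def cU_def cV_def; fail)\<close>)+
next
  case 5 show ?case by (rule that(5)) (use 5 assms in \<open>(simp add: wA_eq fR_def; fail) | (simp add: gL_def fL_def; fail) | (simp add: pU_def pV_def cU_def cV_def; fail)\<close>)+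
next
  case 6 show ?case by (rule that(6)) (use 6 assms in \<open>(simp add: wA_eq fR_def; fail) | (simp add: gL_def fL_def; fail) | (simp add: pU_def pV_def cU_def cV_def; fail)\<close>)+
next
  case 7 show ?case by (rule that(7)) (use 7 assms in \<open>(simp add: wA_eq fR_def; fail) | (simp add: gL_def fL_def; fail) | (simp add: pU_def pV_def cU_def cV_def; fail)\<close>)+
next
  case 8 show ?case by (rule that(8)) (use 8 assms in \<open>(simp add: wA_eq fR_def; fail) | (simp add: gL_def fL_def; fail) | (simp add: pU_def pV_def cU_def cV_def; fail)\<close>)+
qed

lemma xC: assumes "(m::int) \<ge> 3" obtains
"t \<le> -m" "fL m t = -m" "gL m t = -m" "cU m t = -2*m"
 | "-m < t" "t < 0" "fL m t = -2*m-t" "gL m t = -2*m-t" "cU m t = -m+t"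
 | "t = 0" "fL m t = -3*m" "gL m t = -3*m" "cU m t = -m"
 | "t = 1" "fL m t = -2*m-3" "gL m t = -2*m-3" "cU m t = m-3"
 | "1 < t" "t < m-1" "fL m t = -m" "gL m t = -m-2*t" "cU m t = 2*m-4*t"
 | "t = m-1" "fL m t = -m" "gL m t = -m-2*t" "cU m t = 3-m"
 | "t = m" "fL m t = 0" "gL m t = -2*t" "cU m t = m"
 | "m < t" "t < 2*m" "fL m t = -m" "gL m t = -m-2*t" "cU m t = t"
 | "2*m \<le> t" "fL m t = -m" "gL m t = -m-2*t" "cU m t = 2*m"
proof (rule regions9[OF assms, of t], goal_cases)
  case 1 show ?case by (rule that(1)) (use 1 assms in \<open>(simp add: wA_eq fR_def; fail) | (simp add: gL_def fL_def; fail) | (simp add: pU_def pV_def cU_def cV_def; fail)\<close>)+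
next
  case 2 show ?case by (rule that(2)) (use 2 assms in \<open>(simp add: wA_eq fR_def; fail) | (simp add: gL_def fL_def; fail) | (simp add: pU_def pV_def cU_def cV_def; fail)\<close>)+
next
  case 3 show ?case by (rule that(3)) (use 3 assms in \<open>(simp add: wA_eq fR_def; fail) | (simp add: gL_def fL_def; fail) | (simp add: pU_def pV_def cU_def cV_def; fail)\<close>)+
next
  case 4 show ?case by (rule that(4)) (use 4 assms in \<open>(simp add: wA_eq fR_def; fail) | (simp add: gL_def fL_def; fail) | (simp add: pU_def pV_def cU_def cV_def; fail)\<close>)+
next
  case 5 show ?case by (rule that(5)) (use 5 assms in \<open>(simp add: wA_eq fR_def; fail) | (simp add: gL_def fL_def; fail) | (simp add: pU_def pV_def cU_def cV_def; fail)\<close>)+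
next
  case 6 show ?case by (rule that(6)) (use 6 assms in \<open>(simp add: wA_eq fR_def; fail) | (simp add: gL_def fL_def; fail) | (simp add: pU_def pV_def cU_def cV_def; fail)\<close>)+
next
  case 7 show ?case by (rule that(7)) (use 7 assms in \<open>(simp add: wA_eq fR_def; fail) | (simp add: gL_def fL_def; fail) | (simp add: pU_def pV_def cU_def cV_def; fail)\<close>)+
next
  case 8 show ?case by (rule that(8)) (use 8 assms in \<open>(simp add: wA_eq fR_def; fail) | (simp add: gL_def fL_def; fail) | (simp add: pU_def pV_def cU_def cV_def; fail)\<close>)+
next
  case 9 show ?case by (rule that(9)) (use 9 assms in \<open>(simp add: wA_eq fR_def; fail) | (simp add: gL_def fL_def; fail) | (simp add: pU_def pV_def cU_def cV_def; fail)\<close>)+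
qed

lemma yC: assumes "(m::int) \<ge> 3" obtains
"t \<le> -m" "wA m x t = -m + gL m x" "cU m t = -2*m"
 | "-m < t" "t < 0" "wA m x t = t + gL m x" "cU m t = -m+t"
 | "t = 0" "wA m x t = -m + gL m x" "cU m t = -m"
 | "t = 1" "wA m x t = -2*m+3 + gL m x" "cU m t = m-3"
 | "1 < t" "t < m-1" "wA m x t = -m+2*t+2 + gL m x" "cU m t = 2*m-4*t"
 | "t = m-1" "wA m x t = m + gL m x" "cU m t = 3-m"
 | "t = m" "wA m x t = 0 + fL m x" "cU m t = m"
 | "m < t" "t < 2*m" "wA m x t = -m + fL m x" "cU m t = t"
 | "2*m \<le> t" "wA m x t = -m + fL m x" "cU m t = 2*m"
proof (rule regions9[OF assms, of t], goal_cases)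
  case 1 show ?case by (rule that(1)) (use 1 assms in \<open>(simp add: wA_eq fR_def; fail) | (simp add: gL_def fL_def; fail) | (simp add: pU_def pV_def cU_def cV_def; fail)\<close>)+
next
  case 2 show ?case by (rule that(2)) (use 2 assms in \<open>(simp add: wA_eq fR_def; fail) | (simp add: gL_def fL_def; fail) | (simp add: pU_def pV_def cU_def cV_def; fail)\<close>)+
next
  case 3 show ?case by (rule that(3)) (use 3 assms in \<open>(simp add: wA_eq fR_def; fail) | (simp add: gL_def fL_def; fail) | (simp add: pU_def pV_def cU_def cV_def; fail)\<close>)+
next
  case 4 show ?case by (rule that(4)) (use 4 assms in \<open>(simp add: wA_eq fR_def; fail) | (simp add: gL_def fL_def; fail) | (simp add: pU_def pV_def cU_def cV_def; fail)\<close>)+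
next
  case 5 show ?case by (rule that(5)) (use 5 assms in \<open>(simp add: wA_eq fR_def; fail) | (simp add: gL_def fL_def; fail) | (simp add: pU_def pV_def cU_def cV_def; fail)\<close>)+
next
  case 6 show ?case by (rule that(6)) (use 6 assms in \<open>(simp add: wA_eq fR_def; fail) | (simp add: gL_def fL_def; fail) | (simp add: pU_def pV_def cU_def cV_def; fail)\<close>)+
next
  case 7 show ?case by (rule that(7)) (use 7 assms in \<open>(simp add: wA_eq fR_def; fail) | (simp add: gL_def fL_def; fail) | (simp add: pU_def pV_def cU_def cV_def; fail)\<close>)+
next
  case 8 show ?case by (rule that(8)) (use 8 assms in \<open>(simp add: wA_eq fR_def; fail) | (simp add: gL_def fL_def; fail) | (simp add: pU_def pV_def cU_def cV_def; fail)\<close>)+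
next
  case 9 show ?case by (rule that(9)) (use 9 assms in \<open>(simp add: wA_eq fR_def; fail) | (simp add: gL_def fL_def; fail) | (simp add: pU_def pV_def cU_def cV_def; fail)\<close>)+
qed

lemma xD: assumes "(m::int) \<ge> 3" obtains
"t \<le> -m" "fL m t = -m" "gL m t = -m" "cV m t = 2*m"
 | "-m < t" "t < 0" "fL m t = -2*m-t" "gL m t = -2*m-t" "cV m t = 3*m+t"
 | "t = 0" "fL m t = -3*m" "gL m t = -3*m" "cV m t = 3*m"
 | "t = 1" "fL m t = -2*m-3" "gL m t = -2*m-3" "cV m t = m"
 | "1 < t" "t < m-1" "fL m t = -m" "gL m t = -m-2*t" "cV m t = 0"
 | "t = m-1" "fL m t = -m" "gL m t = -m-2*t" "cV m t = -m"
 | "t = m" "fL m t = 0" "gL m t = -2*t" "cV m t = -3*m"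
 | "m < t" "t < 2*m" "fL m t = -m" "gL m t = -m-2*t" "cV m t = t-4*m"
 | "2*m \<le> t" "fL m t = -m" "gL m t = -m-2*t" "cV m t = -2*m"
proof (rule regions9[OF assms, of t], goal_cases)
  case 1 show ?case by (rule that(1)) (use 1 assms in \<open>(simp add: wA_eq fR_def; fail) | (simp add: gL_def fL_def; fail) | (simp add: pU_def pV_def cU_def cV_def; fail)\<close>)+
next
  case 2 show ?case by (rule that(2)) (use 2 assms in \<open>(simp add: wA_eq fR_def; fail) | (simp add: gL_def fL_def; fail) | (simp add: pU_def pV_def cU_def cV_def; fail)\<close>)+
next
  case 3 show ?case by (rule that(3)) (use 3 assms in \<open>(simp add: wA_eq fR_def; fail) | (simp add: gL_def fL_def; fail) | (simp add: pU_def pV_def cU_def cV_def; fail)\<close>)+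
next
  case 4 show ?case by (rule that(4)) (use 4 assms in \<open>(simp add: wA_eq fR_def; fail) | (simp add: gL_def fL_def; fail) | (simp add: pU_def pV_def cU_def cV_def; fail)\<close>)+
next
  case 5 show ?case by (rule that(5)) (use 5 assms in \<open>(simp add: wA_eq fR_def; fail) | (simp add: gL_def fL_def; fail) | (simp add: pU_def pV_def cU_def cV_def; fail)\<close>)+
next
  case 6 show ?case by (rule that(6)) (use 6 assms in \<open>(simp add: wA_eq fR_def; fail) | (simp add: gL_def fL_def; fail) | (simp add: pU_def pV_def cU_def cV_def; fail)\<close>)+
next
  case 7 show ?case by (rule that(7)) (use 7 assms in \<open>(simp add: wA_eq fR_def; fail) | (simp add: gL_def fL_def; fail) | (simp add: pU_def pV_def cU_def cV_def; fail)\<close>)+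
next
  case 8 show ?case by (rule that(8)) (use 8 assms in \<open>(simp add: wA_eq fR_def; fail) | (simp add: gL_def fL_def; fail) | (simp add: pU_def pV_def cU_def cV_def; fail)\<close>)+
next
  case 9 show ?case by (rule that(9)) (use 9 assms in \<open>(simp add: wA_eq fR_def; fail) | (simp add: gL_def fL_def; fail) | (simp add: pU_def pV_def cU_def cV_def; fail)\<close>)+
qed

lemma yD: assumes "(m::int) \<ge> 3" obtains
"t \<le> -m" "wA m x t = -m + gL m x" "cV m t = 2*m"
 | "-m < t" "t < 0" "wA m x t = t + gL m x" "cV m t = 3*m+t"
 | "t = 0" "wA m x t = -m + gL m x" "cV m t = 3*m"
 | "t = 1" "wA m x t = -2*m+3 + gL m x" "cV m t = m"
 | "1 < t" "t < m-1" "wA m x t = -m+2*t+2 + gL m x" "cV m t = 0"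
 | "t = m-1" "wA m x t = m + gL m x" "cV m t = -m"
 | "t = m" "wA m x t = 0 + fL m x" "cV m t = -3*m"
 | "m < t" "t < 2*m" "wA m x t = -m + fL m x" "cV m t = t-4*m"
 | "2*m \<le> t" "wA m x t = -m + fL m x" "cV m t = -2*m"
proof (rule regions9[OF assms, of t], goal_cases)
  case 1 show ?case by (rule that(1)) (use 1 assms in \<open>(simp add: wA_eq fR_def; fail) | (simp add: gL_def fL_def; fail) | (simp add: pU_def pV_def cU_def cV_def; fail)\<close>)+
next
  case 2 show ?case by (rule that(2)) (use 2 assms in \<open>(simp add: wA_eq fR_def; fail) | (simp add: gL_def fL_def; fail) | (simp add: pU_def pV_def cU_def cV_def; fail)\<close>)+
next
  case 3 show ?case by (rule that(3)) (use 3 assms in \<open>(simp add: wA_eq fR_def; fail) | (simp add: gL_def fL_def; fail) | (simp add: pU_def pV_def cU_def cV_def; fail)\<close>)+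
next
  case 4 show ?case by (rule that(4)) (use 4 assms in \<open>(simp add: wA_eq fR_def; fail) | (simp add: gL_def fL_def; fail) | (simp add: pU_def pV_def cU_def cV_def; fail)\<close>)+
next
  case 5 show ?case by (rule that(5)) (use 5 assms in \<open>(simp add: wA_eq fR_def; fail) | (simp add: gL_def fL_def; fail) | (simp add: pU_def pV_def cU_def cV_def; fail)\<close>)+
next
  case 6 show ?case by (rule that(6)) (use 6 assms in \<open>(simp add: wA_eq fR_def; fail) | (simp add: gL_def fL_def; fail) | (simp add: pU_def pV_def cU_def cV_def; fail)\<close>)+
next
  case 7 show ?case by (rule that(7)) (use 7 assms in \<open>(simp add: wA_eq fR_def; fail) | (simp add: gL_def fL_def; fail) | (simp add: pU_def pV_def cU_def cV_def; fail)\<close>)+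
next
  case 8 show ?case by (rule that(8)) (use 8 assms in \<open>(simp add: wA_eq fR_def; fail) | (simp add: gL_def fL_def; fail) | (simp add: pU_def pV_def cU_def cV_def; fail)\<close>)+
next
  case 9 show ?case by (rule that(9)) (use 9 assms in \<open>(simp add: wA_eq fR_def; fail) | (simp add: gL_def fL_def; fail) | (simp add: pU_def pV_def cU_def cV_def; fail)\<close>)+
qed

lemma rU: assumes "(m::int) \<ge> 3" obtains
"t \<le> -m" "pU m t = -4*m"
 | "-m < t" "t < 0" "pU m t = -5*m-t"
 | "t = 0" "pU m t = -4*m"
 | "t = 1" "pU m t = -m-3"
 | "1 < t" "t < m-1" "pU m t = 0"
 | "t = m-1" "pU m t = 0"
 | "t = m" "pU m t = 0"
 | "m < t" "pU m t = 0"
proof (rule regions8[OF assms, of t], goal_cases)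
  case 1 show ?case by (rule that(1)) (use 1 assms in \<open>(simp add: wA_eq fR_def; fail) | (simp add: gL_def fL_def; fail) | (simp add: pU_def pV_def cU_def cV_def; fail)\<close>)+
next
  case 2 show ?case by (rule that(2)) (use 2 assms in \<open>(simp add: wA_eq fR_def; fail) | (simp add: gL_def fL_def; fail) | (simp add: pU_def pV_def cU_def cV_def; fail)\<close>)+
next
  case 3 show ?case by (rule that(3)) (use 3 assms in \<open>(simp add: wA_eq fR_def; fail) | (simp add: gL_def fL_def; fail) | (simp add: pU_def pV_def cU_def cV_def; fail)\<close>)+
next
  case 4 show ?case by (rule that(4)) (use 4 assms in \<open>(simp add: wA_eq fR_def; fail) | (simp add: gL_def fL_def; fail) | (simp add: pU_def pV_def cU_def cV_def; fail)\<close>)+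
next
  case 5 show ?case by (rule that(5)) (use 5 assms in \<open>(simp add: wA_eq fR_def; fail) | (simp add: gL_def fL_def; fail) | (simp add: pU_def pV_def cU_def cV_def; fail)\<close>)+
next
  case 6 show ?case by (rule that(6)) (use 6 assms in \<open>(simp add: wA_eq fR_def; fail) | (simp add: gL_def fL_def; fail) | (simp add: pU_def pV_def cU_def cV_def; fail)\<close>)+
next
  case 7 show ?case by (rule that(7)) (use 7 assms in \<open>(simp add: wA_eq fR_def; fail) | (simp add: gL_def fL_def; fail) | (simp add: pU_def pV_def cU_def cV_def; fail)\<close>)+
next
  case 8 show ?case by (rule that(8)) (use 8 assms in \<open>(simp add: wA_eq fR_def; fail) | (simp add: gL_def fL_def; fail) | (simp add: pU_def pV_def cU_def cV_def; fail)\<close>)+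
qed

lemma rV: assumes "(m::int) \<ge> 3" obtains
"t \<le> -m" "pV m t = 0"
 | "-m < t" "t < 0" "pV m t = m+t"
 | "t = 0" "pV m t = 0"
 | "t = 1" "pV m t = -3*m+3"
 | "1 < t" "t < m-1" "pV m t = -4*m+2*t+2"
 | "t = m-1" "pV m t = -2*m"
 | "t = m" "pV m t = -3*m"
 | "m < t" "pV m t = -4*m"
proof (rule regions8[OF assms, of t], goal_cases)
  case 1 show ?case by (rule that(1)) (use 1 assms in \<open>(simp add: wA_eq fR_def; fail) | (simp add: gL_def fL_def; fail) | (simp add: pU_def pV_def cU_def cV_def; fail)\<close>)+
next
  case 2 show ?case by (rule that(2)) (use 2 assms in \<open>(simp add: wA_eq fR_def; fail) | (simp add: gL_def fL_def; fail) | (simp add: pU_def pV_def cU_def cV_def; fail)\<close>)+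
next
  case 3 show ?case by (rule that(3)) (use 3 assms in \<open>(simp add: wA_eq fR_def; fail) | (simp add: gL_def fL_def; fail) | (simp add: pU_def pV_def cU_def cV_def; fail)\<close>)+
next
  case 4 show ?case by (rule that(4)) (use 4 assms in \<open>(simp add: wA_eq fR_def; fail) | (simp add: gL_def fL_def; fail) | (simp add: pU_def pV_def cU_def cV_def; fail)\<close>)+
next
  case 5 show ?case by (rule that(5)) (use 5 assms in \<open>(simp add: wA_eq fR_def; fail) | (simp add: gL_def fL_def; fail) | (simp add: pU_def pV_def cU_def cV_def; fail)\<close>)+
next
  case 6 show ?case by (rule that(6)) (use 6 assms in \<open>(simp add: wA_eq fR_def; fail) | (simp add: gL_def fL_def; fail) | (simp add: pU_def pV_def cU_def cV_def; fail)\<close>)+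
next
  case 7 show ?case by (rule that(7)) (use 7 assms in \<open>(simp add: wA_eq fR_def; fail) | (simp add: gL_def fL_def; fail) | (simp add: pU_def pV_def cU_def cV_def; fail)\<close>)+
next
  case 8 show ?case by (rule that(8)) (use 8 assms in \<open>(simp add: wA_eq fR_def; fail) | (simp add: gL_def fL_def; fail) | (simp add: pU_def pV_def cU_def cV_def; fail)\<close>)+
qed

lemma rC: assumes "(m::int) \<ge> 3" obtains
"t \<le> -m" "cU m t = -2*m"
 | "-m < t" "t < 0" "cU m t = -m+t"
 | "t = 0" "cU m t = -m"
 | "t = 1" "cU m t = m-3"
 | "1 < t" "t < m-1" "cU m t = 2*m-4*t"
 | "t = m-1" "cU m t = 3-m"
 | "t = m" "cU m t = m"
 | "m < t" "t < 2*m" "cU m t = t"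
 | "2*m \<le> t" "cU m t = 2*m"
proof (rule regions9[OF assms, of t], goal_cases)
  case 1 show ?case by (rule that(1)) (use 1 assms in \<open>(simp add: wA_eq fR_def; fail) | (simp add: gL_def fL_def; fail) | (simp add: pU_def pV_def cU_def cV_def; fail)\<close>)+
next
  case 2 show ?case by (rule that(2)) (use 2 assms in \<open>(simp add: wA_eq fR_def; fail) | (simp add: gL_def fL_def; fail) | (simp add: pU_def pV_def cU_def cV_def; fail)\<close>)+
next
  case 3 show ?case by (rule that(3)) (use 3 assms in \<open>(simp add: wA_eq fR_def; fail) | (simp add: gL_def fL_def; fail) | (simp add: pU_def pV_def cU_def cV_def; fail)\<close>)+
next
  case 4 show ?case by (rule that(4)) (use 4 assms in \<open>(simp add: wA_eq fR_def; fail) | (simp add: gL_def fL_def; fail) | (simp add: pU_def pV_def cU_def cV_def; fail)\<close>)+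
next
  case 5 show ?case by (rule that(5)) (use 5 assms in \<open>(simp add: wA_eq fR_def; fail) | (simp add: gL_def fL_def; fail) | (simp add: pU_def pV_def cU_def cV_def; fail)\<close>)+
next
  case 6 show ?case by (rule that(6)) (use 6 assms in \<open>(simp add: wA_eq fR_def; fail) | (simp add: gL_def fL_def; fail) | (simp add: pU_def pV_def cU_def cV_def; fail)\<close>)+
next
  case 7 show ?case by (rule that(7)) (use 7 assms in \<open>(simp add: wA_eq fR_def; fail) | (simp add: gL_def fL_def; fail) | (simp add: pU_def pV_def cU_def cV_def; fail)\<close>)+
next
  case 8 show ?case by (rule that(8)) (use 8 assms in \<open>(simp add: wA_eq fR_def; fail) | (simp add: gL_def fL_def; fail) | (simp add: pU_def pV_def cU_def cV_def; fail)\<close>)+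
next
  case 9 show ?case by (rule that(9)) (use 9 assms in \<open>(simp add: wA_eq fR_def; fail) | (simp add: gL_def fL_def; fail) | (simp add: pU_def pV_def cU_def cV_def; fail)\<close>)+
qed

lemma rD: assumes "(m::int) \<ge> 3" obtains
"t \<le> -m" "cV m t = 2*m"
 | "-m < t" "t < 0" "cV m t = 3*m+t"
 | "t = 0" "cV m t = 3*m"
 | "t = 1" "cV m t = m"
 | "1 < t" "t < m-1" "cV m t = 0"
 | "t = m-1" "cV m t = -m"
 | "t = m" "cV m t = -3*m"
 | "m < t" "t < 2*m" "cV m t = t-4*m"
 | "2*m \<le> t" "cV m t = -2*m"
proof (rule regions9[OF assms, of t], goal_cases)
  case 1 show ?case by (rule that(1)) (use 1 assms in \<open>(simp add: wA_eq fR_def; fail) | (simp add: gL_def fL_def; fail) | (simp add: pU_def pV_def cU_def cV_def; fail)\<close>)+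
next
  case 2 show ?case by (rule that(2)) (use 2 assms in \<open>(simp add: wA_eq fR_def; fail) | (simp add: gL_def fL_def; fail) | (simp add: pU_def pV_def cU_def cV_def; fail)\<close>)+
next
  case 3 show ?case by (rule that(3)) (use 3 assms in \<open>(simp add: wA_eq fR_def; fail) | (simp add: gL_def fL_def; fail) | (simp add: pU_def pV_def cU_def cV_def; fail)\<close>)+
next
  case 4 show ?case by (rule that(4)) (use 4 assms in \<open>(simp add: wA_eq fR_def; fail) | (simp add: gL_def fL_def; fail) | (simp add: pU_def pV_def cU_def cV_def; fail)\<close>)+
next
  case 5 show ?case by (rule that(5)) (use 5 assms in \<open>(simp add: wA_eq fR_def; fail) | (simp add: gL_def fL_def; fail) | (simp add: pU_def pV_def cU_def cV_def; fail)\<close>)+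
next
  case 6 show ?case by (rule that(6)) (use 6 assms in \<open>(simp add: wA_eq fR_def; fail) | (simp add: gL_def fL_def; fail) | (simp add: pU_def pV_def cU_def cV_def; fail)\<close>)+
next
  case 7 show ?case by (rule that(7)) (use 7 assms in \<open>(simp add: wA_eq fR_def; fail) | (simp add: gL_def fL_def; fail) | (simp add: pU_def pV_def cU_def cV_def; fail)\<close>)+
next
  case 8 show ?case by (rule that(8)) (use 8 assms in \<open>(simp add: wA_eq fR_def; fail) | (simp add: gL_def fL_def; fail) | (simp add: pU_def pV_def cU_def cV_def; fail)\<close>)+
next
  case 9 show ?case by (rule that(9)) (use 9 assms in \<open>(simp add: wA_eq fR_def; fail) | (simp add: gL_def fL_def; fail) | (simp add: pU_def pV_def cU_def cV_def; fail)\<close>)+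
qed

lemma rCD: assumes "(m::int) \<ge> 3" obtains
"t \<le> -m" "cU m t = -2*m" "cV m t = 2*m"
 | "-m < t" "t < 0" "cU m t = -m+t" "cV m t = 3*m+t"
 | "t = 0" "cU m t = -m" "cV m t = 3*m"
 | "t = 1" "cU m t = m-3" "cV m t = m"
 | "1 < t" "t < m-1" "cU m t = 2*m-4*t" "cV m t = 0"
 | "t = m-1" "cU m t = 3-m" "cV m t = -m"
 | "t = m" "cU m t = m" "cV m t = -3*m"
 | "m < t" "t < 2*m" "cU m t = t" "cV m t = t-4*m"
 | "2*m \<le> t" "cU m t = 2*m" "cV m t = -2*m"
proof (rule regions9[OF assms, of t], goal_cases)
  case 1 show ?case by (rule that(1)) (use 1 assms in \<open>(simp add: wA_eq fR_def; fail) | (simp add: gL_def fL_def; fail) | (simp add: pU_def pV_def cU_def cV_def; fail)\<close>)+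
next
  case 2 show ?case by (rule that(2)) (use 2 assms in \<open>(simp add: wA_eq fR_def; fail) | (simp add: gL_def fL_def; fail) | (simp add: pU_def pV_def cU_def cV_def; fail)\<close>)+
next
  case 3 show ?case by (rule that(3)) (use 3 assms in \<open>(simp add: wA_eq fR_def; fail) | (simp add: gL_def fL_def; fail) | (simp add: pU_def pV_def cU_def cV_def; fail)\<close>)+
next
  case 4 show ?case by (rule that(4)) (use 4 assms in \<open>(simp add: wA_eq fR_def; fail) | (simp add: gL_def fL_def; fail) | (simp add: pU_def pV_def cU_def cV_def; fail)\<close>)+
next
  case 5 show ?case by (rule that(5)) (use 5 assms in \<open>(simp add: wA_eq fR_def; fail) | (simp add: gL_def fL_def; fail) | (simp add: pU_def pV_def cU_def cV_def; fail)\<close>)+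
next
  case 6 show ?case by (rule that(6)) (use 6 assms in \<open>(simp add: wA_eq fR_def; fail) | (simp add: gL_def fL_def; fail) | (simp add: pU_def pV_def cU_def cV_def; fail)\<close>)+
next
  case 7 show ?case by (rule that(7)) (use 7 assms in \<open>(simp add: wA_eq fR_def; fail) | (simp add: gL_def fL_def; fail) | (simp add: pU_def pV_def cU_def cV_def; fail)\<close>)+
next
  case 8 show ?case by (rule that(8)) (use 8 assms in \<open>(simp add: wA_eq fR_def; fail) | (simp add: gL_def fL_def; fail) | (simp add: pU_def pV_def cU_def cV_def; fail)\<close>)+
next
  case 9 show ?case by (rule that(9)) (use 9 assms in \<open>(simp add: wA_eq fR_def; fail) | (simp add: gL_def fL_def; fail) | (simp add: pU_def pV_def cU_def cV_def; fail)\<close>)+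
qed


section \<open>The inequalities behind the quadrilateral condition\<close>

text \<open>In a triangle on a diameter the two other sides carry \<open>t\<close> and
  \<open>m - t\<close>. An expression \<open>pU m t - pU m (m - t)\<close> would be antisymmetric by
  its form; \<open>cU\<close> and \<open>cV\<close> need the same property so that the triangle can
  be read from either side.\<close>

lemma cU_refl: assumes m: "m \<ge> 3" shows "cU m (m - t) = - cU m t" using m
  by - (rule rC[OF m, of t ]; (linarith | (rule rC[OF m, of "m - t" ]; (linarith | simp))))
lemma cV_refl: assumes m: "m \<ge> 3" shows "cV m (m - t) = - cV m t" using m
  by - (rule rD[OF m, of t ]; (linarith | (rule rD[OF m, of "m - t" ]; (linarith | simp))))
text \<open>For the flip of a diameter when the old and the new one end in blocks of different
  kinds.\<close>

lemma cUV: assumes m: "m \<ge> 3" shows "\<bar>cV m t - cU m t\<bar> \<le> 4*m" using m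
  by - (rule rCD[OF m, of t ]; (linarith | simp))

text \<open>Three vertices in one block, the fourth in an adjacent one: the triangle inside the
  block has value 0, so three terms remain. Here and below, one variable is split at a time, and
  \<open>linarith\<close> discards the regions that contradict the order before the next
  split.\<close>

lemma wA_step: assumes m: "m \<ge> 3" and "x < y" "y < z"
  shows "\<bar>wA m x y + wA m y z - wA m x z\<bar> \<le> 4*m"
  using assms by - (rule regR[OF m, of z y x]; (linarith | (rule regLR[OF m, of y x]; (linarith | (rule regL[OF m, of x]; (linarith | simp))))))

text \<open>Quadrilaterals that meet three blocks and have two vertices in an outer one. In the
  \<open>central\<close> variants the longest side is a diameter, whose triangles bring in
  \<open>2 * m\<close> and \<open>cU\<close> or \<open>cV\<close>.\<close>

lemma pU_le: assumes m: "m \<ge> 3" and "x < y" shows "\<bar>pU m y - pU m x - wA m x y - 4*m\<bar> \<le> 4*m"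
  using assms by - (rule yU[OF m, of y x]; (linarith | (rule xU[OF m, of x ]; (linarith | simp))))
lemma pU_central: assumes m: "m \<ge> 3" and "x < y" shows "\<bar>pU m y - pU m (m - x) - wA m x y - cU m x - 2*m\<bar> \<le> 4*m"
  using assms by - (rule yU[OF m, of y x]; (linarith | (rule xC[OF m, of x ]; (linarith | (rule rU[OF m, of "m - x" ]; (linarith | simp))))))
lemma pV_le: assumes m: "m \<ge> 3" and "x < y" shows "\<bar>eV m (y - x) + pV m y - pV m x + wA m x y\<bar> \<le> 4*m"
  using assms unfolding eV_def by (cases "y - x < m"; simp only: if_True if_False) (rule yV[OF m, of y x]; (linarith | (rule xV[OF m, of x ]; (linarith | simp))))+
lemma pV_central: assumes m: "m \<ge> 3" and "x < y" shows "\<bar>2*m + pV m (m - y) - pV m x + wA m x y + cV m y\<bar> \<le> 4*m"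
  using assms by - (rule yD[OF m, of y x]; (linarith | (rule xV[OF m, of x ]; (linarith | (rule rV[OF m, of "m - y" ]; (linarith | simp))))))
text \<open>Two vertices in the middle one of three blocks, with a diameter as the longest side; the
  two triangles on that side give the two values of \<open>cU\<close>.\<close>

lemma cU_pair: assumes m: "m \<ge> 3" and "x < y" shows "\<bar>cU m x - cU m y - wA m x y - wA m (m - y) (m - x)\<bar> \<le> 4*m"
  using assms by - (rule yC[OF m, of y x]; (linarith | (rule xC[OF m, of x ]; (linarith | (rule regR[OF m, of "m - x" "m - y" "m - y"]; (linarith | (rule regL[OF m, of "m - y"]; (linarith | simp))))))))
lemma cV_pair: assumes m: "m \<ge> 3" and "x < y" shows "\<bar>cV m x - cV m y + wA m x y + wA m (m - y) (m - x)\<bar> \<le> 4*m"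
  using assms by - (rule yD[OF m, of y x]; (linarith | (rule xD[OF m, of x ]; (linarith | (rule regR[OF m, of "m - x" "m - y" "m - y"]; (linarith | (rule regL[OF m, of "m - y"]; (linarith | simp))))))))

lemma HU_le: assumes m: "m \<ge> 3" and "x < y" shows "pU m x - pU m y - wA m x y \<le> 2*m"
  using assms by - (rule yU[OF m, of y x]; (linarith | (rule xU[OF m, of x ]; (linarith | simp))))
lemma HU_ge: assumes m: "m \<ge> 3" and "x < y" shows "-4*m \<le> pU m x - pU m y - wA m x y"
  using assms by - (rule yU[OF m, of y x]; (linarith | (rule xU[OF m, of x ]; (linarith | simp))))
lemma HU_ge': assumes m: "m \<ge> 3" and "x < y" "0 \<le> x \<or> m < y" shows "-2*m \<le> pU m x - pU m y - wA m x y"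
  using assms by - (rule yU[OF m, of y x]; (linarith | (rule xU[OF m, of x ]; (linarith | simp))))
lemma HU_nonneg: assumes m: "m \<ge> 3" and "x < y" "1 \<le> x" "m < y" shows "0 \<le> pU m x - pU m y - wA m x y"
  using assms by - (rule yU[OF m, of y x]; (linarith | (rule xU[OF m, of x ]; (linarith | simp))))
lemma HV: assumes m: "m \<ge> 3" and "x < y" shows "\<bar>pV m x - pV m y + wA m x y\<bar> \<le> 2*m"
  using assms by - (rule yV[OF m, of y x]; (linarith | (rule xV[OF m, of x ]; (linarith | simp))))

text \<open>Four variables range over eight regions each. The two bounds and the regions of
  \<open>bd\<close> get separate lemmas, so that every single case distinction stays small.\<close>

lemma coreW_U0: assumes m: "m \<ge> 3" and "ac<ad" "ad \<le> bc" "bc<bd" "ad+bc=ac+bd" "bd \<le> -m"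
  shows "wA m ad bd + wA m bc bd - wA m ac bc - wA m ac ad \<le> 4*m"
  using assms by - (rule regR[OF m, of bd ad bc]; (linarith | (rule regLR[OF m, of ad ac]; (linarith | (rule regLR[OF m, of bc ac]; (linarith | (rule regL[OF m, of ac]; (linarith | simp))))))))

lemma coreW_U1: assumes m: "m \<ge> 3" and "ac<ad" "ad \<le> bc" "bc<bd" "ad+bc=ac+bd" "-m < bd \<and> bd < 0"
  shows "wA m ad bd + wA m bc bd - wA m ac bc - wA m ac ad \<le> 4*m"
  using assms by - (rule regR[OF m, of bd ad bc]; (linarith | (rule regLR[OF m, of ad ac]; (linarith | (rule regLR[OF m, of bc ac]; (linarith | (rule regL[OF m, of ac]; (linarith | simp))))))))

lemma coreW_U2: assumes m: "m \<ge> 3" and "ac<ad" "ad \<le> bc" "bc<bd" "ad+bc=ac+bd" "bd = 0"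
  shows "wA m ad bd + wA m bc bd - wA m ac bc - wA m ac ad \<le> 4*m"
  using assms by - (rule regR[OF m, of bd ad bc]; (linarith | (rule regLR[OF m, of ad ac]; (linarith | (rule regLR[OF m, of bc ac]; (linarith | (rule regL[OF m, of ac]; (linarith | simp))))))))

lemma coreW_U3: assumes m: "m \<ge> 3" and "ac<ad" "ad \<le> bc" "bc<bd" "ad+bc=ac+bd" "bd = 1"
  shows "wA m ad bd + wA m bc bd - wA m ac bc - wA m ac ad \<le> 4*m"
  using assms by - (rule regR[OF m, of bd ad bc]; (linarith | (rule regLR[OF m, of ad ac]; (linarith | (rule regLR[OF m, of bc ac]; (linarith | (rule regL[OF m, of ac]; (linarith | simp))))))))

lemma coreW_U4: assumes m: "m \<ge> 3" and "ac<ad" "ad \<le> bc" "bc<bd" "ad+bc=ac+bd" "1 < bd \<and> bd < m-1"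
  shows "wA m ad bd + wA m bc bd - wA m ac bc - wA m ac ad \<le> 4*m"
  using assms by - (rule regR[OF m, of bd ad bc]; (linarith | (rule regLR[OF m, of ad ac]; (linarith | (rule regLR[OF m, of bc ac]; (linarith | (rule regL[OF m, of ac]; (linarith | simp))))))))

lemma coreW_U5: assumes m: "m \<ge> 3" and "ac<ad" "ad \<le> bc" "bc<bd" "ad+bc=ac+bd" "bd = m-1"
  shows "wA m ad bd + wA m bc bd - wA m ac bc - wA m ac ad \<le> 4*m"
  using assms by - (rule regR[OF m, of bd ad bc]; (linarith | (rule regLR[OF m, of ad ac]; (linarith | (rule regLR[OF m, of bc ac]; (linarith | (rule regL[OF m, of ac]; (linarith | simp))))))))

lemma coreW_U6: assumes m: "m \<ge> 3" and "ac<ad" "ad \<le> bc" "bc<bd" "ad+bc=ac+bd" "bd = m"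
  shows "wA m ad bd + wA m bc bd - wA m ac bc - wA m ac ad \<le> 4*m"
  using assms by - (rule regR[OF m, of bd ad bc]; (linarith | (rule regLR[OF m, of ad ac]; (linarith | (rule regLR[OF m, of bc ac]; (linarith | (rule regL[OF m, of ac]; (linarith | simp))))))))

lemma coreW_U7: assumes m: "m \<ge> 3" and "ac<ad" "ad \<le> bc" "bc<bd" "ad+bc=ac+bd" "m < bd"
  shows "wA m ad bd + wA m bc bd - wA m ac bc - wA m ac ad \<le> 4*m"
  using assms by - (rule regR[OF m, of bd ad bc]; (linarith | (rule regLR[OF m, of ad ac]; (linarith | (rule regLR[OF m, of bc ac]; (linarith | (rule regL[OF m, of ac]; (linarith | simp))))))))

lemma coreW_L0: assumes m: "m \<ge> 3" and "ac<ad" "ad \<le> bc" "bc<bd" "ad+bc=ac+bd" "bd \<le> -m"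
  shows "-4*m \<le> wA m ad bd + wA m bc bd - wA m ac bc - wA m ac ad"
  using assms by - (rule regR[OF m, of bd ad bc]; (linarith | (rule regLR[OF m, of ad ac]; (linarith | (rule regLR[OF m, of bc ac]; (linarith | (rule regL[OF m, of ac]; (linarith | simp))))))))

lemma coreW_L1: assumes m: "m \<ge> 3" and "ac<ad" "ad \<le> bc" "bc<bd" "ad+bc=ac+bd" "-m < bd \<and> bd < 0"
  shows "-4*m \<le> wA m ad bd + wA m bc bd - wA m ac bc - wA m ac ad"
  using assms by - (rule regR[OF m, of bd ad bc]; (linarith | (rule regLR[OF m, of ad ac]; (linarith | (rule regLR[OF m, of bc ac]; (linarith | (rule regL[OF m, of ac]; (linarith | simp))))))))

lemma coreW_L2: assumes m: "m \<ge> 3" and "ac<ad" "ad \<le> bc" "bc<bd" "ad+bc=ac+bd" "bd = 0"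
  shows "-4*m \<le> wA m ad bd + wA m bc bd - wA m ac bc - wA m ac ad"
  using assms by - (rule regR[OF m, of bd ad bc]; (linarith | (rule regLR[OF m, of ad ac]; (linarith | (rule regLR[OF m, of bc ac]; (linarith | (rule regL[OF m, of ac]; (linarith | simp))))))))

lemma coreW_L3: assumes m: "m \<ge> 3" and "ac<ad" "ad \<le> bc" "bc<bd" "ad+bc=ac+bd" "bd = 1"
  shows "-4*m \<le> wA m ad bd + wA m bc bd - wA m ac bc - wA m ac ad"
  using assms by - (rule regR[OF m, of bd ad bc]; (linarith | (rule regLR[OF m, of ad ac]; (linarith | (rule regLR[OF m, of bc ac]; (linarith | (rule regL[OF m, of ac]; (linarith | simp))))))))

lemma coreW_L4: assumes m: "m \<ge> 3" and "ac<ad" "ad \<le> bc" "bc<bd" "ad+bc=ac+bd" "1 < bd \<and> bd < m-1"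
  shows "-4*m \<le> wA m ad bd + wA m bc bd - wA m ac bc - wA m ac ad"
  using assms by - (rule regR[OF m, of bd ad bc]; (linarith | (rule regLR[OF m, of ad ac]; (linarith | (rule regLR[OF m, of bc ac]; (linarith | (rule regL[OF m, of ac]; (linarith | simp))))))))

lemma coreW_L5: assumes m: "m \<ge> 3" and "ac<ad" "ad \<le> bc" "bc<bd" "ad+bc=ac+bd" "bd = m-1"
  shows "-4*m \<le> wA m ad bd + wA m bc bd - wA m ac bc - wA m ac ad"
  using assms by - (rule regR[OF m, of bd ad bc]; (linarith | (rule regLR[OF m, of ad ac]; (linarith | (rule regLR[OF m, of bc ac]; (linarith | (rule regL[OF m, of ac]; (linarith | simp))))))))

lemma coreW_L6: assumes m: "m \<ge> 3" and "ac<ad" "ad \<le> bc" "bc<bd" "ad+bc=ac+bd" "bd = m"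
  shows "-4*m \<le> wA m ad bd + wA m bc bd - wA m ac bc - wA m ac ad"
  using assms by - (rule regR[OF m, of bd ad bc]; (linarith | (rule regLR[OF m, of ad ac]; (linarith | (rule regLR[OF m, of bc ac]; (linarith | (rule regL[OF m, of ac]; (linarith | simp))))))))

lemma coreW_L7: assumes m: "m \<ge> 3" and "ac<ad" "ad \<le> bc" "bc<bd" "ad+bc=ac+bd" "m < bd"
  shows "-4*m \<le> wA m ad bd + wA m bc bd - wA m ac bc - wA m ac ad"
  using assms by - (rule regR[OF m, of bd ad bc]; (linarith | (rule regLR[OF m, of ad ac]; (linarith | (rule regLR[OF m, of bc ac]; (linarith | (rule regL[OF m, of ac]; (linarith | simp))))))))

lemma coreW_U: assumes m: "m \<ge> 3" and o: "ac<ad" "ad \<le> bc" "bc<bd" "ad+bc=ac+bd"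
  shows "wA m ad bd + wA m bc bd - wA m ac bc - wA m ac ad \<le> 4*m"
proof (rule regions8[OF m, of bd], goal_cases)
  case 1
  show ?case by (rule coreW_U0[OF m o]) (use 1 in simp)
next
  case 2
  show ?case by (rule coreW_U1[OF m o]) (use 2 in simp)
next
  case 3
  show ?case by (rule coreW_U2[OF m o]) (use 3 in simp)
next
  case 4
  show ?case by (rule coreW_U3[OF m o]) (use 4 in simp)
next
  case 5
  show ?case by (rule coreW_U4[OF m o]) (use 5 in simp)
next
  case 6
  show ?case by (rule coreW_U5[OF m o]) (use 6 in simp)
next
  case 7
  show ?case by (rule coreW_U6[OF m o]) (use 7 in simp)
next
  case 8
  show ?case by (rule coreW_U7[OF m o]) (use 8 in simp)
qed

lemma coreW_L: assumes m: "m \<ge> 3" and o: "ac<ad" "ad \<le> bc" "bc<bd" "ad+bc=ac+bd"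
  shows "-4*m \<le> wA m ad bd + wA m bc bd - wA m ac bc - wA m ac ad"
proof (rule regions8[OF m, of bd], goal_cases)
  case 1
  show ?case by (rule coreW_L0[OF m o]) (use 1 in simp)
next
  case 2
  show ?case by (rule coreW_L1[OF m o]) (use 2 in simp)
next
  case 3
  show ?case by (rule coreW_L2[OF m o]) (use 3 in simp)
next
  case 4
  show ?case by (rule coreW_L3[OF m o]) (use 4 in simp)
next
  case 5
  show ?case by (rule coreW_L4[OF m o]) (use 5 in simp)
next
  case 6
  show ?case by (rule coreW_L5[OF m o]) (use 6 in simp)
next
  case 7
  show ?case by (rule coreW_L6[OF m o]) (use 7 in simp)
next
  case 8
  show ?case by (rule coreW_L7[OF m o]) (use 8 in simp)
qed

section \<open>The value of a triangle and the quadrilateral inequality, by block patterns\<close>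

text \<open>\<open>c\<close> marks a triangle on a diameter. Flipping a diameter within blocks of
  one kind turns such a value into its negative, so it has to be \<open>2 * m\<close> for a change
  of \<open>4 * m\<close>.\<close>

definition vv :: "int \<Rightarrow> bool \<Rightarrow> int \<Rightarrow> bool \<Rightarrow> int" where
  "vv m p d c = (if c then 2*m else if p then 4*m else eV m d)"

text \<open>\<open>p\<close> tells whether the first vertex lies in a U block, \<open>j\<close> and
  \<open>l\<close> count the blocks from it to the other two vertices, and \<open>x\<close>,
  \<open>y\<close>, \<open>z\<close> are the depths. In \<open>wA\<close>, \<open>pU\<close> and
  \<open>pV\<close>, a side from U to the next V enters through its depth difference
  \<open>t\<close>, and a side from V to the next U through \<open>m - t\<close> with the opposite
  sign. If \<open>l = 2\<close>, the third vertex lies in the translate of the first block, and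
  \<open>x = z\<close> means that the longest side is a diameter.\<close>

definition tri_pot :: "int \<Rightarrow> bool \<Rightarrow> int \<Rightarrow> int \<Rightarrow> int \<Rightarrow> int \<Rightarrow> int \<Rightarrow> int" where
  "tri_pot m p j l x y z =
    (if l = 0 then 0
     else if l = 1 then
       (if p then (if j = 0 then wA m (x - z) (y - z) else wA m (x - y) (x - z))
        else - (if j = 0 then wA m (m - (z - y)) (m - (z - x)) else wA m (m - (z - x)) (m - (y - x))))
     else if j = 1 then
       (if p then (if x = z then cU m (x - y) else pU m (x - y) - pU m (m - (z - y)))
        else (if x = z then cV m (y - z) else pV m (y - z) - pV m (m - (y - x))))
     else if j = 0 then (if p then - vv m p (y - x) (x = z) else vv m p (x - y) (x = z))
     else (if p then vv m p (z - y) (x = z) else - vv m p (y - z) (x = z)))"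

text \<open>Two vertices \<open>a\<close>, \<open>b\<close> in one block and \<open>c\<close>,
  \<open>d\<close> in an adjacent one. The variables are the depth differences of the four pairs
  that join the blocks, hence their linear relation.\<close>

lemma coreW: assumes m: "m \<ge> 3" and o: "ac < ad" "ac < bc" "ad < bd" "bc < bd" "ad + bc = ac + bd"
  shows "\<bar>wA m ad bd + wA m bc bd - wA m ac bc - wA m ac ad\<bar> \<le> 4*m"
proof (cases "ad \<le> bc")
  case True
  show ?thesis using coreW_U[OF m o(1) True o(4,5)] coreW_L[OF m o(1) True o(4,5)] by (simp add: abs_le_iff)
next
  \<comment> \<open>The sum is symmetric in \<open>ad\<close> and \<open>bc\<close>.\<close>
  case False
  have "bc \<le> ad" "bc + ad = ac + bd" using False o by auto
  from coreW_U[OF m o(2) this(1) o(3) this(2)] coreW_L[OF m o(2) this(1) o(3) this(2)]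
  show ?thesis by (simp add: abs_le_iff)
qed

text \<open>One summand ranges within \<open>[-4 * m, 2 * m]\<close>, so two of them might reach
  \<open>-8 * m\<close>. A summand falls below \<open>-2 * m\<close> only if its left argument is
  negative and its right one at most \<open>m\<close>; then \<open>m < x + y'\<close> pushes the
  other summand into the region where it is nonnegative.\<close>

lemma HU_pair:
  assumes m: "m \<ge> 3" and o: "x < y" "y - x = y' - x'" "m < x + y'"
  shows "\<bar>(pU m x - pU m y - wA m x y) + (pU m x' - pU m y' - wA m x' y')\<bar> \<le> 4*m"
proof -
  have o': "x' < y'" "m < x' + y" using o by linarith+
  have u: "pU m x - pU m y - wA m x y \<le> 2*m" "pU m x' - pU m y' - wA m x' y' \<le> 2*m"
    using HU_le[OF m o(1)] HU_le[OF m o'(1)] by auto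
  have l: "-4*m \<le> pU m x - pU m y - wA m x y" "-4*m \<le> pU m x' - pU m y' - wA m x' y'"
    using HU_ge[OF m o(1)] HU_ge[OF m o'(1)] by auto
  consider "(0 \<le> x \<or> m < y) \<and> (0 \<le> x' \<or> m < y')" | "x < 0" "y \<le> m" | "x' < 0" "y' \<le> m" by linarith
  then have "-4*m \<le> (pU m x - pU m y - wA m x y) + (pU m x' - pU m y' - wA m x' y')"
  proof cases
    case 1
    then show ?thesis using HU_ge'[OF m o(1)] HU_ge'[OF m o'(1)] by auto
  next
    case 2
    then have "1 \<le> x'" "m < y'" using o o' by linarith+
    then show ?thesis using HU_nonneg[OF m o'(1)] l by auto
  next
    case 3
    then have "1 \<le> x" "m < y" using o o' by linarith+
    then show ?thesis using HU_nonneg[OF m o(1)] l by auto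
  qed
  then show ?thesis using u by (simp add: abs_le_iff)
qed

lemma eV_bounds: "m \<ge> 3 \<Longrightarrow> 0 < d \<Longrightarrow> 2*m \<le> eV m d \<and> eV m d \<le> 4*m"
  unfolding eV_def by auto
text \<open>For three vertices in one V block and the fourth in a neighbouring V block:
  \<open>eV\<close> must be additive up to \<open>4 * m\<close>.\<close>

lemma eV_add: "m \<ge> 3 \<Longrightarrow> 0 < d \<Longrightarrow> 0 < e \<Longrightarrow> \<bar>eV m d + eV m e - eV m (d + e)\<bar> \<le> 4*m"
  unfolding eV_def by auto

lemma three: assumes "0 \<le> kb" "kb \<le> kc" "kc \<le> kd" "kd \<le> (2::int)"
  obtains "kb=0" "kc=0" "kd=0" | "kb=0" "kc=0" "kd=1" | "kb=0" "kc=1" "kd=1" | "kb=1" "kc=1" "kd=1"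
   | "kb=0" "kc=0" "kd=2" | "kb=0" "kc=1" "kd=2" | "kb=0" "kc=2" "kd=2" | "kb=1" "kc=1" "kd=2"
   | "kb=1" "kc=2" "kd=2" | "kb=2" "kc=2" "kd=2"
  using assms by atomize_elim presburger

text \<open>Vertices are replaced by block differences and depths. The assumptions \<open>o1\<close>
  to \<open>o3\<close> express increasing positions, since depth rises along U and falls along V;
  \<open>o4\<close> expresses that the last vertex is at most the first one shifted by
  \<open>n\<close>. Ten block patterns remain.\<close>

lemma quadU:
  assumes m: "m \<ge> 3" and k: "0 \<le> kb" "kb \<le> kc" "kc \<le> kd" "kd \<le> 2"
    and o1: "kb = 0 \<Longrightarrow> xa < xb" and o2: "kc = kb \<Longrightarrow> (if even kb then xb < xc else xc < xb)"
    and o3: "kd = kc \<Longrightarrow> (if even kc then xc < xd else xd < xc)" and o4: "kd = 2 \<Longrightarrow> xd \<le> xa"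
  shows "\<bar>tri_pot m True kb kd xa xb xd + tri_pot m (even kb) (kc - kb) (kd - kb) xb xc xd
     - tri_pot m True kb kc xa xb xc - tri_pot m True kc kd xa xc xd\<bar> \<le> 4*m"
  using k
proof (cases rule: three)
  case 1 then show ?thesis using m by (simp add: tri_pot_def)
next
  case 2
  then show ?thesis using wA_step[OF m, of "xa - xd" "xb - xd" "xc - xd"] o1 o2 by (simp add: tri_pot_def abs_le_iff)
next
  case 3
  then show ?thesis using coreW[OF m, of "xa - xc" "xa - xd" "xb - xc" "xb - xd"] o1 o3 by (simp add: tri_pot_def abs_le_iff)
next
  case 4
  then show ?thesis using wA_step[OF m, of "xa - xb" "xa - xc" "xa - xd"] o2 o3 by (simp add: tri_pot_def abs_le_iff)
next
  case 5
  then show ?thesis using m o1 o2 o4 by (auto simp: tri_pot_def vv_def)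
next
  case 6
  then have o: "xa - xc < xb - xc" "xd \<noteq> xb" using o1 o4 by auto
  show ?thesis
    using 6 o pU_le[OF m o(1)] pU_central[OF m o(1)] by (cases "xa = xd") (auto simp: tri_pot_def vv_def abs_le_iff)
next
  case 7
  then show ?thesis using m o1 o3 o4 by (auto simp: tri_pot_def vv_def)
next
  case 8
  then have o: "xa - xb < xa - xc" "m - (xd - xc) < m - (xd - xb)" using o2 by auto
  show ?thesis
  proof (cases "xa = xd")
    case True
    then show ?thesis using 8 cU_pair[OF m o(1)] by (simp add: tri_pot_def abs_le_iff)
  next
    case False
    \<comment> \<open>The strict inequality \<open>xd < xa\<close> is what the hypothesis
      \<open>m < x + y'\<close> of \<open>HU_pair\<close> amounts to here.\<close>
    then show ?thesis using 8 o4 HU_pair[OF m o(1), of "m - (xd - xb)" "m - (xd - xc)"]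
      by (simp add: tri_pot_def abs_le_iff)
  qed
next
  case 9
  then have o: "m - (xd - xb) < m - (xc - xb)" "xa \<noteq> xc" using o3 o4 by auto
  show ?thesis
  proof (cases "xa = xd")
    case True
    \<comment> \<open>The diameter triangle with apex \<open>b\<close> has the argument
      \<open>xa - xb\<close>, whereas \<open>pU_central\<close> involves its reflection.\<close>
    then show ?thesis using 9 o pU_central[OF m o(1)] cU_refl[OF m, of "xd - xb"]
      by (simp add: tri_pot_def vv_def abs_le_iff)
  next
    case False
    then show ?thesis using 9 o pU_le[OF m o(1)] by (simp add: tri_pot_def vv_def abs_le_iff)
  qed
next
  case 10
  then show ?thesis using m o2 o3 o4 by (auto simp: tri_pot_def vv_def)
qed

text \<open>With two vertices in the middle block, each half stays within \<open>2 * m\<close> by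
  \<open>HV\<close>, unlike in \<open>quadU\<close>. The patterns with several vertices in one V
  block are governed by \<open>eV\<close>.\<close>

lemma quadV:
  assumes m: "m \<ge> 3" and k: "0 \<le> kb" "kb \<le> kc" "kc \<le> kd" "kd \<le> 2"
    and o1: "kb = 0 \<Longrightarrow> xb < xa" and o2: "kc = kb \<Longrightarrow> (if odd kb then xb < xc else xc < xb)"
    and o3: "kd = kc \<Longrightarrow> (if odd kc then xc < xd else xd < xc)" and o4: "kd = 2 \<Longrightarrow> xa \<le> xd"
  shows "\<bar>tri_pot m False kb kd xa xb xd + tri_pot m (odd kb) (kc - kb) (kd - kb) xb xc xd
     - tri_pot m False kb kc xa xb xc - tri_pot m False kc kd xa xc xd\<bar> \<le> 4*m"
  using k
proof (cases rule: three)
  case 1 then show ?thesis using m by (simp add: tri_pot_def)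
next
  case 2
  then show ?thesis using wA_step[OF m, of "m - (xd - xc)" "m - (xd - xb)" "m - (xd - xa)"] o1 o2 by (simp add: tri_pot_def abs_le_iff)
next
  case 3
  then show ?thesis
    using coreW[OF m, of "m - (xd - xb)" "m - (xc - xb)" "m - (xd - xa)" "m - (xc - xa)"] o1 o3
    by (simp add: tri_pot_def abs_le_iff)
next
  case 4
  then show ?thesis using wA_step[OF m, of "m - (xd - xa)" "m - (xc - xa)" "m - (xb - xa)"] o2 o3 by (simp add: tri_pot_def abs_le_iff)
next
  case 5
  then show ?thesis using o1 o2 o4 eV_bounds[OF m, of "xb - xc"] eV_add[OF m, of "xa - xb" "xb - xc"]
    by (auto simp: tri_pot_def vv_def abs_le_iff)
next
  case 6
  then have o: "m - (xc - xb) < m - (xc - xa)" "xd \<noteq> xb" using o1 o4 by auto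
  show ?thesis
  proof (cases "xa = xd")
    case True
    then show ?thesis using 6 o pV_central[OF m o(1)] cV_refl[OF m, of "xc - xa"]
      by (simp add: tri_pot_def vv_def abs_le_iff)
  next
    case False
    then show ?thesis using 6 o pV_le[OF m o(1)] by (simp add: tri_pot_def vv_def abs_le_iff)
  qed
next
  case 7
  then show ?thesis using o1 o3 o4 eV_bounds[OF m, of "xc - xd"] eV_bounds[OF m, of "xa - xb"]
    by (auto simp: tri_pot_def vv_def abs_le_iff)
next
  case 8
  then have o: "xb - xd < xc - xd" using o2 by auto
  show ?thesis
  proof (cases "xa = xd")
    case True
    then show ?thesis using 8 cV_pair[OF m o] by (simp add: tri_pot_def abs_le_iff)
  next
    case False
    have "m - (xc - xa) < m - (xb - xa)" using o by auto
    then show ?thesis using False 8 o4 HV[OF m o] HV[OF m, of "m - (xc - xa)" "m - (xb - xa)"]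
      by (simp add: tri_pot_def abs_le_iff)
  qed
next
  case 9
  then have o: "xb - xc < xb - xd" "xa \<noteq> xc" using o3 o4 by auto
  show ?thesis
  proof (cases "xa = xd")
    case True
    then show ?thesis using 9 o pV_central[OF m o(1)] by (simp add: tri_pot_def vv_def abs_le_iff)
  next
    case False
    then show ?thesis using 9 o pV_le[OF m o(1)] by (simp add: tri_pot_def vv_def abs_le_iff)
  qed
next
  case 10
  then show ?thesis using o2 o3 o4 eV_bounds[OF m, of "xb - xc"] eV_add[OF m, of "xb - xc" "xc - xd"]
    eV_bounds[OF m, of "xc - xd"]
    by (auto simp: tri_pot_def vv_def abs_le_iff)
qed

section \<open>Blocks and depths of the integers\<close>

text \<open>A consecutive numbering of the blocks on the integer line: U blocks get even numbers, V
  blocks odd ones, and the shift by \<open>n\<close> adds 2.\<close>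

definition hgt :: "int \<Rightarrow> int \<Rightarrow> int \<Rightarrow> int" where
  "hgt n h a = 2 * (a div n) + (if a mod n < h then 0 else 1)"

text \<open>The distance to the multiple of \<open>n\<close> that bounds the block: on the left for
  U, on the right for V. So \<open>j\<close> in U and \<open>n - j\<close> in V have the same depth,
  and edges of vertex sum \<open>n\<close> join equal depths.\<close>

definition dep :: "int \<Rightarrow> int \<Rightarrow> int \<Rightarrow> int" where
  "dep n h a = (if a mod n < h then a mod n else n - a mod n)"

definition gpot :: "int \<Rightarrow> int \<Rightarrow> int \<Rightarrow> int \<times> int \<times> int \<Rightarrow> int" where
  "gpot n h m = (\<lambda>(a, b, c). tri_pot m (even (hgt n h a)) (hgt n h b - hgt n h a) (hgt n h c - hgt n h a)
      (dep n h a) (dep n h b) (dep n h c))"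

lemma hgt_shift: "n > 0 \<Longrightarrow> hgt n h (a + n) = hgt n h a + 2" and dep_shift: "dep n h (a + n) = dep n h a"
  unfolding hgt_def dep_def by simp_all

lemma hgt_mono: assumes "n > 0" "a < b"
  shows "hgt n h a \<le> hgt n h b \<and> (hgt n h a = hgt n h b \<longrightarrow> (if even (hgt n h a) then dep n h a < dep n h b else dep n h b < dep n h a))"
proof -
  have d: "a div n \<le> b div n" using assms by (intro zdiv_mono1) auto
  show ?thesis
  proof (cases "a div n = b div n")
    case True
    have "a mod n < b mod n"
      using True assms(2) div_mult_mod_eq[of a n] div_mult_mod_eq[of b n] by (metis add_less_cancel_left)
    then show ?thesis using True by (auto simp: hgt_def dep_def)
  next
    case False
    then have "a div n < b div n" using d by simp
    then show ?thesis by (auto simp: hgt_def dep_def)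
  qed
qed

lemma hgt_span: assumes "n > 0" "b \<le> a + n"
  shows "hgt n h b \<le> hgt n h a + 2 \<and> (hgt n h b = hgt n h a + 2 \<longrightarrow> (if even (hgt n h a) then dep n h b \<le> dep n h a else dep n h a \<le> dep n h b))"
proof (cases "b = a + n")
  case True then show ?thesis using assms(1) by (simp add: hgt_shift dep_shift)
next
  case False
  then have "b < a + n" using assms by simp
  from hgt_mono[OF assms(1) this, of h] show ?thesis using assms(1) by (auto simp: hgt_shift dep_shift split: if_splits)
qed

lemma gpot_invariant: "n > 0 \<Longrightarrow> gpot n h m (a + n, b + n, c + n) = gpot n h m (a, b, c)"
  unfolding gpot_def by (simp add: hgt_shift dep_shift)

lemma gpot_quad:
  assumes n: "n > 0" and m: "m \<ge> 3" and o: "a < b" "b < c" "c < e" "e \<le> a + n"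
  shows "\<bar>gpot n h m (a, b, e) + gpot n h m (b, c, e) - gpot n h m (a, b, c) - gpot n h m (a, c, e)\<bar> \<le> 4*m"
proof -
  let ?H = "hgt n h" and ?x = "dep n h"
  define kb kc kd where kk: "kb = ?H b - ?H a" "kc = ?H c - ?H a" "kd = ?H e - ?H a"
  note s = hgt_mono[OF n o(1), of h] hgt_mono[OF n o(2), of h] hgt_mono[OF n o(3), of h] hgt_span[OF n o(4), of h]
  have k: "0 \<le> kb" "kb \<le> kc" "kc \<le> kd" "kd \<le> 2" using s unfolding kk by linarith+
  have H: "?H b = ?H a + kb" "?H c = ?H a + kc" "?H e = ?H a + kd" unfolding kk by simp_all
  have e: "even (?H b) = (even (?H a) = even kb)" "even (?H c) = (even (?H a) = even kc)" unfolding H by auto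
  show ?thesis
  proof (cases "even (?H a)")
    case True
    have "\<bar>tri_pot m True kb kd (?x a) (?x b) (?x e) + tri_pot m (even kb) (kc - kb) (kd - kb) (?x b) (?x c) (?x e)
     - tri_pot m True kb kc (?x a) (?x b) (?x c) - tri_pot m True kc kd (?x a) (?x c) (?x e)\<bar> \<le> 4*m"
      by (rule quadU[OF m k]) (use s e True in \<open>auto simp: H\<close>)
    then show ?thesis using True e unfolding gpot_def by (simp add: H)
  next
    case False
    have "\<bar>tri_pot m False kb kd (?x a) (?x b) (?x e) + tri_pot m (odd kb) (kc - kb) (kd - kb) (?x b) (?x c) (?x e)
     - tri_pot m False kb kc (?x a) (?x b) (?x c) - tri_pot m False kc kd (?x a) (?x c) (?x e)\<bar> \<le> 4*m"
      by (rule quadV[OF m k]) (use s e False in \<open>auto simp: H\<close>)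
    then show ?thesis using False e unfolding gpot_def by (simp add: H)
  qed
qed

text \<open>If \<open>a\<close> and \<open>b\<close> lie in blocks of the same kind, the two values
  are \<open>2 * m\<close> and \<open>-2 * m\<close> in some order; otherwise \<open>cU\<close> and
  \<open>cV\<close> meet at the same depth difference.\<close>

lemma gpot_diameter:
  assumes n: "n > 0" and m: "m \<ge> 3" and o: "a < b" "b < a + n"
  shows "\<bar>gpot n h m (b, a + n, b + n) - gpot n h m (a, b, a + n)\<bar> \<le> 4*m"
proof -
  let ?H = "hgt n h" and ?x = "dep n h"
  define kb where kb: "kb = ?H b - ?H a"
  have H: "?H b = ?H a + kb" unfolding kb by simp
  have "0 \<le> kb" "kb \<le> 2"
    using hgt_mono[OF n o(1), of h] hgt_span[OF n, of b a h] o unfolding kb by auto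
  then consider "kb = 0" | "kb = 1" | "kb = 2" by linarith
  then show ?thesis
    using m cUV[OF m, of "?x a - ?x b"] cUV[OF m, of "?x b - ?x a"]
    by cases (auto simp: gpot_def tri_pot_def vv_def H hgt_shift[OF n] dep_shift abs_le_iff)
qed

section \<open>Periodic arc systems and sums over orbits of triangles\<close>

text \<open>The polygon is unrolled to the integers, where central symmetry becomes the shift by
  \<open>n\<close>. Of the two ways around the polygon, only one of length at most \<open>n\<close>
  is recorded. A diameter has length \<open>n\<close>, and all its lifts form a single
  orbit.\<close>

locale arc_system =
  fixes n :: int and D :: "(int \<times> int) set"
  assumes n_pos: "n > 0"
    and arc: "(u, v) \<in> D \<Longrightarrow> u < v \<and> v \<le> u + n"
    and shift: "(u + n, v + n) \<in> D \<longleftrightarrow> (u, v) \<in> D"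
    and noncross: "(u, v) \<in> D \<Longrightarrow> (u', v') \<in> D \<Longrightarrow> u < u' \<Longrightarrow> u' < v \<Longrightarrow> v < v' \<Longrightarrow> False"

definition tris :: "(int \<times> int) set \<Rightarrow> (int \<times> int \<times> int) set" where
  "tris D = {(a, b, c). (a, b) \<in> D \<and> (b, c) \<in> D \<and> (a, c) \<in> D}"

definition orb2 :: "int \<Rightarrow> int \<times> int \<Rightarrow> (int \<times> int) set" where
  "orb2 n e = (\<lambda>k. (fst e + k * n, snd e + k * n)) ` UNIV"

definition orb3 :: "int \<Rightarrow> int \<times> int \<times> int \<Rightarrow> (int \<times> int \<times> int) set" where
  "orb3 n p = (\<lambda>k. (fst p + k * n, fst (snd p) + k * n, snd (snd p) + k * n)) ` UNIV"

text \<open>First vertices in \<open>[0, n)\<close> select one representative of each orbit, so a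
  triangle and its opposite are counted once together.\<close>

definition fsum :: "int \<Rightarrow> (int \<times> int \<times> int \<Rightarrow> int) \<Rightarrow> (int \<times> int \<times> int) set \<Rightarrow> int" where
  "fsum n g S = (\<Sum>p\<in>{p\<in>S. 0 \<le> fst p \<and> fst p < n}. g p)"

definition invariant :: "int \<Rightarrow> (int \<times> int \<times> int \<Rightarrow> int) \<Rightarrow> bool" where
  "invariant n g \<longleftrightarrow> (\<forall>a b c. g (a + n, b + n, c + n) = g (a, b, c))"

lemma shift_all:
  fixes P :: "int \<Rightarrow> 'a"
  assumes "\<And>j. P (j + n) = P j"
  shows "P (j + k * n) = P j"
proof -
  have nat: "P (j + int i * n) = P j" for i j
  proof (induction i)
    case (Suc i)
    have "P (j + int (Suc i) * n) = P ((j + int i * n) + n)" by (simp add: algebra_simps)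
    then show ?case using assms[of "j + int i * n"] Suc by simp
  qed simp
  show ?thesis
  proof (cases "k \<ge> 0")
    case True then show ?thesis using nat[of j "nat k"] by simp
  next
    case False then show ?thesis using nat[of "j + k * n" "nat (-k)"] by (simp add: algebra_simps)
  qed
qed

lemma disjoint3: "(\<And>p q r. (p, q, r) \<in> A \<Longrightarrow> (p, q, r) \<in> B \<Longrightarrow> False) \<Longrightarrow> A \<inter> B = {}"
  by auto

lemma invariant_shift:
  assumes "invariant n g"
  shows "g (a + k * n, b + k * n, c + k * n) = g (a, b, c)"
  using shift_all[of "\<lambda>j. g (a + j, b + j, c + j)" n 0 k] assms
  unfolding invariant_def by (simp add: add.assoc[symmetric])

lemma fsum_orb3:
  assumes "n > 0" "invariant n g"
  shows "fsum n g (orb3 n p) = g p"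
proof -
  obtain a b c where p: "p = (a, b, c)" by (metis prod_cases3)
  let ?k = "- (a div n)"
  have rng: "0 \<le> a + ?k * n" "a + ?k * n < n"
    using assms(1) by (simp_all add: minus_div_mult_eq_mod)
  have uniq: "k = ?k" if "0 \<le> a + k * n" "a + k * n < n" for k
  proof -
    have "(a + k * n) div n = 0" using that by simp
    then show ?thesis using assms(1) by simp
  qed
  have "{q \<in> orb3 n p. 0 \<le> fst q \<and> fst q < n} = {(a + ?k * n, b + ?k * n, c + ?k * n)}" (is "?L = {?x}")
  proof (intro equalityI subsetI)
    fix q assume q: "q \<in> ?L"
    then obtain k where k: "q = (a + k * n, b + k * n, c + k * n)" unfolding orb3_def p by auto
    with q have "k = ?k" by (intro uniq) auto
    with k show "q \<in> {?x}" by blast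
  next
    fix q assume "q \<in> {?x}"
    moreover have "?x \<in> orb3 n p" unfolding orb3_def p by (rule image_eqI[of _ _ ?k]) simp_all
    ultimately show "q \<in> ?L" using rng by auto
  qed
  then show ?thesis unfolding fsum_def using invariant_shift[OF assms(2), of a ?k b c] p by simp
qed

lemma fsum_Un:
  assumes "finite {p\<in>S. 0 \<le> fst p \<and> fst p < n}" "finite {p\<in>S'. 0 \<le> fst p \<and> fst p < n}" "S \<inter> S' = {}"
  shows "fsum n g (S \<union> S') = fsum n g S + fsum n g S'"
proof -
  have "{p\<in>S \<union> S'. 0 \<le> fst p \<and> fst p < n} = {p\<in>S. 0 \<le> fst p \<and> fst p < n} \<union> {p\<in>S'. 0 \<le> fst p \<and> fst p < n}" by auto
  then show ?thesis unfolding fsum_def using assms by (subst sum.union_disjoint[symmetric]) auto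
qed

context arc_system begin

lemma shiftk: "(u + k * n, v + k * n) \<in> D \<longleftrightarrow> (u, v) \<in> D"
  using shift_all[of "\<lambda>j. (u + j, v + j) \<in> D" n 0 k] shift[of "u + _" "v + _"] by (simp add: add.assoc[symmetric])

lemma tris_shiftk: "(a + k * n, b + k * n, c + k * n) \<in> tris D \<longleftrightarrow> (a, b, c) \<in> tris D"
  unfolding tris_def by (simp add: shiftk)

lemma orb3_subset: "(a, b, c) \<in> tris D \<Longrightarrow> orb3 n (a, b, c) \<subseteq> tris D"
  using tris_shiftk unfolding orb3_def by auto

lemma finite_tris: "finite {p\<in>tris D. 0 \<le> fst p \<and> fst p < n}"
proof (rule finite_subset)
  show "{p\<in>tris D. 0 \<le> fst p \<and> fst p < n} \<subseteq> {0..n} \<times> {0..3*n} \<times> {0..3*n}"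
  proof
    fix x assume x: "x \<in> {p\<in>tris D. 0 \<le> fst p \<and> fst p < n}"
    obtain p q r where pqr: "x = (p, q, r)" by (metis prod_cases3)
    have "p < q \<and> q \<le> p + n" "p < r \<and> r \<le> p + n"
      using x arc[of p q] arc[of p r] unfolding pqr tris_def by simp_all
    then show "x \<in> {0..n} \<times> {0..3*n} \<times> {0..3*n}" using x unfolding pqr by simp
  qed
qed simp

text \<open>Any apex other than \<open>b\<close> or \<open>d\<close> would give a side of the
  triangle that crosses a side of the quadrilateral.\<close>

lemma tri_of_arc:
  assumes "(a, b) \<in> D" "(b, c) \<in> D" "(c, d) \<in> D" "(a, d) \<in> D" "(p, q, r) \<in> tris D"
    and "(p, q) = (a, c) \<or> (q, r) = (a, c) \<or> (p, r) = (a, c)"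
  shows "(p, q, r) \<in> {(a, b, c), (a, c, d)}"
proof -
  have o: "a < b" "b < c" "c < d" using assms(1-3) arc by blast+
  have t: "(p, q) \<in> D" "(q, r) \<in> D" "(p, r) \<in> D" using assms(5) by (auto simp: tris_def)
  have o': "p < q" "q < r" using t arc by blast+
  consider "p = a" "q = c" | "q = a" "r = c" | "p = a" "r = c" using assms(6) by auto
  then show ?thesis
  proof cases
    case 1
    have "\<not> r < d" "\<not> d < r"
      using noncross[OF t(3) assms(3)] noncross[OF assms(4) t(2)] o o' 1 by auto
    then show ?thesis using 1 by simp
  next
    case 2
    then show ?thesis using noncross[OF t(3) assms(4)] o o' by simp
  next
    case 3
    have "\<not> q < b" "\<not> b < q"
      using noncross[OF assms(1) t(2)] noncross[OF t(1) assms(2)] o o' 3 by auto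
    then show ?thesis using 3 by simp
  qed
qed

lemma tri_of_arc':
  assumes "(a, b) \<in> D" "(b, c) \<in> D" "(c, d) \<in> D" "(a, d) \<in> D" "(p, q, r) \<in> tris D"
    and "(p, q) = (b, d) \<or> (q, r) = (b, d) \<or> (p, r) = (b, d)"
  shows "(p, q, r) \<in> {(a, b, d), (b, c, d)}"
proof -
  have o: "a < b" "b < c" "c < d" using assms(1-3) arc by blast+
  have t: "(p, q) \<in> D" "(q, r) \<in> D" "(p, r) \<in> D" using assms(5) by (auto simp: tris_def)
  have o': "p < q" "q < r" using t arc by blast+
  consider "p = b" "q = d" | "q = b" "r = d" | "p = b" "r = d" using assms(6) by auto
  then show ?thesis
  proof cases
    case 1
    then show ?thesis using noncross[OF assms(4) t(3)] o o' by simp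
  next
    case 2
    have "\<not> p < a" "\<not> a < p"
      using noncross[OF t(1) assms(4)] noncross[OF assms(1) t(3)] o o' 2 by auto
    then show ?thesis using 2 by simp
  next
    case 3
    have "\<not> q < c" "\<not> c < q"
      using noncross[OF assms(2) t(2)] noncross[OF t(1) assms(3)] o o' 3 by auto
    then show ?thesis using 3 by simp
  qed
qed

text \<open>A diameter has a triangle on either side, but the two are translates of each other by
  \<open>n\<close>; only one of them has this very lift of the diameter as a side.\<close>

lemma tri_of_diameter:
  assumes "(a, b) \<in> D" "(b, a + n) \<in> D" "(p, q, r) \<in> tris D"
    and "(p, q) = (a, a + n) \<or> (q, r) = (a, a + n) \<or> (p, r) = (a, a + n)"
  shows "(p, q, r) = (a, b, a + n)"
proof -
  have o: "a < b" "b < a + n" using assms(1,2) arc by blast+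
  have t: "(p, q) \<in> D" "(q, r) \<in> D" "(p, r) \<in> D" using assms(3) by (auto simp: tris_def)
  have o': "p < q" "q < r" "r \<le> p + n" using t arc by blast+
  then have e: "p = a" "r = a + n" using assms(4) by auto
  have "\<not> q < b" "\<not> b < q"
    using noncross[OF assms(1) t(2)] noncross[OF t(1) assms(2)] o o' e by auto
  then show ?thesis using e by simp
qed

end

lemma orb2_iff: "(u, v) \<in> orb2 n (a, c) \<longleftrightarrow> (\<exists>k. u = a + k * n \<and> v = c + k * n)"
  unfolding orb2_def by auto

lemma orb3_iff: "(p, q, r) \<in> orb3 n (a, b, c) \<longleftrightarrow> (\<exists>k. p = a + k * n \<and> q = b + k * n \<and> r = c + k * n)"
  unfolding orb3_def by auto

lemma (in arc_system) tris_with_orb2: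
  assumes "\<And>p q r. (p, q, r) \<in> tris D \<Longrightarrow> (p, q) = (a, c) \<or> (q, r) = (a, c) \<or> (p, r) = (a, c) \<Longrightarrow> (p, q, r) \<in> X"
    and "(p, q, r) \<in> tris D" "(p, q) \<in> orb2 n (a, c) \<or> (q, r) \<in> orb2 n (a, c) \<or> (p, r) \<in> orb2 n (a, c)"
  shows "\<exists>x\<in>X. (p, q, r) \<in> orb3 n x"
proof -
  obtain k where k: "(p, q) = (a + k * n, c + k * n) \<or> (q, r) = (a + k * n, c + k * n) \<or> (p, r) = (a + k * n, c + k * n)"
    using assms(3) unfolding orb2_iff by auto
  have "(p - k * n, q - k * n, r - k * n) \<in> tris D"
    using tris_shiftk[of "p - k * n" k "q - k * n" "r - k * n"] assms(2) by simp
  then have "(p - k * n, q - k * n, r - k * n) \<in> X" using assms(1) k by auto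
  moreover have "(p, q, r) \<in> orb3 n (p - k * n, q - k * n, r - k * n)" unfolding orb3_iff by (rule exI[of _ k]) simp
  ultimately show ?thesis by blast
qed

section \<open>The change of the sum under a flip\<close>

text \<open>The triangles common to both systems cancel. Every other triangle has a translate of a
  flipped diagonal as a side, so by \<open>tri_of_arc\<close> and \<open>tri_of_arc'\<close> two
  disjoint orbits are replaced by two others.\<close>

lemma fsum_flip:
  assumes "arc_system n D" "arc_system n D'" and g: "invariant n g"
    and o: "a < b" "b < c" "c < d" "d \<le> a + n"
    and sides: "(a, b) \<in> D" "(b, c) \<in> D" "(c, d) \<in> D" "(a, d) \<in> D"
    and D': "D' = D - orb2 n (a, c) \<union> orb2 n (b, d)"
    and ac: "(a, c) \<in> D"
  shows "fsum n g (tris D') - fsum n g (tris D) = g (a, b, d) + g (b, c, d) - g (a, b, c) - g (a, c, d)"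
proof -
  interpret D: arc_system n D by fact
  interpret D': arc_system n D' by fact
  have n: "n > 0" by (rule D.n_pos)
  have no: "(u, v) \<notin> orb2 n (a, c)" if "v - u \<noteq> c - a" for u v using that unfolding orb2_iff by auto
  have small: "k = 0" if "0 \<le> k * n" "k * n < n" for k :: int
    using that n by (metis div_pos_pos_trivial mult.commute nonzero_mult_div_cancel_left less_irrefl)
  have nac: "(a, b) \<notin> orb2 n (a, c)" "(b, c) \<notin> orb2 n (a, c)" "(a, d) \<notin> orb2 n (a, c)"
    using o by (intro no; linarith)+
  \<comment> \<open>This side may be as long as \<open>(a, c)\<close>, so comparing lengths is not
    enough: as a translate it would make \<open>c - a\<close> a multiple of \<open>n\<close>, but
    \<open>0 < c - a < n\<close>.\<close>
  have ncd: "(c, d) \<notin> orb2 n (a, c)"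
  proof
    assume "(c, d) \<in> orb2 n (a, c)"
    then obtain k where k: "c = a + k * n" "d = c + k * n" unfolding orb2_iff by blast
    then have "0 \<le> k * n" "k * n < n" using o by linarith+
    with small[OF this] k o show False by simp
  qed
  have sides': "(a, b) \<in> D'" "(b, c) \<in> D'" "(c, d) \<in> D'" "(a, d) \<in> D'" "(b, d) \<in> D'"
  proof -
    have "(u, v) \<in> D'" if "(u, v) \<in> D" "(u, v) \<notin> orb2 n (a, c)" for u v using that D' by blast
    then show "(a, b) \<in> D'" "(b, c) \<in> D'" "(c, d) \<in> D'" "(a, d) \<in> D'" using sides nac ncd by blast+
    have "(b, d) \<in> orb2 n (b, d)" unfolding orb2_iff by (rule exI[of _ 0]) simp
    then show "(b, d) \<in> D'" using D' by blast
  qed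
  let ?R = "tris D \<inter> tris D'"
  let ?o = "orb3 n"
  have in1: "?o (a, b, c) \<subseteq> tris D" "?o (a, c, d) \<subseteq> tris D" "?o (a, b, d) \<subseteq> tris D'" "?o (b, c, d) \<subseteq> tris D'"
    using sides sides' ac by (intro D.orb3_subset D'.orb3_subset; simp add: tris_def)+
  have bdD: "(b, d) \<notin> D" using D.noncross[OF ac, of b d] o by auto
  have acD': "(a, c) \<notin> D'" using D'.noncross[OF _ sides'(5), of a c] o by auto
  have bdD: "(u, v) \<notin> D" if "(u, v) \<in> orb2 n (b, d)" for u v using that bdD D.shiftk by (auto simp: orb2_iff)
  have acD': "(u, v) \<notin> D'" if "(u, v) \<in> orb2 n (a, c)" for u v using that acD' D'.shiftk by (auto simp: orb2_iff)
  have d1: "tris D = ?R \<union> (?o (a, b, c) \<union> ?o (a, c, d))"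
  proof (intro equalityI subsetI)
    fix x assume x: "x \<in> tris D"
    obtain p q r where pqr: "x = (p, q, r)" by (metis prod_cases3)
    show "x \<in> ?R \<union> (?o (a, b, c) \<union> ?o (a, c, d))"
    proof (cases "x \<in> tris D'")
      case False
      then have "(p, q) \<in> orb2 n (a, c) \<or> (q, r) \<in> orb2 n (a, c) \<or> (p, r) \<in> orb2 n (a, c)"
        using x unfolding pqr tris_def mem_Collect_eq prod.case D' by blast
      from D.tris_with_orb2[OF D.tri_of_arc[OF sides] _ this] x show ?thesis unfolding pqr by blast
    qed (use x in blast)
  qed (use in1 in blast)
  have d2: "tris D' = ?R \<union> (?o (a, b, d) \<union> ?o (b, c, d))"
  proof (intro equalityI subsetI)
    fix x assume x: "x \<in> tris D'"
    obtain p q r where pqr: "x = (p, q, r)" by (metis prod_cases3)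
    show "x \<in> ?R \<union> (?o (a, b, d) \<union> ?o (b, c, d))"
    proof (cases "x \<in> tris D")
      case False
      then have "(p, q) \<in> orb2 n (b, d) \<or> (q, r) \<in> orb2 n (b, d) \<or> (p, r) \<in> orb2 n (b, d)"
        using x unfolding pqr tris_def mem_Collect_eq prod.case D' by blast
      from D'.tris_with_orb2[OF D'.tri_of_arc'[OF sides'(1-4)] _ this] x show ?thesis unfolding pqr by blast
    qed (use x in blast)
  qed (use in1 in blast)
  have j1: "?R \<inter> (?o (a, b, c) \<union> ?o (a, c, d)) = {}"
  proof -
    have False if "(p, q, r) \<in> tris D'" "(p, q, r) \<in> ?o (a, b, c) \<or> (p, q, r) \<in> ?o (a, c, d)" for p q r
    proof -
      have "(p, r) \<in> orb2 n (a, c) \<or> (p, q) \<in> orb2 n (a, c)" using that(2) unfolding orb3_iff orb2_iff by blast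
      then show False using acD' that(1) unfolding tris_def by blast
    qed
    then show ?thesis by - (rule disjoint3, blast)
  qed
  have j2: "?R \<inter> (?o (a, b, d) \<union> ?o (b, c, d)) = {}"
  proof -
    have False if "(p, q, r) \<in> tris D" "(p, q, r) \<in> ?o (a, b, d) \<or> (p, q, r) \<in> ?o (b, c, d)" for p q r
    proof -
      have "(q, r) \<in> orb2 n (b, d) \<or> (p, r) \<in> orb2 n (b, d)" using that(2) unfolding orb3_iff orb2_iff by blast
      then show False using bdD that(1) unfolding tris_def by blast
    qed
    then show ?thesis by - (rule disjoint3, blast)
  qed
  have j3: "?o (a, b, c) \<inter> ?o (a, c, d) = {}"
  proof -
    have False if "(p, q, r) \<in> ?o (a, b, c)" "(p, q, r) \<in> ?o (a, c, d)" for p q r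
      using that o unfolding orb3_iff by (elim exE conjE) linarith
    then show ?thesis by - (rule disjoint3, blast)
  qed
  have j4: "?o (a, b, d) \<inter> ?o (b, c, d) = {}"
  proof -
    have False if "(p, q, r) \<in> ?o (a, b, d)" "(p, q, r) \<in> ?o (b, c, d)" for p q r
      using that o unfolding orb3_iff by (elim exE conjE) linarith
    then show ?thesis by - (rule disjoint3, blast)
  qed
  have fin: "finite {p\<in>S. 0 \<le> fst p \<and> fst p < n}" if "S \<subseteq> tris D \<or> S \<subseteq> tris D'" for S
  proof -
    have "{p\<in>S. 0 \<le> fst p \<and> fst p < n} \<subseteq> {p\<in>tris D. 0 \<le> fst p \<and> fst p < n}
        \<or> {p\<in>S. 0 \<le> fst p \<and> fst p < n} \<subseteq> {p\<in>tris D'. 0 \<le> fst p \<and> fst p < n}"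
      using that by blast
    then show ?thesis using D.finite_tris D'.finite_tris finite_subset by blast
  qed
  have split: "fsum n g (R \<union> (X \<union> Y)) = fsum n g R + (fsum n g X + fsum n g Y)"
    if "R \<union> (X \<union> Y) \<subseteq> tris D \<or> R \<union> (X \<union> Y) \<subseteq> tris D'" "R \<inter> (X \<union> Y) = {}" "X \<inter> Y = {}" for R X Y
  proof -
    have "R \<subseteq> tris D \<or> R \<subseteq> tris D'" "X \<subseteq> tris D \<or> X \<subseteq> tris D'"
      "Y \<subseteq> tris D \<or> Y \<subseteq> tris D'" "X \<union> Y \<subseteq> tris D \<or> X \<union> Y \<subseteq> tris D'" using that(1) by blast+
    then show ?thesis using fsum_Un[OF fin fin that(2), of g] fsum_Un[OF fin fin that(3), of g] by simp
  qed
  have "fsum n g (tris D) = fsum n g ?R + (fsum n g (?o (a, b, c)) + fsum n g (?o (a, c, d)))"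
    using split[OF _ j1 j3, unfolded d1[symmetric]] by simp
  moreover have "fsum n g (tris D') = fsum n g ?R + (fsum n g (?o (a, b, d)) + fsum n g (?o (b, c, d)))"
    using split[OF _ j2 j4, unfolded d2[symmetric]] by simp
  ultimately show ?thesis by (simp add: fsum_orb3[OF n g])
qed


text \<open>The triangles on both sides of a diameter form one orbit, so a single value replaces a
  single value; this is why diameters have an inequality of their own.\<close>

lemma fsum_flip_diameter:
  assumes "arc_system n D" "arc_system n D'" and g: "invariant n g"
    and sides: "(a, b) \<in> D" "(b, a + n) \<in> D" "(a, a + n) \<in> D"
    and sides': "(b, a + n) \<in> D'" "(a + n, b + n) \<in> D'" "(b, b + n) \<in> D'"
    and D': "D' = D - orb2 n (a, a + n) \<union> orb2 n (b, b + n)"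
  shows "fsum n g (tris D') - fsum n g (tris D) = g (b, a + n, b + n) - g (a, b, a + n)"
proof -
  interpret D: arc_system n D by fact
  interpret D': arc_system n D' by fact
  have n: "n > 0" by (rule D.n_pos)
  have o: "a < b" "b < a + n" using sides D.arc by blast+
  let ?R = "tris D \<inter> tris D'"
  let ?o = "orb3 n"
  have in1: "?o (a, b, a + n) \<subseteq> tris D" "?o (b, a + n, b + n) \<subseteq> tris D'"
    using sides sides' by (intro D.orb3_subset D'.orb3_subset; simp add: tris_def)+
  have bdD: "(b, b + n) \<notin> D" using D.noncross[OF sides(3), of b "b + n"] o by auto
  have acD': "(a, a + n) \<notin> D'" using D'.noncross[OF _ sides'(3), of a "a + n"] o by auto
  have bdD: "(u, v) \<notin> D" if "(u, v) \<in> orb2 n (b, b + n)" for u v using that bdD D.shiftk by (auto simp: orb2_iff)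
  have acD': "(u, v) \<notin> D'" if "(u, v) \<in> orb2 n (a, a + n)" for u v using that acD' D'.shiftk by (auto simp: orb2_iff)
  have d1: "tris D = ?R \<union> ?o (a, b, a + n)"
  proof (intro equalityI subsetI)
    fix x assume x: "x \<in> tris D"
    obtain p q r where pqr: "x = (p, q, r)" by (metis prod_cases3)
    show "x \<in> ?R \<union> ?o (a, b, a + n)"
    proof (cases "x \<in> tris D'")
      case False
      then have "(p, q) \<in> orb2 n (a, a + n) \<or> (q, r) \<in> orb2 n (a, a + n) \<or> (p, r) \<in> orb2 n (a, a + n)"
        using x unfolding pqr tris_def mem_Collect_eq prod.case D' by blast
      from D.tris_with_orb2[of a "a + n" "{(a, b, a + n)}", OF _ _ this] D.tri_of_diameter[OF sides(1,2)] x
      show ?thesis unfolding pqr by blast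
    qed (use x in blast)
  qed (use in1 in blast)
  have d2: "tris D' = ?R \<union> ?o (b, a + n, b + n)"
  proof (intro equalityI subsetI)
    fix x assume x: "x \<in> tris D'"
    obtain p q r where pqr: "x = (p, q, r)" by (metis prod_cases3)
    show "x \<in> ?R \<union> ?o (b, a + n, b + n)"
    proof (cases "x \<in> tris D")
      case False
      then have "(p, q) \<in> orb2 n (b, b + n) \<or> (q, r) \<in> orb2 n (b, b + n) \<or> (p, r) \<in> orb2 n (b, b + n)"
        using x unfolding pqr tris_def mem_Collect_eq prod.case D' by blast
      from D'.tris_with_orb2[of b "b + n" "{(b, a + n, b + n)}", OF _ _ this] D'.tri_of_diameter[OF sides'(1,2)] x
      show ?thesis unfolding pqr by blast
    qed (use x in blast)
  qed (use in1 in blast)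
  have j1: "?R \<inter> ?o (a, b, a + n) = {}"
  proof -
    have False if "(p, q, r) \<in> tris D'" "(p, q, r) \<in> ?o (a, b, a + n)" for p q r
    proof -
      have "(p, r) \<in> orb2 n (a, a + n)" using that(2) unfolding orb3_iff orb2_iff by blast
      then show False using acD' that(1) unfolding tris_def by blast
    qed
    then show ?thesis by - (rule disjoint3, blast)
  qed
  have j2: "?R \<inter> ?o (b, a + n, b + n) = {}"
  proof -
    have False if "(p, q, r) \<in> tris D" "(p, q, r) \<in> ?o (b, a + n, b + n)" for p q r
    proof -
      have "(p, r) \<in> orb2 n (b, b + n)" using that(2) unfolding orb3_iff orb2_iff by blast
      then show False using bdD that(1) unfolding tris_def by blast
    qed
    then show ?thesis by - (rule disjoint3, blast)
  qed
  have fin: "finite {p\<in>S. 0 \<le> fst p \<and> fst p < n}" if "S \<subseteq> tris D \<or> S \<subseteq> tris D'" for S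
  proof -
    have "{p\<in>S. 0 \<le> fst p \<and> fst p < n} \<subseteq> {p\<in>tris D. 0 \<le> fst p \<and> fst p < n}
        \<or> {p\<in>S. 0 \<le> fst p \<and> fst p < n} \<subseteq> {p\<in>tris D'. 0 \<le> fst p \<and> fst p < n}"
      using that by blast
    then show ?thesis using D.finite_tris D'.finite_tris finite_subset by blast
  qed
  have split: "fsum n g (R \<union> X) = fsum n g R + fsum n g X"
    if "R \<union> X \<subseteq> tris D \<or> R \<union> X \<subseteq> tris D'" "R \<inter> X = {}" for R X
  proof -
    have "R \<subseteq> tris D \<or> R \<subseteq> tris D'" "X \<subseteq> tris D \<or> X \<subseteq> tris D'" using that(1) by blast+
    then show ?thesis using fsum_Un[OF fin fin that(2), of g] by simp
  qed
  have "fsum n g (tris D) = fsum n g ?R + fsum n g (?o (a, b, a + n))"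
    using split[OF _ j1, unfolded d1[symmetric]] by simp
  moreover have "fsum n g (tris D') = fsum n g ?R + fsum n g (?o (b, a + n, b + n))"
    using split[OF _ j2, unfolded d2[symmetric]] by simp
  ultimately show ?thesis by (simp add: fsum_orb3[OF n g])
qed


section \<open>Lifting triangulations and flips to the integers\<close>

definition pm :: "nat \<Rightarrow> int \<Rightarrow> nat" where
  "pm d z = nat (z mod (2 * int d + 2))"

definition arcs_of :: "nat \<Rightarrow> nat set set \<Rightarrow> (int \<times> int) set" where
  "arcs_of d T = {(u, v). u < v \<and> v \<le> u + (int d + 1) \<and> {pm d u, pm d v} \<in> T}"

lemma int_pm: "int (pm d z) = z mod (2 * int d + 2)"
  unfolding pm_def by simp

lemma pm_less: "pm d z < 2 * d + 2"
proof -
  have "int (pm d z) < 2 * int d + 2" unfolding int_pm by (rule pos_mod_bound) simp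
  then show ?thesis by linarith
qed

lemma pm_eq_iff: "pm d z = pm d w \<longleftrightarrow> (\<exists>k. z = w + 2 * (int d + 1) * k)"
proof -
  have "pm d z = pm d w \<longleftrightarrow> z mod (2 * int d + 2) = w mod (2 * int d + 2)"
    unfolding int_pm[symmetric] by simp
  also have "\<dots> \<longleftrightarrow> (\<exists>k. z = w + 2 * (int d + 1) * k)"
    unfolding mod_eq_dvd_iff dvd_def by (auto simp: algebra_simps)
  finally show ?thesis .
qed

lemma pm_of_nat: "x < 2 * d + 2 \<Longrightarrow> pm d (int x) = x"
  unfolding pm_def by simp

lemma opposite_pm: "opposite d (pm d z) = pm d (z + (int d + 1))"
proof -
  have "int (opposite d (pm d z)) = (int (pm d z) + (int d + 1)) mod (2 * int d + 2)"
    unfolding opposite_def by (simp add: zmod_int add_ac)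
  also have "\<dots> = (z + (int d + 1)) mod (2 * int d + 2)" unfolding int_pm by (simp add: mod_add_left_eq)
  finally show ?thesis unfolding int_pm[symmetric] by simp
qed

lemma pm_add_period: "pm d (z + 2 * (int d + 1)) = pm d z"
  unfolding pm_eq_iff by (rule exI[of _ 1]) simp

lemma crossingI: "a < b \<Longrightarrow> b < c \<Longrightarrow> c < e \<Longrightarrow> crossing {a, c} {b, e} \<and> crossing {b, e} {a, c}"
proof -
  assume "a < b" "b < c" "c < e"
  then have "crossing {a, c} {b, e}" unfolding crossing_def by blast
  then show ?thesis using crossing_commute by blast
qed

text \<open>The four integers are in cyclic order within one turn, but \<open>crossing\<close>
  compares representatives in \<open>[0, 2 * n)\<close> linearly. Reduction rotates the quadruple,
  and the two pairs of alternate vertices survive every rotation.\<close>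

lemma crossing_pm:
  assumes "a < b" "b < c" "c < e" "e < a + 2 * (int d + 1)"
  shows "crossing {pm d a, pm d c} {pm d b, pm d e}"
proof -
  let ?N = "2 * int d + 2"
  \<comment> \<open>The largest multiple of \<open>2 * n\<close> not above \<open>a\<close>: some
    initial part of the quadruple stays below the next multiple, and the rest wraps around to the
    front.\<close>
  define q where "q = ?N * (a div ?N)"
  have a: "a - q = a mod ?N" unfolding q_def by (simp add: minus_mult_div_eq_mod)
  have a0: "0 \<le> a - q" "a - q < ?N" unfolding a by simp_all
  have low: "int (pm d z) = z - q" if "a \<le> z" "z - q < ?N" for z
  proof -
    have "z mod ?N = (z - q) mod ?N" unfolding q_def by (simp add: mod_diff_right_eq[symmetric])
    then show ?thesis unfolding int_pm using that a0 by simp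
  qed
  have high: "int (pm d z) = z - q - ?N" if "z < a + ?N" "?N \<le> z - q" for z
  proof -
    have "z mod ?N = (z - q) mod ?N" unfolding q_def by (simp add: mod_diff_right_eq[symmetric])
    also have "\<dots> = (z - q - ?N) mod ?N" by (rule minus_mod_self2[symmetric])
    also have "\<dots> = z - q - ?N" by (rule mod_pos_pos_trivial) (use that a0 in linarith)+
    finally show ?thesis unfolding int_pm .
  qed
  have e: "e < a + ?N" using assms(4) by simp
  let ?a = "pm d a" and ?b = "pm d b" and ?c = "pm d c" and ?e = "pm d e"
  consider "e - q < ?N" | "c - q < ?N" "?N \<le> e - q" | "b - q < ?N" "?N \<le> c - q" | "?N \<le> b - q" by linarith
  then show ?thesis
  proof cases
    case 1
    have "?a < ?b" "?b < ?c" "?c < ?e" using low[of a] low[of b] low[of c] low[of e] assms 1 a0 by linarith+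
    then show ?thesis using crossingI by blast
  next
    case 2
    have "?e < ?a" "?a < ?b" "?b < ?c" using low[of a] low[of b] low[of c] high[of e] assms 2 a0 e by linarith+
    from crossingI[OF this] show ?thesis by (simp add: insert_commute)
  next
    case 3
    have "?c < ?e" "?e < ?a" "?a < ?b" using low[of a] low[of b] high[of c] high[of e] assms 3 a0 e by linarith+
    from crossingI[OF this] show ?thesis by (simp add: insert_commute)
  next
    case 4
    have "?b < ?c" "?c < ?e" "?e < ?a" using low[of a] high[of b] high[of c] high[of e] assms 4 a0 e by linarith+
    from crossingI[OF this] show ?thesis by (simp add: insert_commute)
  qed
qed

lemma arcs_arcs_of:
  assumes T: "T \<in> symmetric_triangulations d"
  shows "arc_system (int d + 1) (arcs_of d T)"
proof
  have nc: "noncrossing T" and sym: "centrally_symmetric d T"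
    using T unfolding symmetric_triangulations_def triangulation_def by auto
  show "int d + 1 > 0" by simp
  fix u v u' v'
  show "(u, v) \<in> arcs_of d T \<Longrightarrow> u < v \<and> v \<le> u + (int d + 1)" unfolding arcs_of_def by simp
  have s: "{pm d (x + (int d + 1)), pm d (y + (int d + 1))} \<in> T" if "{pm d x, pm d y} \<in> T" for x y
    using sym that unfolding centrally_symmetric_def opposite_pm[symmetric] by blast
  have "{pm d (u + (int d + 1)), pm d (v + (int d + 1))} \<in> T \<longleftrightarrow> {pm d u, pm d v} \<in> T"
  proof
    assume "{pm d (u + (int d + 1)), pm d (v + (int d + 1))} \<in> T"
    from s[OF this] show "{pm d u, pm d v} \<in> T"
      using pm_add_period[of d u] pm_add_period[of d v] by (simp add: add.assoc)
  qed (rule s)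
  then show "(u + (int d + 1), v + (int d + 1)) \<in> arcs_of d T \<longleftrightarrow> (u, v) \<in> arcs_of d T"
    unfolding arcs_of_def by auto
  assume "(u, v) \<in> arcs_of d T" "(u', v') \<in> arcs_of d T" "u < u'" "u' < v" "v < v'"
  then show False
    using crossing_pm[of u u' v v' d] nc unfolding arcs_of_def noncrossing_def by auto
qed

lemma sum_extreme: "x \<le> N \<Longrightarrow> y \<le> N \<Longrightarrow> x + y = 2 * N \<Longrightarrow> x = N \<and> y = (N::int)"
  by linarith

text \<open>Edges are unordered, so \<open>u, v\<close> may match \<open>a, c\<close> in either
  order. In the reversed order the two lengths add up to a multiple of \<open>2 * n\<close>, which
  forces both to be \<open>n\<close>; then the edge is a diameter and its reversal is again a
  translate. Even translates give the edge itself, odd ones its opposite.\<close>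

lemma edge_in_orb2:
  assumes uv: "u < v" "v \<le> u + (int d + 1)" and ac: "a < c" "c \<le> a + (int d + 1)"
  shows "{pm d u, pm d v} \<in> {{pm d a, pm d c}, {pm d (a + (int d + 1)), pm d (c + (int d + 1))}}
    \<longleftrightarrow> (u, v) \<in> orb2 (int d + 1) (a, c)" (is "?L \<longleftrightarrow> ?R")
proof
  let ?n = "int d + 1"
  have small: "j = i" if "\<bar>2 * ?n * j - 2 * ?n * i\<bar> < 2 * ?n" for i j :: int
  proof (rule ccontr)
    assume "j \<noteq> i"
    then have "1 \<le> \<bar>j - i\<bar>" by simp
    then have "2 * ?n * 1 \<le> 2 * ?n * \<bar>j - i\<bar>" by (intro mult_left_mono) auto
    then show False using that by (simp add: abs_mult right_diff_distrib[symmetric])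
  qed
  have key: "(u, v) \<in> orb2 ?n (a, c)" if "{pm d u, pm d v} = {pm d (a + e * ?n), pm d (c + e * ?n)}" for e
  proof -
    from that consider "pm d u = pm d (a + e * ?n)" "pm d v = pm d (c + e * ?n)"
      | "pm d u = pm d (c + e * ?n)" "pm d v = pm d (a + e * ?n)" unfolding doubleton_eq_iff by blast
    then show ?thesis
    proof cases
      case 1
      then obtain i j where ij: "u = a + e * ?n + 2 * ?n * i" "v = c + e * ?n + 2 * ?n * j" unfolding pm_eq_iff by blast
      have 1: "2 * ?n * j - 2 * ?n * i = (v - u) - (c - a)" using ij by linarith
      have "v - u - (c - a) < 2 * ?n" "- (v - u - (c - a)) < 2 * ?n" using uv ac by simp_all
      then have "j = i" by (intro small, unfold 1 abs_less_iff) simp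
      then show ?thesis unfolding orb2_iff using ij by (intro exI[of _ "e + 2 * i"]) (simp add: algebra_simps)
    next
      case 2
      then obtain i j where ij: "u = c + e * ?n + 2 * ?n * i" "v = a + e * ?n + 2 * ?n * j" unfolding pm_eq_iff by blast
      have 1: "2 * ?n * j - 2 * ?n * i = (v - u) + (c - a)" using ij by linarith
      have "j - 1 = i"
      proof (rule small)
        have "2 * ?n * (j - 1) - 2 * ?n * i = (v - u) + (c - a) - 2 * ?n" using 1 by (simp add: algebra_simps)
        moreover have "(v - u) + (c - a) - 2 * ?n < 2 * ?n" "- ((v - u) + (c - a) - 2 * ?n) < 2 * ?n" using uv ac by simp_all
        ultimately show "\<bar>2 * ?n * (j - 1) - 2 * ?n * i\<bar> < 2 * ?n" unfolding abs_less_iff by simp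
      qed
      then have j: "j = i + 1" by simp
      have "(v - u) + (c - a) = 2 * ?n" using 1 unfolding j by (simp add: algebra_simps)
      moreover have "v - u \<le> ?n" "c - a \<le> ?n" using uv ac by simp_all
      ultimately have "v - u = ?n \<and> c - a = ?n" using sum_extreme by blast
      then have "v = u + ?n" "c = a + ?n" by simp_all
      then show ?thesis unfolding orb2_iff using ij by (intro exI[of _ "e + 1 + 2 * i"]) (simp add: algebra_simps)
    qed
  qed
  show ?R if ?L using that key[of 0] key[of 1] by auto
  show ?L if R: ?R
  proof -
    obtain k where k: "u = a + k * ?n" "v = c + k * ?n" using R unfolding orb2_iff by blast
    show ?L
    proof (cases "even k")
      case True
      then obtain i where "k = 2 * i" by blast
      then have "pm d u = pm d a" "pm d v = pm d c" unfolding pm_eq_iff k by (auto intro!: exI[of _ i])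
      then show ?thesis by simp
    next
      case False
      then obtain i where "k = 2 * i + 1" using oddE by blast
      then have "pm d u = pm d (a + ?n)" "pm d v = pm d (c + ?n)" unfolding pm_eq_iff k
        by (auto intro!: exI[of _ i] simp: algebra_simps)
      then show ?thesis by simp
    qed
  qed
qed

lemma arcs_of_flip:
  assumes "T' = T - {{pm d a, pm d c}, {pm d (a + (int d + 1)), pm d (c + (int d + 1))}}
      \<union> {{pm d b, pm d e}, {pm d (b + (int d + 1)), pm d (e + (int d + 1))}}"
    and "a < c" "c \<le> a + (int d + 1)" "b < e" "e \<le> b + (int d + 1)"
  shows "arcs_of d T' = arcs_of d T - orb2 (int d + 1) (a, c) \<union> orb2 (int d + 1) (b, e)"
proof (intro set_eqI)
  fix p :: "int \<times> int"
  obtain u v where p: "p = (u, v)" by fastforce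
  show "p \<in> arcs_of d T' \<longleftrightarrow> p \<in> arcs_of d T - orb2 (int d + 1) (a, c) \<union> orb2 (int d + 1) (b, e)"
  proof (cases "u < v \<and> v \<le> u + (int d + 1)")
    case True
    then have uv: "u < v" "v \<le> u + (int d + 1)" by simp_all
    have "{pm d u, pm d v} \<in> T' \<longleftrightarrow> {pm d u, pm d v} \<in> T \<and> (u, v) \<notin> orb2 (int d + 1) (a, c) \<or> (u, v) \<in> orb2 (int d + 1) (b, e)"
      unfolding assms(1) Un_iff Diff_iff edge_in_orb2[OF uv assms(2,3)] edge_in_orb2[OF uv assms(4,5)] by (rule refl)
    then show ?thesis using uv unfolding p arcs_of_def by simp
  next
    case False
    moreover have "(u, v) \<notin> orb2 (int d + 1) (b, e)" using False assms(4,5) unfolding orb2_iff by auto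
    ultimately show ?thesis unfolding p arcs_of_def by auto
  qed
qed

text \<open>Of the two boundary arcs between the ends of the flipped edge, one has length at most
  \<open>n\<close>; the lift starts at the end that makes it the arc from \<open>a\<close> to
  \<open>c\<close>. Only the position of \<open>e\<close> relative to the centre then remains
  open.\<close>

lemma flip_lift:
  assumes T: "T \<in> symmetric_triangulations d" and fl: "flip d T T'"
  obtains a b c e where "a < b" "b < c" "c < e" "e < a + 2 * (int d + 1)" "c \<le> a + (int d + 1)"
    "{pm d a, pm d c} \<in> T" "{pm d a, pm d b} \<in> T" "{pm d b, pm d c} \<in> T" "{pm d c, pm d e} \<in> T" "{pm d a, pm d e} \<in> T"
    "T' = T - {{pm d a, pm d c}, {pm d (a + (int d + 1)), pm d (c + (int d + 1))}}
      \<union> {{pm d b, pm d e}, {pm d (b + (int d + 1)), pm d (e + (int d + 1))}}"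
proof -
  let ?n = "int d + 1"
  obtain x x' y y' where xx: "{x, x'} \<in> T" and cr: "crossing {x, x'} {y, y'}"
    and q: "{x, y} \<in> T" "{y, x'} \<in> T" "{x', y'} \<in> T" "{y', x} \<in> T"
    and T': "T' = (T - {{x, x'}, {opposite d x, opposite d x'}}) \<union> {{y, y'}, {opposite d y, opposite d y'}}"
    using fl unfolding flip_def by blast
  have sub: "T \<subseteq> polygon_edges (2 * d + 2)"
    using T unfolding symmetric_triangulations_def triangulation_def by auto
  obtain A B C E where o: "A < B" "B < C" "C < E" and eq: "{{x, x'}, {y, y'}} = {{A, C}, {B, E}}"
    using cr unfolding crossing_def by blast
  have lt: "x < 2*d+2" "x' < 2*d+2" "y < 2*d+2" "y' < 2*d+2"
    using q sub polygon_edge_iff by blast+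
  have eq': "{x, x'} = {A, C} \<and> {y, y'} = {B, E} \<or> {x, x'} = {B, E} \<and> {y, y'} = {A, C}"
    using eq unfolding doubleton_eq_iff[of "{x, x'}"] .
  then have ABCE: "A < 2*d+2" "B < 2*d+2" "C < 2*d+2" "E < 2*d+2"
    using lt unfolding doubleton_eq_iff by (elim disjE conjE; simp)+
  have sides: "{A, B} \<in> T" "{B, C} \<in> T" "{C, E} \<in> T" "{A, E} \<in> T"
    using eq' q unfolding doubleton_eq_iff by (elim disjE conjE; simp add: insert_commute)+
  have opp: "{opposite d x, opposite d x'} = opposite d ` {x, x'}" "{opposite d y, opposite d y'} = opposite d ` {y, y'}" by auto
  note pmn = ABCE[THEN pm_of_nat]
  have per: "pm d (z + 2 * ?n) = pm d z" "pm d (z + 2 * ?n + ?n) = pm d (z + ?n)" for z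
    using pm_add_period[of d z] pm_add_period[of d "z + ?n"] by (simp_all add: algebra_simps)
  note fin = that
  have res: thesis if "P < Q" "Q < R" "R < S" "S < P + 2 * ?n" "{pm d P, pm d R} = {x, x'}" "{pm d Q, pm d S} = {y, y'}"
    "{pm d P, pm d Q} \<in> T" "{pm d Q, pm d R} \<in> T" "{pm d R, pm d S} \<in> T" "{pm d P, pm d S} \<in> T" for P Q R S
  proof -
    have T'1: "T' = T - {{pm d P, pm d R}, {pm d (P + ?n), pm d (R + ?n)}} \<union> {{pm d Q, pm d S}, {pm d (Q + ?n), pm d (S + ?n)}}"
      unfolding T' opp that(5,6)[symmetric] opposite_pm[symmetric] by simp
    have PR: "{pm d P, pm d R} \<in> T" using xx that(5) by simp
    show thesis
    proof (cases "R \<le> P + ?n")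
      case True
      show thesis by (rule fin[of P Q R S, OF that(1-4) True PR that(7-10) T'1])
    next
      case False
      \<comment> \<open>The lift starts at \<open>R\<close> instead, with \<open>P\<close> and
        \<open>Q\<close> moved one turn ahead.\<close>
      have "R < S" "S < P + 2 * ?n" "P + 2 * ?n < Q + 2 * ?n" "Q + 2 * ?n < R + 2 * ?n" "P + 2 * ?n \<le> R + ?n"
        using that(1-4) False by simp_all
      moreover have "{pm d R, pm d (P + 2 * ?n)} \<in> T" "{pm d R, pm d S} \<in> T" "{pm d S, pm d (P + 2 * ?n)} \<in> T"
        "{pm d (P + 2 * ?n), pm d (Q + 2 * ?n)} \<in> T" "{pm d R, pm d (Q + 2 * ?n)} \<in> T"
        unfolding per using that(7-10) PR by (simp_all add: insert_commute)
      moreover have "T' = T - {{pm d R, pm d (P + 2 * ?n)}, {pm d (R + ?n), pm d (P + 2 * ?n + ?n)}}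
        \<union> {{pm d S, pm d (Q + 2 * ?n)}, {pm d (S + ?n), pm d (Q + 2 * ?n + ?n)}}"
        unfolding per T'1 by (simp add: insert_commute)
      ultimately show thesis by (rule fin[of R S "P + 2 * ?n" "Q + 2 * ?n"])
    qed
  qed
  from eq' show thesis
  proof
    assume h: "{x, x'} = {A, C} \<and> {y, y'} = {B, E}"
    show thesis
      by (rule res[of "int A" "int B" "int C" "int E"]) (use o h ABCE sides pmn in auto)
  next
    assume h: "{x, x'} = {B, E} \<and> {y, y'} = {A, C}"
    have pA: "pm d (int A + 2 * ?n) = A" using per(1) pmn by simp
    show thesis
      by (rule res[of "int B" "int C" "int E" "int A + 2 * ?n"], unfold pA pmn)
        (use o h ABCE sides in \<open>auto simp: insert_commute\<close>)
  qed
qed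

section \<open>The potential is Lipschitz along flips\<close>

lemma potential_flip:
  assumes T: "T \<in> symmetric_triangulations d" and T': "T' \<in> symmetric_triangulations d" and fl: "flip d T T'"
    and inv: "invariant (int d + 1) g"
    and quad: "\<And>a b c e. a < b \<Longrightarrow> b < c \<Longrightarrow> c < e \<Longrightarrow> e \<le> a + (int d + 1) \<Longrightarrow>
      \<bar>g (a, b, e) + g (b, c, e) - g (a, b, c) - g (a, c, e)\<bar> \<le> K"
    and diam: "\<And>a b. a < b \<Longrightarrow> b < a + (int d + 1) \<Longrightarrow> \<bar>g (b, a + (int d + 1), b + (int d + 1)) - g (a, b, a + (int d + 1))\<bar> \<le> K"
  shows "\<bar>fsum (int d + 1) g (tris (arcs_of d T')) - fsum (int d + 1) g (tris (arcs_of d T))\<bar> \<le> K"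
proof -
  let ?n = "int d + 1"
  let ?D = "arcs_of d T" and ?D' = "arcs_of d T'"
  have D: "arc_system ?n ?D" and D': "arc_system ?n ?D'" using arcs_arcs_of T T' by blast+
  have nc: "noncrossing T" using T unfolding symmetric_triangulations_def triangulation_def by auto
  obtain a b c e where o: "a < b" "b < c" "c < e" "e < a + 2 * ?n" "c \<le> a + ?n"
    and E: "{pm d a, pm d c} \<in> T" "{pm d a, pm d b} \<in> T" "{pm d b, pm d c} \<in> T" "{pm d c, pm d e} \<in> T" "{pm d a, pm d e} \<in> T"
    and T'eq: "T' = T - {{pm d a, pm d c}, {pm d (a + ?n), pm d (c + ?n)}} \<union> {{pm d b, pm d e}, {pm d (b + ?n), pm d (e + ?n)}}"
    by (rule flip_lift[OF T fl])
  have inD: "(u, v) \<in> ?D" if "u < v" "v \<le> u + ?n" "{pm d u, pm d v} \<in> T" for u v using that unfolding arcs_of_def by simp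
  have inD': "(u, v) \<in> ?D'" if "u < v" "v \<le> u + ?n" "{pm d u, pm d v} \<in> T'" for u v using that unfolding arcs_of_def by simp
  have pme: "pm d (e - 2 * ?n) = pm d e" "pm d (e - 2 * ?n + ?n) = pm d (e + ?n)"
    using pm_add_period[of d "e - 2 * ?n"] pm_add_period[of d "e - 2 * ?n + ?n"] by (simp_all add: algebra_simps)
  have opE: "{pm d (u + ?n), pm d (v + ?n)} \<in> T" if "{pm d u, pm d v} \<in> T" for u v
    using T that unfolding symmetric_triangulations_def centrally_symmetric_def opposite_pm[symmetric] by blast
  have keep: "{pm d u, pm d v} \<in> T'" if "{pm d u, pm d v} \<in> T" "u < v" "v \<le> u + ?n" "(u, v) \<notin> orb2 ?n (a, c)" for u v
    using edge_in_orb2[OF that(2,3), of a c] that o unfolding T'eq by auto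
  \<comment> \<open>The position of the centre: on the flipped edge; on or beyond the side
    \<open>{a, e}\<close>; on or beyond the side \<open>{c, e}\<close>; inside the triangle
    \<open>a, c, e\<close>.\<close>
  consider "c = a + ?n" | "c < a + ?n" "e \<le> a + ?n" | "c < a + ?n" "c + ?n \<le> e" | "c < a + ?n" "a + ?n < e" "e < c + ?n"
    using o by linarith
  then show ?thesis
  proof cases
    case 1
    \<comment> \<open>Otherwise a side of the quadrilateral crosses the opposite of another side;
      which pair it is depends on the side of \<open>b + n\<close> on which \<open>e\<close>
      lies.\<close>
    have "e = b + ?n"
    proof (rule ccontr)
      assume ne: "e \<noteq> b + ?n"
      have bc: "{pm d (a + ?n), pm d (b + ?n)} \<in> T" "{pm d (b + ?n), pm d (c + ?n)} \<in> T" using opE E by blast+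
      show False
      proof (cases "e < b + ?n")
        case True
        have "crossing {pm d (a + ?n), pm d (b + ?n)} {pm d e, pm d (a + 2 * ?n)}"
          by (rule crossing_pm) (use o 1 True in simp_all)
        moreover have "{pm d e, pm d (a + 2 * ?n)} \<in> T"
          unfolding pm_add_period using E(5) by (simp add: insert_commute)
        ultimately show False using nc bc(1) unfolding noncrossing_def by blast
      next
        case False
        have "crossing {pm d c, pm d e} {pm d (b + ?n), pm d (c + ?n)}"
          by (rule crossing_pm) (use o 1 ne False in simp_all)
        then show False using nc E(4) bc(2) unfolding noncrossing_def by blast
      qed
    qed
    have T'2: "?D' = ?D - orb2 ?n (a, a + ?n) \<union> orb2 ?n (b, b + ?n)"
      using arcs_of_flip[OF T'eq] o unfolding 1 \<open>e = b + ?n\<close> by simp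
    have no: "(b, c) \<notin> orb2 ?n (a, c)" "(c, e) \<notin> orb2 ?n (a, c)"
      using o 1 \<open>e = b + ?n\<close> unfolding orb2_iff by auto
    have "fsum ?n g (tris ?D') - fsum ?n g (tris ?D) = g (b, a + ?n, b + ?n) - g (a, b, a + ?n)"
    proof (rule fsum_flip_diameter[OF D D' inv _ _ _ _ _ _ T'2])
      show "(a, b) \<in> ?D" "(b, a + ?n) \<in> ?D" "(a, a + ?n) \<in> ?D" using E o 1 by (auto intro!: inD)
      show "(b, a + ?n) \<in> ?D'" using keep[of b c] E no o 1 by (auto intro!: inD')
      show "(a + ?n, b + ?n) \<in> ?D'" using keep[of c e] E no o 1 \<open>e = b + ?n\<close> by (auto intro!: inD')
      show "(b, b + ?n) \<in> ?D'" unfolding T'2 orb2_iff by (intro UnI2) (auto simp: orb2_iff intro!: exI[of _ 0])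
    qed
    then show ?thesis using diam[of a b] o 1 by simp
  next
    case 2
    have "?D' = ?D - orb2 ?n (a, c) \<union> orb2 ?n (b, e)" using arcs_of_flip[OF T'eq] o 2 by simp
    moreover have "(a, b) \<in> ?D" "(b, c) \<in> ?D" "(c, e) \<in> ?D" "(a, e) \<in> ?D" "(a, c) \<in> ?D"
      using E o 2 by (auto intro!: inD)
    ultimately show ?thesis using fsum_flip[OF D D' inv o(1-3) 2(2)] quad[OF o(1-3) 2(2)] by simp
  next
    case 3
    \<comment> \<open>With \<open>e\<close> moved one turn back, the vertices in order are
      \<open>?p\<close>, \<open>a\<close>, \<open>b\<close>, \<open>c\<close>, and the removed edge
      joins the second to the fourth. So \<open>fsum_flip\<close> applies to the inverse flip, from
      \<open>?D'\<close> to \<open>?D\<close>.\<close>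
    let ?p = "e - 2 * ?n"
    have o': "?p < a" "a < b" "b < c" "c \<le> ?p + ?n" using o 3 by simp_all
    have T2: "T' = T - {{pm d a, pm d c}, {pm d (a + ?n), pm d (c + ?n)}} \<union> {{pm d ?p, pm d b}, {pm d (?p + ?n), pm d (b + ?n)}}"
      unfolding T'eq pme by (simp add: insert_commute)
    have D'eq: "?D' = ?D - orb2 ?n (a, c) \<union> orb2 ?n (?p, b)" using arcs_of_flip[OF T2] o' o by simp
    have acD: "(a, c) \<in> ?D" using E o by (auto intro!: inD)
    have pbD: "(?p, b) \<notin> ?D" using arc_system.noncross[OF D _ acD, of ?p b] o' by auto
    have Deq: "?D = ?D' - orb2 ?n (?p, b) \<union> orb2 ?n (a, c)"
    proof -
      have "orb2 ?n (a, c) \<subseteq> ?D" using acD arc_system.shiftk[OF D] unfolding orb2_def by auto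
      moreover have "orb2 ?n (?p, b) \<inter> ?D = {}" using pbD arc_system.shiftk[OF D] unfolding orb2_def by auto
      ultimately show ?thesis unfolding D'eq by blast
    qed
    have pb': "(?p, b) \<in> ?D'" unfolding D'eq by (intro UnI2) (auto simp: orb2_iff intro!: exI[of _ 0])
    have sD: "(?p, a) \<in> ?D" "(a, b) \<in> ?D" "(b, c) \<in> ?D" "(?p, c) \<in> ?D"
    proof -
      have "{pm d ?p, pm d a} \<in> T" "{pm d ?p, pm d c} \<in> T" unfolding pme using E by (simp_all add: insert_commute)
      then show "(?p, a) \<in> ?D" "(a, b) \<in> ?D" "(b, c) \<in> ?D" "(?p, c) \<in> ?D"
        using E o o' by (auto intro!: inD)
    qed
    have no: "(?p, a) \<notin> orb2 ?n (a, c)" "(a, b) \<notin> orb2 ?n (a, c)" "(b, c) \<notin> orb2 ?n (a, c)" "(?p, c) \<notin> orb2 ?n (a, c)"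
    proof -
      show "(a, b) \<notin> orb2 ?n (a, c)" "(b, c) \<notin> orb2 ?n (a, c)" "(?p, c) \<notin> orb2 ?n (a, c)" using o o' unfolding orb2_iff by auto
      show "(?p, a) \<notin> orb2 ?n (a, c)"
      proof
        assume "(?p, a) \<in> orb2 ?n (a, c)"
        then obtain k where k: "?p = a + k * ?n" "a = c + k * ?n" unfolding orb2_iff by blast
        have "k < 0"
        proof (rule ccontr)
          assume "\<not> k < 0"
          then have "0 \<le> k * ?n" by (intro mult_nonneg_nonneg) auto
          then show False using k(1) o'(1) by linarith
        qed
        then have "k * ?n \<le> (-1) * ?n" by (intro mult_right_mono) auto
        then show False using k o' o by linarith
      qed
    qed
    have "(?p, a) \<in> ?D'" "(a, b) \<in> ?D'" "(b, c) \<in> ?D'" "(?p, c) \<in> ?D'" using sD no D'eq by blast+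
    from fsum_flip[OF D' D inv o' this Deq pb'] quad[OF o']
    show ?thesis by simp
  next
    case 4
    \<comment> \<open>A triangle around the centre is incompatible with symmetry: its side
      \<open>{a, e}\<close> crosses the opposite of its side \<open>{a, c}\<close>.\<close>
    have "crossing {pm d a, pm d e} {pm d (a + ?n), pm d (c + ?n)}"
      by (rule crossing_pm) (use o 4 in simp_all)
    then show ?thesis using nc E(5) opE[OF E(1)] unfolding noncrossing_def by blast
  qed
qed

section \<open>Zigzag triangulations\<close>

text \<open>Boundary edges and vertex sums are expressed by congruences, so the relation does not
  depend on the chosen lifts (\<open>zrel_shift\<close>).\<close>

definition zrel :: "nat \<Rightarrow> int \<Rightarrow> int \<Rightarrow> int \<Rightarrow> bool" where
  "zrel d k u v \<longleftrightarrow> 2 * (int d + 1) dvd v - u - 1 \<or> 2 * (int d + 1) dvd u - v - 1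
     \<or> 2 * (int d + 1) dvd u + v - k \<or> 2 * (int d + 1) dvd u + v - k - 1"

definition zigzag :: "nat \<Rightarrow> int \<Rightarrow> nat set set" where
  "zigzag d k = {{pm d u, pm d v} | u v. \<not> 2 * (int d + 1) dvd u - v \<and> zrel d k u v}"

lemma dvd_shift: "(N::int) dvd x \<Longrightarrow> y = x + N * i \<Longrightarrow> N dvd y"
  by simp

lemma zrel_shift:
  assumes "zrel d k u v" "u' = u + 2 * (int d + 1) * i" "v' = v + 2 * (int d + 1) * j"
  shows "zrel d k u' v'"
  using assms(1) unfolding zrel_def
proof (elim disjE)
  assume "2 * (int d + 1) dvd v - u - 1"
  from dvd_shift[OF this, of "v' - u' - 1" "j - i"] show "2 * (int d + 1) dvd v' - u' - 1 \<or> 2 * (int d + 1) dvd u' - v' - 1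
     \<or> 2 * (int d + 1) dvd u' + v' - k \<or> 2 * (int d + 1) dvd u' + v' - k - 1" unfolding assms by (simp add: algebra_simps)
next
  assume "2 * (int d + 1) dvd u - v - 1"
  from dvd_shift[OF this, of "u' - v' - 1" "i - j"] show "2 * (int d + 1) dvd v' - u' - 1 \<or> 2 * (int d + 1) dvd u' - v' - 1
     \<or> 2 * (int d + 1) dvd u' + v' - k \<or> 2 * (int d + 1) dvd u' + v' - k - 1" unfolding assms by (simp add: algebra_simps)
next
  assume "2 * (int d + 1) dvd u + v - k"
  from dvd_shift[OF this, of "u' + v' - k" "i + j"] show "2 * (int d + 1) dvd v' - u' - 1 \<or> 2 * (int d + 1) dvd u' - v' - 1
     \<or> 2 * (int d + 1) dvd u' + v' - k \<or> 2 * (int d + 1) dvd u' + v' - k - 1" unfolding assms by (simp add: algebra_simps)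
next
  assume "2 * (int d + 1) dvd u + v - k - 1"
  from dvd_shift[OF this, of "u' + v' - k - 1" "i + j"] show "2 * (int d + 1) dvd v' - u' - 1 \<or> 2 * (int d + 1) dvd u' - v' - 1
     \<or> 2 * (int d + 1) dvd u' + v' - k \<or> 2 * (int d + 1) dvd u' + v' - k - 1" unfolding assms by (simp add: algebra_simps)
qed

lemma zrel_sym: "zrel d k u v \<longleftrightarrow> zrel d k v u"
  unfolding zrel_def by (auto simp: add.commute)

lemma pm_eq_dvd: "pm d u = pm d v \<longleftrightarrow> 2 * (int d + 1) dvd u - v"
  unfolding pm_eq_iff dvd_def by (auto simp: algebra_simps)

lemma zigzag_iff: "{pm d u, pm d v} \<in> zigzag d k \<longleftrightarrow> pm d u \<noteq> pm d v \<and> zrel d k u v"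
proof
  assume "{pm d u, pm d v} \<in> zigzag d k"
  then obtain u' v' where e: "{pm d u, pm d v} = {pm d u', pm d v'}" and n: "pm d u' \<noteq> pm d v'" and z: "zrel d k u' v'"
    unfolding zigzag_def pm_eq_dvd[symmetric] by blast
  from e consider "pm d u = pm d u'" "pm d v = pm d v'" | "pm d u = pm d v'" "pm d v = pm d u'"
    unfolding doubleton_eq_iff by blast
  then show "pm d u \<noteq> pm d v \<and> zrel d k u v"
  proof cases
    case 1
    then obtain i j where "u = u' + 2 * (int d + 1) * i" "v = v' + 2 * (int d + 1) * j" unfolding pm_eq_iff by blast
    from zrel_shift[OF z this] show ?thesis using n 1 by simp
  next
    case 2
    then obtain i j where "v = u' + 2 * (int d + 1) * i" "u = v' + 2 * (int d + 1) * j" unfolding pm_eq_iff by blast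
    from zrel_shift[OF z this] have "zrel d k u v" using zrel_sym by blast
    then show ?thesis using n 2 by simp
  qed
next
  show "pm d u \<noteq> pm d v \<and> zrel d k u v \<Longrightarrow> {pm d u, pm d v} \<in> zigzag d k"
    unfolding zigzag_def pm_eq_dvd by blast
qed

lemma no_dvd: "0 < z \<Longrightarrow> z < N \<Longrightarrow> \<not> (N::int) dvd z"
  by (rule zdvd_not_zless)

lemma zigzag_edges: "zigzag d k \<subseteq> polygon_edges (2 * d + 2)"
  unfolding zigzag_def polygon_edges_def using pm_less pm_eq_dvd by blast

lemma zrel_far:
  assumes "zrel d k u v" "u + 2 \<le> v" "v + 2 \<le> u + 2 * (int d + 1)"
  shows "\<exists>i\<in>{0, 1}. 2 * (int d + 1) dvd u + v - k - i"
proof -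
  have "\<not> 2 * (int d + 1) dvd v - u - 1" by (rule no_dvd) (use assms in linarith)+
  moreover have "\<not> 2 * (int d + 1) dvd u - v - 1"
  proof
    assume "2 * (int d + 1) dvd u - v - 1"
    from dvd_shift[OF this, of "u - v - 1 + 2 * (int d + 1)" 1] have "2 * (int d + 1) dvd u - v - 1 + 2 * (int d + 1)" by simp
    moreover have "\<not> 2 * (int d + 1) dvd u - v - 1 + 2 * (int d + 1)" by (rule no_dvd) (use assms in linarith)+
    ultimately show False by blast
  qed
  ultimately show ?thesis using assms(1) unfolding zrel_def by auto
qed

text \<open>The vertex sums of two crossing edges differ by at least 2 and at most
  \<open>2 * n - 2\<close>, but modulo \<open>2 * n\<close> both sums would be \<open>k\<close> or
  \<open>k + 1\<close>.\<close>

lemma noncrossing_zigzag: "noncrossing (zigzag d k)"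
  unfolding noncrossing_def
proof (intro ballI notI)
  fix e f assume ef: "e \<in> zigzag d k" "f \<in> zigzag d k" "crossing e f"
  let ?N = "2 * (int d + 1)"
  obtain A B C E where o: "A < B" "B < C" "C < E" and eq: "{e, f} = {{A, C}, {B, E}}"
    using ef(3) unfolding crossing_def by blast
  have in_z: "{A, C} \<in> zigzag d k" "{B, E} \<in> zigzag d k"
    using eq[unfolded doubleton_eq_iff[of e]] ef(1,2) by auto
  have lt: "A < 2 * d + 2" "C < 2 * d + 2" "B < 2 * d + 2" "E < 2 * d + 2"
    using in_z zigzag_edges polygon_edge_iff by blast+
  have z: "zrel d k (int A) (int C)" "zrel d k (int B) (int E)"
    using in_z zigzag_iff[of d "int A" "int C" k] zigzag_iff[of d "int B" "int E" k] lt by (simp_all add: pm_of_nat)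
  have oi: "int A + 1 \<le> int B" "int B + 1 \<le> int C" "int C + 1 \<le> int E" "int E + 1 \<le> ?N" "0 \<le> int A" using o lt by simp_all
  obtain i j where ij: "i \<in> {0, 1}" "j \<in> {0, 1}" "?N dvd int A + int C - k - i" "?N dvd int B + int E - k - j"
  proof -
    have far: "int A + 2 \<le> int C" "int C + 2 \<le> int A + ?N" "int B + 2 \<le> int E" "int E + 2 \<le> int B + ?N" using oi by linarith+
    show thesis using that zrel_far[OF z(1) far(1,2)] zrel_far[OF z(2) far(3,4)] by blast
  qed
  have "?N dvd (int B + int E - k - j) - (int A + int C - k - i)" by (rule dvd_diff) fact+
  moreover have "\<not> ?N dvd (int B + int E - k - j) - (int A + int C - k - i)"
    by (rule no_dvd) (use oi ij in auto)
  ultimately show False by blast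
qed

text \<open>An edge \<open>{x, y}\<close> outside the zigzag is crossed by one inside. The vertex
  \<open>w\<close> is the partner of \<open>x\<close>, of sum \<open>k\<close>. As \<open>y\<close>
  is neither \<open>w\<close> nor \<open>w + 1\<close> nor a neighbour of \<open>x\<close>, a zigzag
  edge close to those at \<open>x\<close> separates \<open>x\<close> from \<open>y\<close>.\<close>

lemma zigzag_maximal:
  assumes S: "S \<subseteq> polygon_edges (2 * d + 2)" "noncrossing S" "zigzag d k \<subseteq> S"
  shows "S = zigzag d k"
proof (rule ccontr)
  assume "S \<noteq> zigzag d k"
  then obtain f where f: "f \<in> S" "f \<notin> zigzag d k" using S(3) by blast
  let ?N = "2 * (int d + 1)"
  obtain X Y where XY: "X < Y" "Y < 2 * d + 2" "f = {X, Y}"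
  proof -
    obtain X Y where "X < 2 * d + 2" "Y < 2 * d + 2" "X \<noteq> Y" "f = {X, Y}" using f(1) S(1) unfolding polygon_edges_def by blast
    then show thesis using that[of X Y] that[of Y X] by (cases "X < Y") (auto simp: insert_commute)
  qed
  define x y where "x = int X" and "y = int Y"
  have fxy: "f = {pm d x, pm d y}" using XY unfolding x_def y_def by (simp add: pm_of_nat)
  have xy: "x < y" "y < x + ?N" using XY unfolding x_def y_def by auto
  have "pm d x \<noteq> pm d y" unfolding x_def y_def using XY by (simp add: pm_of_nat)
  then have nz: "\<not> zrel d k x y" using f(2) unfolding fxy zigzag_iff by blast
  define w where "w = x + 1 + (k - 2 * x - 1) mod ?N"
  have w: "x + 1 \<le> w" "w \<le> x + ?N"
  proof -
    have "0 \<le> (k - 2 * x - 1) mod ?N" "(k - 2 * x - 1) mod ?N < ?N" by simp_all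
    then show "x + 1 \<le> w" "w \<le> x + ?N" unfolding w_def by linarith+
  qed
  have wk: "?N dvd x + w - k"
  proof -
    have eq: "x + w - k = - ((k - 2 * x - 1) - (k - 2 * x - 1) mod ?N)" unfolding w_def by simp
    show ?thesis unfolding eq dvd_minus_iff by (rule dvd_minus_mod)
  qed
  have y1: "y \<noteq> x + 1" "y \<noteq> x + ?N - 1" "y \<noteq> w" "y \<noteq> w + 1"
  proof -
    show "y \<noteq> x + 1" using nz unfolding zrel_def by auto
    show "y \<noteq> x + ?N - 1"
    proof
      assume "y = x + ?N - 1"
      then have "x - y - 1 = - ?N" by simp
      then have "?N dvd x - y - 1" by (simp only: dvd_minus_iff dvd_refl)
      then show False using nz unfolding zrel_def by blast
    qed
    show "y \<noteq> w" using nz wk unfolding zrel_def by blast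
    show "y \<noteq> w + 1"
    proof
      assume "y = w + 1"
      then have "x + y - k - 1 = x + w - k" by simp
      then show False using nz wk unfolding zrel_def by metis
    qed
  qed
  have no: False if "x < p" "p < y" "y < q" "q < x + ?N" "?N dvd p + q - k \<or> ?N dvd p + q - k - 1" for p q
  proof -
    have "\<not> ?N dvd q - p" by (rule no_dvd) (use that in linarith)+
    then have "pm d p \<noteq> pm d q" unfolding pm_eq_dvd by (metis dvd_minus_iff minus_diff_eq)
    then have "{pm d p, pm d q} \<in> S" using that(5) S(3) zigzag_iff[of d p q k] unfolding zrel_def by blast
    moreover have "crossing {pm d x, pm d y} {pm d p, pm d q}" by (rule crossing_pm) (use that in simp_all)
    ultimately show False using S(2) f(1) fxy unfolding noncrossing_def by blast
  qed
  \<comment> \<open>The crossing edge is \<open>{x + 1, w}\<close>, \<open>{x + 1, x - 1}\<close> or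
    \<open>{w + 1, x - 1}\<close>, respectively; in the second case \<open>x\<close> is its own
    partner.\<close>
  consider "y < w" "w < x + ?N" | "y < w" "w = x + ?N" | "w + 1 < y" using y1 w by linarith
  then show False
  proof cases
    case 1
    show False
    proof (rule no[of "x + 1" w])
      have "x + 1 + w - k - 1 = x + w - k" by simp
      then show "?N dvd x + 1 + w - k \<or> ?N dvd x + 1 + w - k - 1" using wk by metis
    qed (use 1 xy y1 in linarith)+
  next
    case 2
    show False
    proof (rule no[of "x + 1" "w - 1"])
      have "x + 1 + (w - 1) - k = x + w - k" by simp
      then show "?N dvd x + 1 + (w - 1) - k \<or> ?N dvd x + 1 + (w - 1) - k - 1" using wk by metis
    qed (use 2 xy y1 in linarith)+
  next
    case 3
    show False
    proof (rule no[of "w + 1" "x - 1 + ?N"])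
      have "w + 1 + (x - 1 + ?N) - k = (x + w - k) + ?N * 1" by simp
      then show "?N dvd w + 1 + (x - 1 + ?N) - k \<or> ?N dvd w + 1 + (x - 1 + ?N) - k - 1" using dvd_shift[OF wk] by blast
    qed (use 3 xy y1 w in linarith)+
  qed
qed

text \<open>Central symmetry adds \<open>2 * n\<close> to every vertex sum and keeps boundary
  edges.\<close>

lemma zigzag_symmetric_triangulation: "zigzag d k \<in> symmetric_triangulations d"
proof -
  have "centrally_symmetric d (zigzag d k)"
    unfolding centrally_symmetric_def
  proof (intro allI impI)
    fix x y assume xy: "{x, y} \<in> zigzag d k"
    then have lt: "x < 2 * d + 2" "y < 2 * d + 2" using zigzag_edges polygon_edge_iff by blast+
    let ?n = "int d + 1"
    have p: "pm d (int x) = x" "pm d (int y) = y" using lt pm_of_nat by auto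
    then have z: "pm d (int x) \<noteq> pm d (int y)" "zrel d k (int x) (int y)" using xy zigzag_iff[of d "int x" "int y" k] by simp_all
    have "zrel d k (int x + ?n) (int y + ?n)"
    proof -
      have e: "int y + ?n - (int x + ?n) - 1 = int y - int x - 1" "int x + ?n - (int y + ?n) - 1 = int x - int y - 1"
        "int x + ?n + (int y + ?n) - k = (int x + int y - k) + 2 * ?n"
        "int x + int y - k + 2 * ?n - 1 = (int x + int y - k - 1) + 2 * ?n" by simp_all
      show ?thesis using z(2) unfolding zrel_def e by (simp only: dvd_add_triv_right_iff)
    qed
    moreover have "pm d (int x + ?n) \<noteq> pm d (int y + ?n)" using z(1) unfolding pm_eq_dvd by simp
    ultimately have "{pm d (int x + ?n), pm d (int y + ?n)} \<in> zigzag d k" unfolding zigzag_iff by blast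
    then show "{opposite d x, opposite d y} \<in> zigzag d k" unfolding opposite_pm[symmetric] p .
  qed
  then show ?thesis
    unfolding symmetric_triangulations_def triangulation_def
    using zigzag_edges noncrossing_zigzag zigzag_maximal by blast
qed

lemma zigzag_arc_iff:
  assumes "d > 0"
  shows "(u, v) \<in> arcs_of d (zigzag d k) \<longleftrightarrow> u < v \<and> v \<le> u + (int d + 1)
    \<and> (v = u + 1 \<or> 2 * (int d + 1) dvd u + v - k \<or> 2 * (int d + 1) dvd u + v - k - 1)"
proof (cases "u < v \<and> v \<le> u + (int d + 1)")
  case True
  have "\<not> 2 * (int d + 1) dvd v - u" by (rule no_dvd) (use True in auto)
  then have "pm d v \<noteq> pm d u" unfolding pm_eq_dvd .
  moreover have "zrel d k u v \<longleftrightarrow> v = u + 1 \<or> 2 * (int d + 1) dvd u + v - k \<or> 2 * (int d + 1) dvd u + v - k - 1"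
  proof (cases "v = u + 1")
    case False
    then show ?thesis using zrel_far[of d k u v] True assms unfolding zrel_def by auto
  qed (simp add: zrel_def)
  ultimately show ?thesis using True unfolding arcs_of_def zigzag_iff by (auto simp: zigzag_iff)
next
  case False then show ?thesis unfolding arcs_of_def by auto
qed

text \<open>The triangle on the boundary edge from \<open>j\<close> to \<open>j + 1\<close> has its apex at \<open>k - j\<close>.\<close>

definition apex_tri :: "nat \<Rightarrow> int \<Rightarrow> int \<Rightarrow> int \<times> int \<times> int" where
  "apex_tri d k j = (let r = j + (k - 2 * j) mod (2 * (int d + 1)) in
     if r \<le> j + (int d + 1) then (j, j + 1, r) else (r - 2 * (int d + 1), j, j + 1))"

lemma apex_tri_eqI:
  assumes "2 * (int d + 1) dvd j + r - k" "j \<le> r" "r < j + 2 * (int d + 1)"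
  shows "(k - 2 * j) mod (2 * (int d + 1)) = r - j"
proof -
  obtain q where q: "j + r - k = 2 * (int d + 1) * q" using assms(1) by blast
  have "k - 2 * j = (r - j) + 2 * (int d + 1) * (- q)" using q by (simp add: algebra_simps)
  then have "(k - 2 * j) mod (2 * (int d + 1)) = (r - j) mod (2 * (int d + 1))" by (simp only: mod_mult_self2)
  then show ?thesis using assms by simp
qed

section \<open>The triangles of a zigzag\<close>

text \<open>The three pairwise sums of a triangle are distinct modulo \<open>2 * n\<close>, so at
  most two of them are \<open>k\<close> or \<open>k + 1\<close>, and some side is a boundary edge.
  Which sum equals \<open>k\<close> tells whether the base lies before or after the apex.\<close>

lemma zigzag_tris:
  assumes d: "d > 0" and t: "(p, q, r) \<in> tris (arcs_of d (zigzag d k))"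
  shows "q = p + 1 \<and> 2 * (int d + 1) dvd p + r - k \<or> r = q + 1 \<and> 2 * (int d + 1) dvd p + q - k"
proof -
  let ?N = "2 * (int d + 1)"
  have a: "p < q" "q < r" "r \<le> p + (int d + 1)"
    "q = p + 1 \<or> ?N dvd p + q - k \<or> ?N dvd p + q - k - 1"
    "r = q + 1 \<or> ?N dvd q + r - k \<or> ?N dvd q + r - k - 1"
    "r = p + 1 \<or> ?N dvd p + r - k \<or> ?N dvd p + r - k - 1"
    using t unfolding tris_def by (auto simp: zigzag_arc_iff[OF d])
  have sm: False if "?N dvd x" "?N dvd y" "0 < x - y" "x - y < ?N" for x y
    using dvd_diff[OF that(1,2)] no_dvd[OF that(3,4)] by blast
  have pr: "?N dvd p + r - k \<or> ?N dvd p + r - k - 1" using a by auto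
  show ?thesis
  proof (cases "q = p + 1")
    case True
    show ?thesis
    proof (cases "?N dvd p + r - k")
      case False
      then have 1: "?N dvd p + r - k - 1" using pr by blast
      have "r = q + 1"
      proof (rule ccontr)
        assume "r \<noteq> q + 1"
        then consider "?N dvd q + r - k" | "?N dvd q + r - k - 1" using a(5) by blast
        then show False
        proof cases
          case 1
          then show False using sm[of "q + r - k" "p + r - k - 1"] \<open>?N dvd p + r - k - 1\<close> True a d by simp
        next
          case 2
          then show False using sm[of "q + r - k - 1" "p + r - k - 1"] 1 True a d by simp
        qed
      qed
      then have "p + q - k = p + r - k - 1" by simp
      then show ?thesis using 1 \<open>r = q + 1\<close> by metis
    qed (use True in simp)
  next
    case False
    then have pq: "?N dvd p + q - k \<or> ?N dvd p + q - k - 1" using a by blast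
    have pq0: "?N dvd p + q - k"
    proof (rule ccontr)
      assume n: "\<not> ?N dvd p + q - k"
      then have "?N dvd p + q - k - 1" using pq by blast
      from pr this show False using sm[of "p + r - k" "p + q - k - 1"] sm[of "p + r - k - 1" "p + q - k - 1"] a by auto
    qed
    have r1: "r = q + 1"
    proof (rule ccontr)
      assume "r \<noteq> q + 1"
      then have "?N dvd q + r - k \<or> ?N dvd q + r - k - 1" using a by blast
      then show False using pq0 sm[of "q + r - k" "p + q - k"] sm[of "q + r - k - 1" "p + q - k"] a by auto
    qed
    then show ?thesis using pq0 by blast
  qed
qed

text \<open>The residues 0 and 1 would put the apex on an end of the base edge. Otherwise the apex
  is lifted to the right of the base if that stays within distance \<open>n\<close>, and one turn
  back if not.\<close>

lemma apex_tri_in: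
  assumes d: "d > 0" and J: "2 \<le> (k - 2 * j) mod (2 * (int d + 1))"
  shows "apex_tri d k j \<in> tris (arcs_of d (zigzag d k))"
proof -
  let ?N = "2 * (int d + 1)"
  define r where "r = j + (k - 2 * j) mod ?N"
  have lt: "(k - 2 * j) mod ?N < ?N" by simp
  have r: "j + 2 \<le> r" "r < j + ?N" using J lt unfolding r_def by linarith+
  have eq: "j + r - k = - ((k - 2 * j) - (k - 2 * j) mod ?N)" unfolding r_def by simp
  have dv: "?N dvd j + r - k" unfolding eq dvd_minus_iff by (rule dvd_minus_mod)
  have "(j + 1) + r - k - 1 = j + r - k" by simp
  then have dv1: "?N dvd (j + 1) + r - k - 1" using dv by (simp only:)
  show ?thesis
  proof (cases "r \<le> j + (int d + 1)")
    case True
    then have "apex_tri d k j = (j, j + 1, r)" unfolding apex_tri_def r_def by simp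
    then show ?thesis using True r dv dv1 d unfolding tris_def by (auto simp: zigzag_arc_iff[OF d])
  next
    case False
    have 1: "?N dvd (r - ?N) + j - k" "?N dvd (r - ?N) + (j + 1) - k - 1"
    proof -
      have "(r - ?N) + j - k = (j + r - k) + ?N * (- 1)" "(r - ?N) + (j + 1) - k - 1 = (j + r - k) + ?N * (- 1)" by simp_all
      then show "?N dvd (r - ?N) + j - k" "?N dvd (r - ?N) + (j + 1) - k - 1" using dvd_shift[OF dv] by blast+
    qed
    have b: "r - ?N < j" "j \<le> r - ?N + (int d + 1)" "r - ?N < j + 1" "j + 1 \<le> r - ?N + (int d + 1)"
      "j < j + 1" "j + 1 \<le> j + (int d + 1)" using False r d by simp_all
    have "(r - ?N, j) \<in> arcs_of d (zigzag d k)" "(r - ?N, j + 1) \<in> arcs_of d (zigzag d k)" "(j, j + 1) \<in> arcs_of d (zigzag d k)"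
      unfolding zigzag_arc_iff[OF d] using 1 b by blast+
    moreover have "apex_tri d k j = (r - ?N, j, j + 1)" using False unfolding apex_tri_def r_def by simp
    ultimately show ?thesis unfolding tris_def by simp
  qed
qed
lemma apex_tri_shift: "apex_tri d k (j + c * (int d + 1)) =
   (case apex_tri d k j of (p, q, r) \<Rightarrow> (p + c * (int d + 1), q + c * (int d + 1), r + c * (int d + 1)))"
proof -
  have "k - 2 * (j + c * (int d + 1)) = k - 2 * j + 2 * (int d + 1) * (- c)" by (simp add: algebra_simps)
  then have "(k - 2 * (j + c * (int d + 1))) mod (2 * (int d + 1)) = (k - 2 * j) mod (2 * (int d + 1))"
    by (simp only: mod_mult_self2)
  then show ?thesis unfolding apex_tri_def Let_def by simp
qed

lemma apex_tri_base:
  assumes "(p, q, r) \<in> orb3 (int d + 1) (apex_tri d k j)"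
  shows "\<exists>c. (p = j + c * (int d + 1) \<and> q = p + 1 \<and> 2 * (int d + 1) dvd p + r - k)
    \<or> (q = j + c * (int d + 1) \<and> r = q + 1 \<and> 2 * (int d + 1) dvd p + q - k)"
proof -
  let ?N = "2 * (int d + 1)"
  obtain p0 q0 r0 where t: "apex_tri d k j = (p0, q0, r0)" by (metis prod_cases3)
  obtain c where "p = p0 + c * (int d + 1)" "q = q0 + c * (int d + 1)" "r = r0 + c * (int d + 1)"
    using assms unfolding t orb3_iff by blast
  then have c: "(p, q, r) = apex_tri d k (j + c * (int d + 1))" unfolding apex_tri_shift t by simp
  let ?j = "j + c * (int d + 1)"
  define r' where "r' = ?j + (k - 2 * ?j) mod ?N"
  have eq: "?j + r' - k = - ((k - 2 * ?j) - (k - 2 * ?j) mod ?N)" unfolding r'_def by simp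
  have dv: "?N dvd ?j + r' - k" unfolding eq dvd_minus_iff by (rule dvd_minus_mod)
  have dv': "?N dvd (r' - ?N) + ?j - k"
    by (rule dvd_shift[OF dv, of _ "-1"]) simp
  show ?thesis
  proof (cases "r' \<le> ?j + (int d + 1)")
    case True
    then have "p = ?j" "q = ?j + 1" "r = r'" using c unfolding apex_tri_def Let_def r'_def[symmetric] by simp_all
    then show ?thesis using dv by blast
  next
    case False
    then have "p = r' - ?N" "q = ?j" "r = ?j + 1" using c unfolding apex_tri_def Let_def r'_def[symmetric] by simp_all
    then show ?thesis using dv' by blast
  qed
qed

lemma (in arc_system) fsum_orbits:
  assumes "invariant n g" "finite J" "\<And>j. j \<in> J \<Longrightarrow> orb3 n (t j) \<subseteq> tris D"
    "\<And>i j. i \<in> J \<Longrightarrow> j \<in> J \<Longrightarrow> i \<noteq> j \<Longrightarrow> orb3 n (t i) \<inter> orb3 n (t j) = {}"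
  shows "fsum n g (\<Union>j\<in>J. orb3 n (t j)) = (\<Sum>j\<in>J. g (t j))"
  using assms(2-)
proof (induction J rule: finite_induct)
  case empty
  then show ?case by (simp add: fsum_def)
next
  case (insert j J)
  have fin: "finite {p\<in>S. 0 \<le> fst p \<and> fst p < n}" if "S \<subseteq> tris D" for S
    by (rule finite_subset[OF _ finite_tris]) (use that in blast)
  have s1: "orb3 n (t j) \<subseteq> tris D" using insert.prems(1) by blast
  have s2: "(\<Union>j\<in>J. orb3 n (t j)) \<subseteq> tris D" using insert.prems(1) by blast
  have "orb3 n (t j) \<inter> orb3 n (t i) = {}" if "i \<in> J" for i using insert.prems(2)[of j i] insert.hyps that by auto
  then have dj: "orb3 n (t j) \<inter> (\<Union>j\<in>J. orb3 n (t j)) = {}" by blast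
  have IH: "fsum n g (\<Union>j\<in>J. orb3 n (t j)) = (\<Sum>j\<in>J. g (t j))"
    by (rule insert.IH) (use insert.prems in blast)+
  show ?case
    using fsum_Un[OF fin[OF s1] fin[OF s2] dj, of g] IH fsum_orb3[OF n_pos assms(1), of "t j"] insert.hyps by simp
qed

text \<open>Up to translation, each triangle arises from exactly one base edge. An ear has two
  boundary sides, but for one of them the residue is 0 or 1, and this one is left out.\<close>

lemma fsum_zigzag:
  assumes d: "d > 0" and g: "invariant (int d + 1) g"
  shows "fsum (int d + 1) g (tris (arcs_of d (zigzag d k)))
    = (\<Sum>j\<in>{j\<in>{0..<int d + 1}. 2 \<le> (k - 2 * j) mod (2 * (int d + 1))}. g (apex_tri d k j))"
proof -
  let ?n = "int d + 1" and ?N = "2 * (int d + 1)"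
  let ?J = "{j\<in>{0..<?n}. 2 \<le> (k - 2 * j) mod ?N}"
  let ?D = "arcs_of d (zigzag d k)"
  interpret arc_system ?n ?D by (rule arcs_arcs_of[OF zigzag_symmetric_triangulation])
  have sub: "orb3 ?n (apex_tri d k j) \<subseteq> tris ?D" if "2 \<le> (k - 2 * j) mod ?N" for j
  proof -
    obtain p q r where pqr: "apex_tri d k j = (p, q, r)" by (metis prod_cases3)
    show ?thesis using apex_tri_in[OF d that] unfolding pqr by (rule orb3_subset)
  qed
  have ndvd1: "\<not> ?N dvd 1" by (rule no_dvd) auto
  have dj: "orb3 ?n (apex_tri d k i) \<inter> orb3 ?n (apex_tri d k j) = {}" if ij: "i \<in> ?J" "j \<in> ?J" "i \<noteq> j" for i j
  proof (rule disjoint3)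
    fix p q r assume "(p, q, r) \<in> orb3 ?n (apex_tri d k i)" "(p, q, r) \<in> orb3 ?n (apex_tri d k j)"
    from apex_tri_base[OF this(1)] apex_tri_base[OF this(2)] obtain a b where
      A: "(p = i + a * ?n \<and> q = p + 1 \<and> ?N dvd p + r - k) \<or> (q = i + a * ?n \<and> r = q + 1 \<and> ?N dvd p + q - k)" and
      B: "(p = j + b * ?n \<and> q = p + 1 \<and> ?N dvd p + r - k) \<or> (q = j + b * ?n \<and> r = q + 1 \<and> ?N dvd p + q - k)" by blast
    have same: "i + a * ?n \<noteq> j + b * ?n"
    proof
      assume e: "i + a * ?n = j + b * ?n"
      have "(i + a * ?n) mod ?n = i" "(j + b * ?n) mod ?n = j" using ij by simp_all
      then show False using e ij(3) by metis
    qed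
    \<comment> \<open>Reading one triangle from two different boundary sides would make two
      consecutive sums congruent to \<open>k\<close>.\<close>
    have mixed: False if "?N dvd p + r - k" "r = q + 1" "?N dvd p + q - k"
    proof -
      have "?N dvd (p + r - k) - (p + q - k)" by (rule dvd_diff) fact+
      moreover have "(p + r - k) - (p + q - k) = 1" using that(2) by simp
      ultimately show False using ndvd1 by metis
    qed
    show False using A B same mixed by metis
  qed
  have cover: "tris ?D = (\<Union>j\<in>?J. orb3 ?n (apex_tri d k j))"
  proof (intro equalityI subsetI)
    fix x assume x: "x \<in> tris ?D"
    obtain p q r where pqr: "x = (p, q, r)" by (metis prod_cases3)
    have o: "p < q" "q < r" "r \<le> p + ?n" using x arc unfolding pqr tris_def by auto
    obtain j where j: "apex_tri d k j = (p, q, r)" "2 \<le> (k - 2 * j) mod ?N"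
    proof -
      from zigzag_tris[OF d x[unfolded pqr]] show thesis
      proof
        assume A: "q = p + 1 \<and> ?N dvd p + r - k"
        have e: "(k - 2 * p) mod ?N = r - p" by (rule apex_tri_eqI) (use A o d in auto)
        have "apex_tri d k p = (p, q, r)" unfolding apex_tri_def Let_def e using A o by simp
        moreover have "2 \<le> (k - 2 * p) mod ?N" unfolding e using A o by simp
        ultimately show thesis by (rule that)
      next
        assume B: "r = q + 1 \<and> ?N dvd p + q - k"
        have "q + (p + ?N) - k = (p + q - k) + ?N * 1" by simp
        then have dv: "?N dvd q + (p + ?N) - k" using dvd_shift B by blast
        have e: "(k - 2 * q) mod ?N = p + ?N - q" by (rule apex_tri_eqI[OF dv]) (use o d in auto)
        have "apex_tri d k q = (p, q, r)" unfolding apex_tri_def Let_def e using B o by simp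
        moreover have "2 \<le> (k - 2 * q) mod ?N" unfolding e using B o by simp
        ultimately show thesis by (rule that)
      qed
    qed
    define j0 where "j0 = j mod ?n"
    have jj: "j = j0 + (j div ?n) * ?n" unfolding j0_def by (rule mod_div_mult_eq[symmetric])
    have "k - 2 * j = k - 2 * j0 + ?N * (- (j div ?n))" by (subst jj) (simp add: algebra_simps)
    then have "(k - 2 * j) mod ?N = (k - 2 * j0) mod ?N" by (simp only: mod_mult_self2)
    moreover have "0 \<le> j0" "j0 < ?n" unfolding j0_def by (simp, rule pos_mod_bound, simp)
    ultimately have "j0 \<in> ?J" using j(2) by simp
    moreover have "x \<in> orb3 ?n (apex_tri d k j0)"
      using apex_tri_shift[of d k j0 "j div ?n"] j(1) unfolding jj[symmetric] pqr orb3_def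
      by (auto split: prod.splits)
    ultimately show "x \<in> (\<Union>j\<in>?J. orb3 ?n (apex_tri d k j))" by blast
  next
    fix x assume "x \<in> (\<Union>j\<in>?J. orb3 ?n (apex_tri d k j))"
    then show "x \<in> tris ?D" using sub by blast
  qed
  have "finite ?J" by (rule finite_subset[of _ "{0..<?n}"]) auto
  then show ?thesis unfolding cover by (intro fsum_orbits g sub dj) auto
qed

section \<open>The values of the two zigzags\<close>

text \<open>\<open>h\<close> is half of \<open>n + m\<close>, rounded up. Up to one step it is the
  end of the diameter of the second zigzag, as 0 is for the first. U is then deeper than V by about
  \<open>m\<close>, which is the depth by which the second zigzag is displaced.\<close>

locale shifted_zigzags =
  fixes d :: nat and m h :: int
  assumes m3: "m \<ge> 3" and mn: "m + 2 \<le> int d + 1"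
    and h: "2 * h = int d + m + 1 \<or> 2 * h = int d + m + 2"
begin

abbreviation n :: int where "n \<equiv> int d + 1"
abbreviation g :: "int \<times> int \<times> int \<Rightarrow> int" where "g \<equiv> gpot n h m"

lemma hb: "m < h" "h < n" "n < 2 * h" "2 * h \<le> n + m + 1" "n + m \<le> 2 * h"
  using m3 mn h by auto

lemma dpos: "d > 0"
  using m3 mn by simp

lemma hgtU: "0 \<le> x \<Longrightarrow> x < h \<Longrightarrow> hgt n h x = 0 \<and> dep n h x = x"
  unfolding hgt_def dep_def using hb by simp

lemma hgtV: "h \<le> x \<Longrightarrow> x < n \<Longrightarrow> hgt n h x = 1 \<and> dep n h x = n - x"
  unfolding hgt_def dep_def using hb m3 by simp

lemma hgtU2: assumes "n \<le> x" "x < n + h" shows "hgt n h x = 2 \<and> dep n h x = x - n"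
  using hgt_shift[of n h "x - n"] dep_shift[of n h "x - n"] hgtU[of "x - n"] assms by simp

lemma hgtV0: assumes "h - n \<le> x" "x < 0" shows "hgt n h x = - 1 \<and> dep n h x = - x"
  using hgt_shift[of n h x] dep_shift[of n h x] hgtV[of "x + n"] assms by simp

lemma g_inv: "invariant n g"
  unfolding invariant_def using gpot_invariant[of n] by simp

text \<open>The arguments of a typical triangle; \<open>fL\<close> contributes \<open>-3 * m\<close>
  and \<open>fR\<close> contributes \<open>-2 * m + 3\<close>.\<close>

lemma wA01: "wA m 0 1 = - (5 * m - 3)"
  unfolding wA_def fL_def fR_def using m3 by simp

text \<open>For \<open>j\<close> in the two intervals, the base lies in one block and the apex in
  the adjacent one, at depth differences 0 and 1. The other triangles, inside U or at a cut, only
  have to be nonpositive.\<close>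

lemma tri_minus:
  assumes j: "0 \<le> j" "j < n" "2 \<le> (n - 2 * j) mod (2 * n)"
  shows "g (apex_tri d n j) \<le> (if j \<in> {1..n - h} \<union> {h..n - 2} then - (5 * m - 3) else 0)"
proof (cases "2 * j \<le> n")
  case True
  have md: "(n - 2 * j) mod (2 * n) = n - 2 * j" by (rule mod_pos_pos_trivial) (use True j in simp_all)
  have 2: "2 \<le> n - 2 * j" using j(3) md by simp
  have t: "apex_tri d n j = (j, j + 1, n - j)" unfolding apex_tri_def Let_def md using j by simp
  have U: "hgt n h j = 0 \<and> dep n h j = j" "hgt n h (j + 1) = 0 \<and> dep n h (j + 1) = j + 1"
    by (rule hgtU; use 2 j hb in linarith)+
  consider "j = 0" | "1 \<le> j" "j \<le> n - h" | "n - h < j" using j by linarith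
  then show ?thesis
  proof cases
    case 1
    have "hgt n h n = 2 \<and> dep n h n = 0" using hgtU2[of n] hb m3 by simp
    then show ?thesis unfolding t gpot_def using U 1 hb m3 by (simp add: tri_pot_def vv_def)
  next
    case 2
    have "hgt n h (n - j) = 1 \<and> dep n h (n - j) = j" using hgtV[of "n - j"] 2 by simp
    then show ?thesis unfolding t gpot_def using U 2 wA01 by (simp add: tri_pot_def)
  next
    case 3
    have "hgt n h (n - j) = 0 \<and> dep n h (n - j) = n - j" by (rule hgtU) (use 3 j in linarith)+
    moreover have "j \<notin> {1..n - h} \<union> {h..n - 2}" using 3 True hb by auto
    ultimately show ?thesis unfolding t gpot_def using U by (auto simp: tri_pot_def)
  qed
next
  case False
  have "n - 2 * j = (3 * n - 2 * j) + 2 * n * (- 1)" by simp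
  then have "(n - 2 * j) mod (2 * n) = (3 * n - 2 * j) mod (2 * n)" by (simp only: mod_mult_self2)
  also have "\<dots> = 3 * n - 2 * j" by (rule mod_pos_pos_trivial) (use False j in simp_all)
  finally have md: "(n - 2 * j) mod (2 * n) = 3 * n - 2 * j" .
  have t: "apex_tri d n j = (n - j, j, j + 1)" unfolding apex_tri_def Let_def md using j by simp
  have U: "hgt n h (n - j) = 0 \<and> dep n h (n - j) = n - j" by (rule hgtU) (use False j hb in linarith)+
  consider "j + 1 < h" | "j = h - 1" | "h \<le> j" "j \<le> n - 2" | "j = n - 1" using j by linarith
  then show ?thesis
  proof cases
    case 1
    have "hgt n h j = 0 \<and> dep n h j = j" "hgt n h (j + 1) = 0 \<and> dep n h (j + 1) = j + 1"
      by (rule hgtU; use 1 j in linarith)+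
    moreover have "j \<notin> {1..n - h} \<union> {h..n - 2}" using 1 False hb by auto
    ultimately show ?thesis unfolding t gpot_def using U by (auto simp: tri_pot_def)
  next
    case 2
    have "hgt n h j = 0 \<and> dep n h j = h - 1" using hgtU[of j] 2 j by simp
    moreover have "hgt n h (j + 1) = 1 \<and> dep n h (j + 1) = n - h" using hgtV[of h] hb 2 by simp
    ultimately have "g (n - j, j, j + 1) = wA m (n - j - (n - h)) (h - 1 - (n - h))"
      unfolding gpot_def using U by (simp add: tri_pot_def)
    moreover have "n - j - (n - h) = 1" "h - 1 - (n - h) = 2 * h - 1 - n" using 2 by simp_all
    \<comment> \<open>By the choice of \<open>h\<close>, the right argument is \<open>m - 1\<close>
      or \<open>m\<close>.\<close>
    moreover have "wA m 1 (2 * h - 1 - n) \<le> 0"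
      using h m3 by (elim disjE) (simp_all add: wA_def fL_def fR_def)
    ultimately have le: "g (n - j, j, j + 1) \<le> 0" by metis
    have "j \<notin> {1..n - h} \<union> {h..n - 2}" using 2 False hb by auto
    then show ?thesis unfolding t using le by (simp only: if_False)
  next
    case 3
    have "hgt n h j = 1 \<and> dep n h j = n - j" "hgt n h (j + 1) = 1 \<and> dep n h (j + 1) = n - (j + 1)"
      by (rule hgtV; use 3 j in linarith)+
    then show ?thesis unfolding t gpot_def using U 3 wA01 by (simp add: tri_pot_def)
  next
    case 4
    have "hgt n h j = 1 \<and> dep n h j = 1" using hgtV[of j] 4 hb by simp
    moreover have "hgt n h (j + 1) = 2 \<and> dep n h (j + 1) = 0" using hgtU2[of n] 4 hb m3 by simp
    moreover have "j \<notin> {1..n - h} \<union> {h..n - 2}" using 4 False hb by auto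
    ultimately show ?thesis unfolding t gpot_def using U 4 m3 by (auto simp: tri_pot_def pU_def)
  qed
qed

text \<open>Typical triangles now have depth differences \<open>m - 1\<close> and \<open>m\<close>,
  which the reflection sends to 1 and 0. The exception \<open>j = h - 1\<close> is the triangle on
  the diameter: depending on the parity of \<open>n + m\<close> its value is
  \<open>cU m m = m\<close> or \<open>cV m (m - 1) = - m\<close>, and the loss in the second case is
  conceded.\<close>

lemma tri_plus:
  assumes j: "0 \<le> j" "j < n" "2 \<le> (m - 1 - 2 * j) mod (2 * n)"
  shows "(if j \<in> {m..h - 2} \<union> {h..n - 2} then 5 * m - 3 else 0) - (if j = h - 1 then m else 0) \<le> g (apex_tri d (m - 1) j)"
proof (cases "2 * j \<le> m - 1")
  case True
  have md: "(m - 1 - 2 * j) mod (2 * n) = m - 1 - 2 * j" by (rule mod_pos_pos_trivial) (use True j mn in simp_all)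
  have t: "apex_tri d (m - 1) j = (j, j + 1, m - 1 - j)" unfolding apex_tri_def Let_def md using j mn by simp
  have 2: "2 \<le> m - 1 - 2 * j" using j(3) md by simp
  have U: "hgt n h j = 0" "hgt n h (j + 1) = 0" "hgt n h (m - 1 - j) = 0"
    using hgtU[of j] hgtU[of "j + 1"] hgtU[of "m - 1 - j"] 2 j hb by simp_all
  have "j \<notin> {m..h - 2} \<union> {h..n - 2}" "j \<noteq> h - 1" using 2 j hb by auto
  then show ?thesis unfolding t gpot_def using U by (auto simp: tri_pot_def)
next
  case False
  have "m - 1 - 2 * j = (2 * n + m - 1 - 2 * j) + 2 * n * (- 1)" by simp
  then have "(m - 1 - 2 * j) mod (2 * n) = (2 * n + m - 1 - 2 * j) mod (2 * n)" by (simp only: mod_mult_self2)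
  also have "\<dots> = 2 * n + m - 1 - 2 * j" by (rule mod_pos_pos_trivial) (use False j m3 in simp_all)
  finally have md: "(m - 1 - 2 * j) mod (2 * n) = 2 * n + m - 1 - 2 * j" .
  show ?thesis
  proof (cases "n + m - 1 \<le> 2 * j")
    case True
    have t: "apex_tri d (m - 1) j = (j, j + 1, 2 * n + m - 1 - j)" unfolding apex_tri_def Let_def md using True by simp
    consider "j = h - 1" | "h \<le> j" "j \<le> n - 2" | "j = n - 1" using True j hb by linarith
    then show ?thesis
    proof cases
      case 1
      have 2: "2 * h = n + m + 1" using True 1 h by simp
      have "hgt n h j = 0 \<and> dep n h j = h - 1" using hgtU[of j] 1 j by simp
      moreover have "hgt n h (j + 1) = 1 \<and> dep n h (j + 1) = n - h" using hgtV[of h] hb 1 by simp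
      moreover have "hgt n h (2 * n + m - 1 - j) = 2 \<and> dep n h (2 * n + m - 1 - j) = h - 1"
        using hgtU2[of "2 * n + m - 1 - j"] 1 2 hb m3 by simp
      moreover have "cU m (h - 1 - (n - h)) = m" using 2 m3 by (simp add: cU_def)
      moreover have "j \<notin> {m..h - 2} \<union> {h..n - 2}" using 1 by auto
      ultimately show ?thesis unfolding t gpot_def using 1 m3 by (simp add: tri_pot_def)
    next
      case 2
      have "hgt n h j = 1 \<and> dep n h j = n - j" "hgt n h (j + 1) = 1 \<and> dep n h (j + 1) = n - (j + 1)"
        by (rule hgtV; use 2 j in linarith)+
      moreover have "hgt n h (2 * n + m - 1 - j) = 2 \<and> dep n h (2 * n + m - 1 - j) = 2 * n + m - 1 - j - n"
        by (rule hgtU2) (use 2 j hb m3 in simp_all)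
      ultimately show ?thesis unfolding t gpot_def using 2 wA01 by (simp add: tri_pot_def)
    next
      case 3
      have "hgt n h j = 1 \<and> dep n h j = 1" using hgtV[of j] 3 hb by simp
      moreover have "hgt n h (j + 1) = 2 \<and> dep n h (j + 1) = 0" using hgtU2[of n] 3 hb m3 by simp
      moreover have "hgt n h (2 * n + m - 1 - j) = 2 \<and> dep n h (2 * n + m - 1 - j) = m"
        using hgtU2[of "n + m"] 3 hb m3 by (simp add: algebra_simps)
      moreover have "wA m 1 (m + 1) \<le> 0" using m3 by (simp add: wA_def fL_def fR_def)
      moreover have "j \<notin> {m..h - 2} \<union> {h..n - 2}" "j \<noteq> h - 1" using 3 hb by auto
      ultimately show ?thesis unfolding t gpot_def using m3 by (auto simp: tri_pot_def algebra_simps)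
    qed
  next
    case F: False
    have t: "apex_tri d (m - 1) j = (m - 1 - j, j, j + 1)" unfolding apex_tri_def Let_def md using F by simp
    have jh: "j \<le> h - 1" using F hb by linarith
    have Uj: "hgt n h j = 0 \<and> dep n h j = j" by (rule hgtU) (use j jh in linarith)+
    consider "j \<le> m - 1" | "m \<le> j" "j \<le> h - 2" | "m \<le> j" "j = h - 1" using jh by linarith
    then show ?thesis
    proof cases
      case 1
      have "hgt n h (m - 1 - j) = 0" "hgt n h (j + 1) = 0" using hgtU[of "m - 1 - j"] hgtU[of "j + 1"] 1 j hb by simp_all
      moreover have "j \<notin> {m..h - 2} \<union> {h..n - 2}" using 1 hb by auto
      moreover have "j \<noteq> h - 1" using 1 hb by linarith
      ultimately show ?thesis unfolding t gpot_def using Uj by (auto simp: tri_pot_def)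
    next
      case 2
      have "hgt n h (j + 1) = 0 \<and> dep n h (j + 1) = j + 1" by (rule hgtU) (use 2 j in linarith)+
      moreover have "hgt n h (m - 1 - j) = - 1 \<and> dep n h (m - 1 - j) = - (m - 1 - j)" by (rule hgtV0) (use 2 hb in linarith)+
      ultimately show ?thesis unfolding t gpot_def using Uj 2 wA01 by (simp add: tri_pot_def)
    next
      case 3
      have 2: "2 * h = n + m" using F 3 h by auto
      have "hgt n h (j + 1) = 1 \<and> dep n h (j + 1) = n - h" using hgtV[of h] hb 3 by simp
      moreover have "hgt n h (m - 1 - j) = - 1 \<and> dep n h (m - 1 - j) = n - h"
        using hgtV0[of "m - 1 - j"] 2 3 hb by (simp add: algebra_simps)
      moreover have "cV m (h - 1 - (n - h)) = - m"
      proof -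
        have "h - 1 - (n - h) = m - 1" using 2 by simp
        then show ?thesis using m3 by (simp add: cV_def)
      qed
      moreover have "j \<notin> {m..h - 2} \<union> {h..n - 2}" using 3 by auto
      ultimately show ?thesis unfolding t gpot_def using Uj 3 by (simp add: tri_pot_def)
    qed
  qed
qed

definition F :: "nat set set \<Rightarrow> int" where
  "F T = fsum n g (tris (arcs_of d T))"

lemma F_minus: "F (zigzag d n) \<le> - ((n - m - 2) * (5 * m - 3))"
proof -
  let ?J = "{j\<in>{0..<n}. 2 \<le> (n - 2 * j) mod (2 * n)}" and ?I = "{1..n - h} \<union> {h..n - 2}"
  have fin: "finite ?J" by (rule finite_subset[of _ "{0..<n}"]) auto
  have IJ: "?I \<subseteq> ?J"
  proof
    fix j assume "j \<in> ?I"
    then consider "1 \<le> j" "j \<le> n - h" | "h \<le> j" "j \<le> n - 2" by auto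
    then show "j \<in> ?J"
    proof cases
      case 1
      have "(n - 2 * j) mod (2 * n) = n - 2 * j" by (rule mod_pos_pos_trivial) (use 1 hb in simp_all)
      then show ?thesis using 1 hb m3 by simp
    next
      case 2
      have "n - 2 * j = (3 * n - 2 * j) + 2 * n * (- 1)" by simp
      then have "(n - 2 * j) mod (2 * n) = (3 * n - 2 * j) mod (2 * n)" by (simp only: mod_mult_self2)
      also have "\<dots> = 3 * n - 2 * j" by (rule mod_pos_pos_trivial) (use 2 hb in simp_all)
      finally show ?thesis using 2 hb m3 by simp
    qed
  qed
  have "card ?I = card {1..n - h} + card {h..n - 2}" by (rule card_Un_disjoint) (use hb in auto)
  \<comment> \<open>This is \<open>2 * n - 2 * h - 1\<close>, at least \<open>n - m - 2\<close>
    since \<open>2 * h\<close> is at most \<open>n + m + 1\<close>.\<close>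
  then have card: "int (card ?I) = (n - h) + (n - 1 - h)" using hb by simp
  have "F (zigzag d n) = (\<Sum>j\<in>?J. g (apex_tri d n j))"
    unfolding F_def by (rule fsum_zigzag[OF dpos g_inv])
  also have "\<dots> \<le> (\<Sum>j\<in>?J. if j \<in> ?I then - (5 * m - 3) else 0)" by (rule sum_mono, rule tri_minus) auto
  also have "\<dots> = (\<Sum>j\<in>?J \<inter> ?I. - (5 * m - 3))" by (rule sum.inter_restrict[OF fin, symmetric])
  also have "\<dots> = - (int (card ?I) * (5 * m - 3))"
    unfolding Int_absorb1[OF IJ] sum_constant mult_minus_right by (rule refl)
  also have "\<dots> \<le> - ((n - m - 2) * (5 * m - 3))"
    using mult_right_mono[of "n - m - 2" "int (card ?I)" "5 * m - 3"] card hb m3 by simp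
  finally show ?thesis .
qed

lemma F_plus: "(n - m - 2) * (5 * m - 3) - m \<le> F (zigzag d (m - 1))"
proof -
  let ?J = "{j\<in>{0..<n}. 2 \<le> (m - 1 - 2 * j) mod (2 * n)}" and ?I = "{m..h - 2} \<union> {h..n - 2}"
  have fin: "finite ?J" by (rule finite_subset[of _ "{0..<n}"]) auto
  have IJ: "?I \<subseteq> ?J"
  proof
    fix j assume "j \<in> ?I"
    then have j: "m \<le> j" "j \<le> n - 2" using hb by auto
    have "m - 1 - 2 * j = (2 * n + m - 1 - 2 * j) + 2 * n * (- 1)" by simp
    then have "(m - 1 - 2 * j) mod (2 * n) = (2 * n + m - 1 - 2 * j) mod (2 * n)" by (simp only: mod_mult_self2)
    also have "\<dots> = 2 * n + m - 1 - 2 * j" by (rule mod_pos_pos_trivial) (use j m3 in simp_all)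
    finally show "j \<in> ?J" using j m3 by simp
  qed
  have "card ?I = card {m..h - 2} + card {h..n - 2}" by (rule card_Un_disjoint) auto
  \<comment> \<open>Here \<open>h\<close> cancels, and the count is exactly
    \<open>n - m - 2\<close>.\<close>
  then have card: "int (card ?I) = (h - 1 - m) + (n - 1 - h)" using hb by simp
  have "(n - m - 2) * (5 * m - 3) - m = int (card ?I) * (5 * m - 3) - m" using card by simp
  also have "\<dots> = (\<Sum>j\<in>?J \<inter> ?I. 5 * m - 3) - m" using IJ by (simp add: Int_absorb1)
  also have "\<dots> = (\<Sum>j\<in>?J. if j \<in> ?I then 5 * m - 3 else 0) - m" by (simp only: sum.inter_restrict[OF fin])
  also have "\<dots> \<le> (\<Sum>j\<in>?J. if j \<in> ?I then 5 * m - 3 else 0) - (\<Sum>j\<in>?J. if j = h - 1 then m else 0)"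
    using fin m3 by (simp add: sum.delta)
  also have "\<dots> = (\<Sum>j\<in>?J. (if j \<in> ?I then 5 * m - 3 else 0) - (if j = h - 1 then m else 0))" by (rule sum_subtractf[symmetric])
  also have "\<dots> \<le> (\<Sum>j\<in>?J. g (apex_tri d (m - 1) j))" by (rule sum_mono, rule tri_plus) auto
  also have "\<dots> = F (zigzag d (m - 1))"
    unfolding F_def by (rule fsum_zigzag[OF dpos g_inv, symmetric])
  finally show ?thesis .
qed

lemma F_flip:
  assumes "T \<in> symmetric_triangulations d" "T' \<in> symmetric_triangulations d" "flip d T T'"
  shows "\<bar>F T' - F T\<bar> \<le> 4 * m"
  unfolding F_def by (rule potential_flip[OF assms g_inv gpot_quad gpot_diameter]) (use m3 in simp_all)

end

section \<open>From the potential to the diameter\<close>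

text \<open>Along a walk \<open>P\<close> rises by at most the number of arcs, and
  \<open>\<mu>\<close> is the infimum over all walks. If there is no walk, that infimum is infinite
  and the bound is trivial.\<close>

lemma potential_le_diameter:
  fixes G :: "('a, 'b) pre_digraph"
  assumes G: "wf_digraph G" and u: "u \<in> verts G" "v \<in> verts G"
    and step: "\<And>e. e \<in> arcs G \<Longrightarrow> P (head G e) \<le> P (tail G e) + (1::real)"
  shows "ereal (P v - P u) \<le> graph_diameter G"
proof -
  interpret wf_digraph G by fact
  have walk: "P y \<le> P x + awalk_cost (\<lambda>_. 1) p" if "awalk x p y" for x p y
    using that
  proof (induction p arbitrary: x)
    case Nil then show ?case by (simp add: awalk_Nil_iff)
  next
    case (Cons e p)
    then have "e \<in> arcs G" "x = tail G e" "awalk (head G e) p y" by (simp_all add: awalk_Cons_iff)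
    then show ?case using Cons.IH[of "head G e"] step[of e] by simp
  qed
  have "ereal (P v - P u) \<le> \<mu> (\<lambda>_. 1) u v"
    unfolding \<mu>_def by (rule INF_greatest) (use walk in \<open>fastforce simp: algebra_simps\<close>)
  also have "\<dots> \<le> (SUP v\<in>verts G. \<mu> (\<lambda>_. 1) u v)" by (rule SUP_upper) fact
  also have "\<dots> \<le> graph_diameter G" unfolding graph_diameter_def by (rule SUP_upper[of u]) fact
  finally show ?thesis .
qed

text \<open>Here \<open>x\<close> is the square root of \<open>d\<close>. The cubic terms cancel,
  and the quadratic rest \<open>2 * (x - m) * (3 * x - 5 * m)\<close> vanishes at
  \<open>x = m\<close>, thanks to the coefficient 4 of the square root in the theorem. The deviation
  \<open>e\<close> of \<open>x\<close> from \<open>m\<close> is paid for by the linear rest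
  \<open>- 11 * m - 6\<close>.\<close>

lemma numeric_bound:
  fixes x m :: real
  assumes m: "3 \<le> m" and x: "m - 0.6 \<le> x" "x < m + 1"
  shows "4 * m * (5 * x\<^sup>2 / 2 - 4 * x - 4) \<le> 2 * ((x\<^sup>2 + 1 - m - 2) * (5 * m - 3)) - m"
proof -
  define e where "e = x - m"
  have e: "- 0.6 \<le> e" "e < 1" using x unfolding e_def by auto
  have "e\<^sup>2 \<le> 1" using e by (simp add: abs_square_le_1 abs_le_iff)
  moreover have "- (e * m) \<le> 0.6 * m" using mult_right_mono[of "- 0.6" e m] e m by simp
  ultimately have q: "3 * e\<^sup>2 / 2 - e * m \<le> 11 * m / 4 + 3 / 2" using m by simp
  have a: "4 * m * (5 * x\<^sup>2 / 2 - 4 * x - 4) - (2 * ((x\<^sup>2 + 1 - m - 2) * (5 * m - 3)) - m)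
      = 4 * (3 * e\<^sup>2 / 2 - e * m - 11 * m / 4 - 3 / 2)"
    unfolding e_def by (simp add: power2_eq_square field_simps)
  have "4 * m * (5 * x\<^sup>2 / 2 - 4 * x - 4) - (2 * ((x\<^sup>2 + 1 - m - 2) * (5 * m - 3)) - m) \<le> 0"
    unfolding a using q by simp
  then show ?thesis by (simp only: diff_le_0_iff_le)
qed

theorem corollary2:
  fixes d :: nat
  assumes "d > 0"
  shows "graph_diameter (with_proj (cyclohedron_graph d))
           \<ge> ereal (5 * real d / 2 - 4 * sqrt (real d) - 4)"
proof -
  let ?G = "with_proj (cyclohedron_graph d)"
  interpret pair_graph "cyclohedron_graph d" by (rule pair_graph_cyclohedron_graph)
  have wf: "wf_digraph ?G" by unfold_locales
  have V: "zigzag d k \<in> verts ?G" for k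
    using zigzag_symmetric_triangulation by (simp add: cyclohedron_graph_def)
  have sq: "sqrt (real d) ^ 2 = real d" by simp
  show ?thesis
  \<comment> \<open>Up to 5 the claimed bound is not positive, and a constant potential
    suffices.\<close>
  proof (cases "d \<le> 5")
    case True
    have "0 \<le> graph_diameter ?G"
      using potential_le_diameter[OF wf V V, where P = "\<lambda>_. 0"] by (simp add: zero_ereal_def)
    moreover have "5 * real d / 2 - 4 * sqrt (real d) - 4 \<le> 0"
    proof -
      \<comment> \<open>The square of 9/4 is 81/16, just above 5.\<close>
      have "sqrt (real d) \<le> 9 / 4" by (rule real_le_lsqrt) (use True in \<open>simp_all add: power2_eq_square\<close>)
      then have "sqrt (real d) * sqrt (real d) \<le> 9 / 4 * sqrt (real d)" by (rule mult_right_mono) simp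
      then have "real d \<le> 9 / 4 * sqrt (real d)" by simp
      then show ?thesis using \<open>sqrt (real d) \<le> 9 / 4\<close> by linarith
    qed
    ultimately show ?thesis by (metis ereal_less_eq(3) order_trans zero_ereal_def)
  next
    case False
    \<comment> \<open>For \<open>d\<close> from 6 to 8 the rounded root is only 2, while the
      potential requires \<open>m\<close> to be at least 3. In this range \<open>m\<close> exceeds
      the root by at most 0.6, which is where that constant in \<open>numeric_bound\<close> comes
      from.\<close>
    define m where "m = max 3 \<lfloor>sqrt (real d)\<rfloor>"
    define h where "h = (int d + m + 2) div 2"
    \<comment> \<open>The square of 2.4 is 5.76, below 6.\<close>
    have x24: "2.4 \<le> sqrt (real d)" by (rule real_le_rsqrt) (use False in \<open>simp add: power2_eq_square\<close>)
    have fl: "of_int \<lfloor>sqrt (real d)\<rfloor> \<le> sqrt (real d)" "sqrt (real d) < of_int \<lfloor>sqrt (real d)\<rfloor> + 1" by linarith+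
    have mx: "real_of_int m - 0.6 \<le> sqrt (real d) \<and> sqrt (real d) < real_of_int m + 1"
    proof (cases "3 \<le> \<lfloor>sqrt (real d)\<rfloor>")
      case True
      then have "m = \<lfloor>sqrt (real d)\<rfloor>" unfolding m_def by simp
      then show ?thesis using fl by linarith
    next
      case f: False
      then have "m = 3" unfolding m_def by simp
      moreover have "real_of_int \<lfloor>sqrt (real d)\<rfloor> \<le> 2" using f by linarith
      ultimately show ?thesis using fl x24 by (simp; linarith)
    qed
    have m3: "m \<ge> 3" unfolding m_def by simp
    have mn: "m + 2 \<le> int d + 1"
    proof (cases "\<lfloor>sqrt (real d)\<rfloor> \<le> 3")
      case True then show ?thesis using False unfolding m_def by simp
    next
      case f: False
      then have m: "real_of_int m \<le> sqrt (real d)" "4 \<le> m" using fl unfolding m_def by (auto simp: max_def)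
      have "4 \<le> sqrt (real d)" using m by linarith
      then have "4 * sqrt (real d) \<le> sqrt (real d) * sqrt (real d)" by (rule mult_right_mono) simp
      then have "4 * real_of_int m \<le> real d" using m by simp
      then show ?thesis using m by linarith
    qed
    interpret shifted_zigzags d m h
      by unfold_locales (use m3 mn in \<open>auto simp: h_def\<close>)
    have "ereal (real_of_int (F (zigzag d (m - 1))) / (4 * real_of_int m) - real_of_int (F (zigzag d (int d + 1))) / (4 * real_of_int m)) \<le> graph_diameter ?G"
    proof (rule potential_le_diameter[where P = "\<lambda>T. real_of_int (F T) / (4 * real_of_int m)", OF wf V V])
      fix e assume "e \<in> arcs ?G"
      then have "\<bar>F (snd e) - F (fst e)\<bar> \<le> 4 * m"
        by (intro F_flip) (auto simp: cyclohedron_graph_def)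
      then have "real_of_int (F (snd e)) \<le> real_of_int (F (fst e)) + 4 * real_of_int m" by linarith
      then show "real_of_int (F (head ?G e)) / (4 * real_of_int m) \<le> real_of_int (F (tail ?G e)) / (4 * real_of_int m) + 1"
        using m3 by (simp add: field_simps)
    qed
    moreover have "5 * real d / 2 - 4 * sqrt (real d) - 4 \<le> real_of_int (F (zigzag d (m - 1))) / (4 * real_of_int m) - real_of_int (F (zigzag d (int d + 1))) / (4 * real_of_int m)"
    proof -
      have "2 * ((int d + 1 - m - 2) * (5 * m - 3)) - m \<le> F (zigzag d (m - 1)) - F (zigzag d (int d + 1))"
        using F_minus F_plus by linarith
      then have "real_of_int (2 * ((int d + 1 - m - 2) * (5 * m - 3)) - m) \<le> real_of_int (F (zigzag d (m - 1)) - F (zigzag d (int d + 1)))"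
        by (rule of_int_le_iff[THEN iffD2])
      moreover have "4 * real_of_int m * (5 * real d / 2 - 4 * sqrt (real d) - 4) \<le> 2 * ((real d + 1 - m - 2) * (5 * m - 3)) - m"
        using numeric_bound[of m "sqrt (real d)"] m3 mx unfolding sq by simp
      ultimately have "(5 * real d / 2 - 4 * sqrt (real d) - 4) * (4 * real_of_int m) \<le> real_of_int (F (zigzag d (m - 1)) - F (zigzag d (int d + 1)))"
        by (simp add: algebra_simps)
      then have "5 * real d / 2 - 4 * sqrt (real d) - 4 \<le> real_of_int (F (zigzag d (m - 1)) - F (zigzag d (int d + 1))) / (4 * real_of_int m)"
        using m3 by (subst pos_le_divide_eq) simp_all
      then show ?thesis by (simp add: diff_divide_distrib)
    qed
    ultimately show ?thesis by (meson ereal_less_eq(3) order_trans)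
  qed
qed

end
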